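(* Let $\frac1{r_1},\ldots,\frac1{r_{m+1}}\in(0,1]$ and $\frac1{p_1},\ldots,\frac1{p_{m+1}}\in[0,1]$ with $\frac1{p_j}<\frac1{r_j}$ for all $j$ and $\sum_{j=1}^{m+1}\frac1{p_j}=1$. Let $w_1,\ldots,w_{m+1}$ be weights with $\prod_{j=1}^{m+1}w_j=1$ and $\pmb w\in A_{\pmb p,(\pmb r,\infty)}$. Let $f_j\in L^{p_j}(w_j^{p_j})$ for $j=1,\dots,m+1$, and let $\frac1{q_1},\ldots,\frac1{q_{m+1}}\in[0,1]$ with $\frac1{q_j}\le\frac1{r_j}$ and $\sum_{j=1}^{m+1}\frac1{q_j}=1$. Then there are weights $W_1,\ldots,W_{m+1}$ with $\prod_{j=1}^{m+1}W_j=1$ and $\pmb W\in A_{\pmb q,(\pmb r,\infty)}$ such that \[ \prod_{j=1}^{m+1}\|f_j\|_{L^{q_j}(W_j^{q_j})}\le2^{m^2}\prod_{j=1}^{m+1}\|f_j\|_{L^{p_j}(w_j^{p_j})} \] and \[ [\pmb W]_{\pmb q,(\pmb r,\infty)}\le C_{\pmb p,\pmb q,\pmb r}[\pmb w]_{\pmb p,(\pmb r,\infty)}^{\max_{j=1,\ldots,m+1}\frac{1/r_j-1/q_j}{1/r_j-1/p_j}}, \] where $C_{\pmb p,\pmb q,\pmb r}$ depends only on $\pmb p,\pmb q,\pmb r$ and $n$.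
   Context: Weights are measurable $w:\mathbb R^n\to(0,\infty)$. For $p\in(0,\infty]$, $\|f\|_{L^p(w^p)}:=\|fw\|_{L^p}$. For a cube $Q$, $\langle f\rangle_{t,Q}=(\frac1{|Q|}\int_Q|f|^t)^{1/t}$ ($0<t<\infty$), $\langle f\rangle_{\infty,Q}=\operatorname{ess\,sup}_Q|f|$. Boldface denotes $(m+1)$-tuples. For weights with $\prod_{j=1}^{m+1}w_j=1$ and $\frac1{p_j}\le\frac1{r_j}$, $[\pmb w]_{\pmb p,(\pmb r,\infty)}:=\sup_Q\prod_{j=1}^{m+1}\langle w_j^{-1}\rangle_{t_j,Q}$ with $\frac1{t_j}=\frac1{r_j}-\frac1{p_j}$ (reciprocal $0$ meaning exponent $\infty$), sup over cubes; $\pmb w\in A_{\pmb p,(\pmb r,\infty)}$ means finiteness. *)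

theory Defs
  imports "HOL-Probability.Probability"
begin

definition epowr :: "ennreal \<Rightarrow> real \<Rightarrow> ennreal" where
  "epowr x a = (if x = \<infinity> then \<infinity> else ennreal (enn2real x powr a))"

text \<open>Lebesgue norm parametrised by the reciprocal exponent s = 1/p in [0,1]:
  s = 0 means p = infinity (essential supremum).\<close>
definition Lnorm :: "real \<Rightarrow> ('a::euclidean_space \<Rightarrow> real) \<Rightarrow> ennreal" where
  "Lnorm s g =
     (if g \<notin> borel_measurable lebesgue then \<infinity>
      else if s = 0 then esssup lebesgue (\<lambda>x. ennreal \<bar>g x\<bar>)
      else epowr (\<integral>\<^sup>+ x. ennreal (\<bar>g x\<bar> powr (1 / s)) \<partial>lebesgue) s)"

text \<open>Weighted norm: the norm of f in L^p(w^p) is the L^p norm of f w.\<close>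
definition wnorm :: "real \<Rightarrow> ('a::euclidean_space \<Rightarrow> real) \<Rightarrow> ('a \<Rightarrow> real) \<Rightarrow> ennreal" where
  "wnorm s w f = Lnorm s (\<lambda>x. f x * w x)"

definition cubes :: "'a::euclidean_space set set" where
  "cubes = {cbox x (x + h *\<^sub>R One) | x h. h > 0}"

text \<open>Average <g>_{t,Q}, parametrised by u = 1/t; u = 0 means t = infinity.\<close>
definition avg :: "real \<Rightarrow> 'a::euclidean_space set \<Rightarrow> ('a \<Rightarrow> real) \<Rightarrow> ennreal" where
  "avg u Q g =
     (if u = 0 then esssup lebesgue (\<lambda>x. ennreal (indicator Q x * \<bar>g x\<bar>))
      else epowr (ennreal (1 / measure lebesgue Q) *
                  (\<integral>\<^sup>+ x\<in>Q. ennreal (\<bar>g x\<bar> powr (1 / u)) \<partial>lebesgue)) u)"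

definition weight :: "('a::euclidean_space \<Rightarrow> real) \<Rightarrow> bool" where
  "weight w \<longleftrightarrow> w \<in> borel_measurable lebesgue \<and> (\<forall>x. w x > 0)"

text \<open>The characteristic [w]_{p,(r,infinity)} for an (m+1)-tuple indexed by {0..m},
  with ip j = 1/p_j, ir j = 1/r_j; the exponent t_j has 1/t_j = 1/r_j - 1/p_j.\<close>
definition Achar :: "nat \<Rightarrow> (nat \<Rightarrow> real) \<Rightarrow> (nat \<Rightarrow> real) \<Rightarrow> (nat \<Rightarrow> 'a::euclidean_space \<Rightarrow> real) \<Rightarrow> ennreal" where
  "Achar m ip ir w = (SUP Q\<in>cubes. \<Prod>j\<le>m. avg (ir j - ip j) Q (\<lambda>x. 1 / w j x))"

end

theory Submission
  imports Defs
begin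

text \<open>Put $a_j = 1/r_j - 1/p_j$, $b_j = 1/r_j - 1/q_j$ and $s_j = w_j^{-1/a_j}$. All new weights are
  $W_j = w_j H^{1/q_j-1/p_j}$ for a single positive $H \in L^1$; since
  $\sum_j 1/p_j = \sum_j 1/q_j$, their product is again 1. If $H$ dominates the normalised functions
  $|f_j w_j|^{p_j}$ for the indices with $1/q_j < 1/p_j$, Hoelder's inequality bounds the product of the
  norms by a power of $\int H$, which is at most twice the number of these indices.

  The characteristic of $W$ is controlled if moreover $H$ dominates a small multiple of
  $\sum_k N_k(\sum_i N_i H)$, where $N_j G = s_j \cdot M_j((G/s_j)^{1/\kappa_j})^{\kappa_j}$, with $M_j$ the
  dyadic maximal operator with respect to $s_j\,dx$ and suitable $\kappa_j > 1$. By Doob's maximal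
  inequality each $N_j$ is bounded on $L^1$ with a norm depending on $\kappa_j$ and the dimension only,
  so such an $H$ arises from a monotone iteration. Arbitrary cubes are reduced to dyadic ones by the
  one-third trick.\<close>

section \<open>Maximal functions of laminar families\<close>

text \<open>The averages of H depend on the f_j and are not controlled by the characteristic of w,
  so they must cancel completely in the product of the averages of the 1/W_j. Where b_j > a_j, a
  positive power of H is averaged and its weighted mean n_j appears; at the other indices the power
  is negative, and only a pointwise lower bound of H on the cube can help. That bound has to contain
  all the n_j at once, with prescribed exponents. This is why the operator is applied twice: Y =
  sum_i N_i H dominates every s_i n_i on a cell, hence also their geometric means, and the outer
  application turns weighted means of Y into lower bounds for H. The only pointwise relation between
  the weights that enters is prod_j s_j^(a_j) = 1, which holds because prod_j w_j = 1. The factor 2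
  in the bound for the integral of H has two sources: a summand of mass at most 1/2 that makes H
  positive everywhere, and the damping 1/4 of the iteration, which costs 4/3. For k >= 1 one has 4/3
  * (k + 1/2) <= 2 k.\<close>

lemma epowr_ennreal [simp]: "0 \<le> x \<Longrightarrow> epowr (ennreal x) a = ennreal (x powr a)"
  by (simp add: epowr_def)

lemma epowr_0 [simp]: "epowr 0 a = 0"
  by (simp add: epowr_def)

lemma epowr_top [simp]: "epowr \<top> a = \<top>"
  by (simp add: epowr_def)

lemma epowr_one [simp]: "epowr x 1 = x"
  by (cases x) auto

lemma epowr_mono: "x \<le> y \<Longrightarrow> 0 \<le> a \<Longrightarrow> epowr x a \<le> epowr y a"
  by (cases x; cases y) (auto simp: top_unique intro!: ennreal_leI powr_mono2)

lemma epowr_epowr: "epowr (epowr x a) b = epowr x (a * b)"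
  by (cases x) (auto simp: powr_powr)

lemma epowr_mult: "0 < a \<Longrightarrow> epowr (x * y) a = epowr x a * epowr y a"
  by (cases x; cases y)
     (auto simp: powr_mult ennreal_mult_top ennreal_top_mult ennreal_eq_0_iff simp flip: ennreal_mult)

lemma epowr_add: "0 < a \<Longrightarrow> 0 < b \<Longrightarrow> epowr x (a + b) = epowr x a * epowr x b"
  by (cases x) (auto simp: powr_add simp flip: ennreal_mult)

text \<open>For a > 0 the power is an order isomorphism of [0, top]. In this adjoint form it yields
  continuity along arbitrary suprema (\<open>epowr_SUP\<close>), on which the maximal operators and
  the monotone iteration rely.\<close>

lemma epowr_le_iff:
  assumes "0 < a" shows "epowr x a \<le> y \<longleftrightarrow> x \<le> epowr y (1 / a)"
proof
  assume "epowr x a \<le> y"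
  then have "epowr (epowr x a) (1 / a) \<le> epowr y (1 / a)"
    using assms by (intro epowr_mono) auto
  then show "x \<le> epowr y (1 / a)" using assms by (simp add: epowr_epowr)
next
  assume "x \<le> epowr y (1 / a)"
  then have "epowr x a \<le> epowr (epowr y (1 / a)) a"
    using assms by (intro epowr_mono) auto
  then show "epowr x a \<le> y" using assms by (simp add: epowr_epowr)
qed

lemma epowr_SUP:
  assumes "0 < a" shows "epowr (SUP i\<in>I. f i) a = (SUP i\<in>I. epowr (f i) a)"
proof (rule antisym)
  show "epowr (SUP i\<in>I. f i) a \<le> (SUP i\<in>I. epowr (f i) a)"
    by (subst epowr_le_iff[OF assms], rule SUP_least)
       (auto simp flip: epowr_le_iff[OF assms] intro: SUP_upper)
  show "(SUP i\<in>I. epowr (f i) a) \<le> epowr (SUP i\<in>I. f i) a"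
    using assms by (intro SUP_least epowr_mono SUP_upper) auto
qed

lemma borel_measurable_epowr [measurable]:
  assumes [measurable]: "f \<in> borel_measurable M"
  shows "(\<lambda>x. epowr (f x) a) \<in> borel_measurable M"
  unfolding epowr_def by measurable

text \<open>Besides countability and measurability, this is what Doob's inequality uses of a dyadic
  grid. Ascending chains are not assumed to stop, since a grid contains cells of every size.\<close>

definition laminar :: "'a set set \<Rightarrow> bool" where
  "laminar F \<longleftrightarrow> (\<forall>R\<in>F. \<forall>R'\<in>F. R \<subseteq> R' \<or> R' \<subseteq> R \<or> R \<inter> R' = {})"

lemma laminar_subset: "laminar F \<Longrightarrow> G \<subseteq> F \<Longrightarrow> laminar G"
  unfolding laminar_def by blast

text \<open>A covering argument without loss: the sets that meet a maximal \<open>R\<close> lie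
  inside \<open>R\<close>, so \<open>R\<close> splits off disjointly from the rest, and integrals
  over disjoint sets add up. Hence the constant 1.\<close>

lemma laminar_finite_Union_le:
  assumes "finite S" "S \<subseteq> sets M" "laminar S"
    and [measurable]: "\<phi> \<in> borel_measurable M"
    and "\<And>R. R \<in> S \<Longrightarrow> t * emeasure M R \<le> (\<integral>\<^sup>+x\<in>R. \<phi> x \<partial>M)"
  shows "t * emeasure M (\<Union>S) \<le> (\<integral>\<^sup>+x\<in>\<Union>S. \<phi> x \<partial>M)"
  using assms(1-3,5)
proof (induction S rule: finite_psubset_induct)
  case (psubset S)
  show ?case
  proof (cases "S = {}")
    case False
    then obtain R where R: "R \<in> S" "\<And>R'. R' \<in> S \<Longrightarrow> R \<subseteq> R' \<Longrightarrow> R = R'"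
      using finite_has_maximal[OF \<open>finite S\<close>] by blast
    \<comment> \<open>Removing \<open>R\<close> explicitly matters for the empty set, which is
      disjoint from itself; without it \<open>S'\<close> might not be a proper subset.\<close>
    define S' where "S' = {R'\<in>S. R' \<inter> R = {}} - {R}"
    have un: "\<Union>S = R \<union> \<Union>S'"
      using R psubset.prems(2) unfolding S'_def laminar_def by blast
    have disj: "R \<inter> \<Union>S' = {}" unfolding S'_def by blast
    have [measurable]: "R \<in> sets M" "\<Union>S' \<in> sets M"
      using R psubset.prems(1) \<open>finite S\<close> unfolding S'_def by (auto intro!: sets.finite_Union)
    have IH: "t * emeasure M (\<Union>S') \<le> (\<integral>\<^sup>+x\<in>\<Union>S'. \<phi> x \<partial>M)"
    proof (rule psubset.IH)
      show "S' \<subset> S" using R(1) unfolding S'_def by blast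
      then show "laminar S'" "S' \<subseteq> sets M" "\<And>R. R \<in> S' \<Longrightarrow> t * emeasure M R \<le> (\<integral>\<^sup>+x\<in>R. \<phi> x \<partial>M)"
        using psubset.prems laminar_subset[of S S'] by auto
    qed
    have "t * emeasure M (\<Union>S) = t * emeasure M R + t * emeasure M (\<Union>S')"
      unfolding un using disj by (subst plus_emeasure[symmetric]) (auto simp: distrib_left)
    also have "\<dots> \<le> (\<integral>\<^sup>+x\<in>R. \<phi> x \<partial>M) + (\<integral>\<^sup>+x\<in>\<Union>S'. \<phi> x \<partial>M)"
      using IH psubset.prems(3) R(1) by (intro add_mono) auto
    also have "\<dots> = (\<integral>\<^sup>+x\<in>\<Union>S. \<phi> x \<partial>M)"
    proof -
      have "indicator (R \<union> \<Union>S') x = (indicator R x + indicator (\<Union>S') x :: ennreal)" for x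
        using disj by (auto simp: indicator_def)
      then show ?thesis
        unfolding un by (subst nn_integral_add[symmetric]) (auto intro!: nn_integral_cong simp: distrib_left)
    qed
    finally show ?thesis .
  qed simp
qed

text \<open>An infinite family may have no maximal members, so its union is exhausted by finite
  subfamilies; the finite bound does not depend on their size and passes to the limit.\<close>

lemma laminar_countable_Union_le:
  assumes "countable S" "S \<subseteq> sets M" "laminar S"
    and [measurable]: "\<phi> \<in> borel_measurable M"
    and "\<And>R. R \<in> S \<Longrightarrow> t * emeasure M R \<le> (\<integral>\<^sup>+x\<in>R. \<phi> x \<partial>M)"
  shows "t * emeasure M (\<Union>S) \<le> (\<integral>\<^sup>+x. \<phi> x \<partial>M)"
proof (cases "S = {}")
  case False
  define A where "A n = \<Union>(from_nat_into S ` {..n})" for n :: nat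
  have sub: "from_nat_into S ` {..n} \<subseteq> S" for n
    using False from_nat_into by blast
  have A: "range A \<subseteq> sets M"
    using sub assms(2) unfolding A_def by (auto intro!: sets.finite_Union)
  have inc: "incseq A" unfolding A_def incseq_def by force
  have "\<Union>S = (\<Union>n. A n)"
    unfolding A_def using range_from_nat_into[OF False assms(1)] by blast
  then have "t * emeasure M (\<Union>S) = (SUP n. t * emeasure M (A n))"
    using SUP_emeasure_incseq[OF A inc] by (simp flip: SUP_mult_left_ennreal)
  also have "\<dots> \<le> (\<integral>\<^sup>+x. \<phi> x \<partial>M)"
  proof (rule SUP_least)
    fix n
    have "t * emeasure M (A n) \<le> (\<integral>\<^sup>+x\<in>A n. \<phi> x \<partial>M)"
      unfolding A_def using sub[of n] assms
      by (intro laminar_finite_Union_le) (auto intro: laminar_subset)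
    also have "\<dots> \<le> (\<integral>\<^sup>+x. \<phi> x \<partial>M)"
      by (intro nn_integral_mono) (auto simp: indicator_def)
    finally show "t * emeasure M (A n) \<le> (\<integral>\<^sup>+x. \<phi> x \<partial>M)" .
  qed
  finally show ?thesis .
qed simp

text \<open>Since 0 / 0 = 0 and x / top = 0 in \<open>ennreal\<close>, cells of measure zero or
  infinity contribute 0. Measures with a density that fails to be locally integrable are thereby
  covered.\<close>

definition maxop :: "'a measure \<Rightarrow> 'a set set \<Rightarrow> ('a \<Rightarrow> ennreal) \<Rightarrow> 'a \<Rightarrow> ennreal" where
  "maxop M F \<phi> x = (SUP R\<in>F. indicator R x * ((\<integral>\<^sup>+y\<in>R. \<phi> y \<partial>M) / emeasure M R))"

lemma borel_measurable_maxop [measurable]: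
  assumes "countable F" "F \<subseteq> sets M"
  shows "maxop M F \<phi> \<in> borel_measurable M"
  unfolding maxop_def using assms by (intro borel_measurable_SUP) auto

text \<open>The superlevel set is the union of the cells with average above \<open>t\<close>, so the
  covering bound applies to it directly.\<close>

lemma maxop_weak_type:
  assumes "countable F" "F \<subseteq> sets M" "laminar F"
    and [measurable]: "\<phi> \<in> borel_measurable M"
  shows "t * emeasure M {x\<in>space M. t < maxop M F \<phi> x} \<le> (\<integral>\<^sup>+x. \<phi> x \<partial>M)"
proof -
  define S where "S = {R\<in>F. t < (\<integral>\<^sup>+y\<in>R. \<phi> y \<partial>M) / emeasure M R}"
  have S: "S \<subseteq> F" unfolding S_def by auto
  have eq: "{x\<in>space M. t < maxop M F \<phi> x} = \<Union>S"
    unfolding maxop_def S_def using sets.sets_into_space assms(2)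
    by (auto simp: less_SUP_iff indicator_def split: if_splits)
  have "t * emeasure M R \<le> (\<integral>\<^sup>+x\<in>R. \<phi> x \<partial>M)" if "R \<in> S" for R
  proof -
    have "t < (\<integral>\<^sup>+y\<in>R. \<phi> y \<partial>M) / emeasure M R" using that unfolding S_def by auto
    then have "t * emeasure M R \<le> (\<integral>\<^sup>+y\<in>R. \<phi> y \<partial>M) / emeasure M R * emeasure M R"
      by (intro mult_right_mono) auto
    also have "\<dots> \<le> (\<integral>\<^sup>+y\<in>R. \<phi> y \<partial>M)"
    proof (cases "emeasure M R = 0 \<or> emeasure M R = \<top>")
      case False
      then have "emeasure M R / emeasure M R = 1" by (intro ennreal_divide_self) (auto simp: less_top)
      then show ?thesis by (simp add: ennreal_divide_times)
    qed auto
    finally show ?thesis .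
  qed
  then show ?thesis
    unfolding eq using S assms by (intro laminar_countable_Union_le) (auto intro: laminar_subset countable_subset)
qed

text \<open>Averages of the part of \<phi> below the level \<open>t\<close> are at most
  \<open>t\<close>. Hence a value of the maximal function above 2 t forces the truncated function to
  have one above \<open>t\<close>, and the weak-type bound may be applied to the truncation
  alone.\<close>

lemma maxop_truncate:
  assumes "F \<subseteq> sets M" and [measurable]: "\<phi> \<in> borel_measurable M"
  shows "maxop M F \<phi> x \<le> t + maxop M F (\<lambda>y. \<phi> y * indicator {y. t < \<phi> y} y) x"
  unfolding maxop_def
proof (rule SUP_least)
  fix R assume R: "R \<in> F"
  let ?g = "\<lambda>y. \<phi> y * indicator {y. t < \<phi> y} y"
  have [measurable]: "R \<in> sets M" using R assms by auto
  have "(\<integral>\<^sup>+y\<in>R. \<phi> y \<partial>M) \<le> (\<integral>\<^sup>+y. t * indicator R y + ?g y * indicator R y \<partial>M)"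
    by (intro nn_integral_mono) (auto simp: indicator_def)
  also have "\<dots> = t * emeasure M R + (\<integral>\<^sup>+y\<in>R. ?g y \<partial>M)"
    by (subst nn_integral_add) (auto simp: nn_integral_cmult_indicator)
  finally have "(\<integral>\<^sup>+y\<in>R. \<phi> y \<partial>M) / emeasure M R \<le> (t * emeasure M R + (\<integral>\<^sup>+y\<in>R. ?g y \<partial>M)) / emeasure M R"
    by (rule divide_right_mono_ennreal)
  also have "\<dots> = t * emeasure M R / emeasure M R + (\<integral>\<^sup>+y\<in>R. ?g y \<partial>M) / emeasure M R"
    by (rule add_divide_distrib_ennreal)
  also have "\<dots> \<le> t + (\<integral>\<^sup>+y\<in>R. ?g y \<partial>M) / emeasure M R"
  proof (intro add_right_mono)
    show "t * emeasure M R / emeasure M R \<le> t"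
      by (cases "emeasure M R = 0 \<or> emeasure M R = \<top>") (auto simp: ennreal_mult_divide_eq)
  qed
  finally have *: "(\<integral>\<^sup>+y\<in>R. \<phi> y \<partial>M) / emeasure M R \<le> t + (\<integral>\<^sup>+y\<in>R. ?g y \<partial>M) / emeasure M R" .
  have "indicator R x * ((\<integral>\<^sup>+y\<in>R. \<phi> y \<partial>M) / emeasure M R)
      \<le> t + indicator R x * ((\<integral>\<^sup>+y\<in>R. ?g y \<partial>M) / emeasure M R)"
    using * by (auto simp: indicator_def)
  also have "\<dots> \<le> t + (SUP R\<in>F. indicator R x * ((\<integral>\<^sup>+y\<in>R. ?g y \<partial>M) / emeasure M R))"
    using R by (intro add_left_mono SUP_upper2[of R]) auto
  finally show "indicator R x * ((\<integral>\<^sup>+y\<in>R. \<phi> y \<partial>M) / emeasure M R)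
      \<le> t + (SUP R\<in>F. indicator R x * ((\<integral>\<^sup>+y\<in>R. ?g y \<partial>M) / emeasure M R))" .
qed

text \<open>Discrete layer-cake formula. For finite positive \<open>y\<close> a single level
  suffices, one with 2 * 2^j < y <= 4 * 2^j; hence 4^p. The extra factor 2 in the threshold matches
  truncation at half that threshold. For infinite \<open>y\<close> every level counts and the terms
  are unbounded.\<close>

lemma epowr_le_dyadic_sum:
  fixes y :: ennreal assumes p: "0 < p"
  shows "epowr y p \<le> (\<integral>\<^sup>+j. ennreal (4 powr p) * (ennreal (2 powr (p * real_of_int j)) *
            indicator {j::int. 2 * ennreal (2 powr j) < y} j) \<partial>count_space UNIV)"
    (is "_ \<le> nn_integral _ ?f")
proof -
  have pt: "?f j \<le> nn_integral (count_space UNIV) ?f" for j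
    by (intro nn_integral_ge_point) auto
  show ?thesis
  proof (cases y)
    case (real r)
    show ?thesis
    proof (cases "r = 0")
      case False
      then have r: "0 < r" using real by simp
      \<comment> \<open>Ceiling minus 2 rather than a floor, because the indicator asks for the
        strict inequality 2 * 2^j < r.\<close>
      define j where "j = \<lceil>log 2 r\<rceil> - 2"
      have j: "real_of_int j + 1 < log 2 r" "log 2 r \<le> real_of_int j + 2"
        unfolding j_def by linarith+
      have "2 powr (real_of_int j + 1) < r" "r \<le> 2 powr (real_of_int j + 2)"
        using j r by (simp_all add: less_log_iff log_le_iff)
      then have *: "2 * (2 powr (real_of_int j)) < r" "r \<le> 4 * 2 powr (real_of_int j)"
        by (simp_all add: powr_add)
      have "r powr p \<le> (4 * 2 powr (real_of_int j)) powr p"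
        using * r p by (intro powr_mono2) auto
      also have "\<dots> = 4 powr p * 2 powr (p * real_of_int j)"
        by (simp add: powr_mult powr_powr mult.commute)
      finally have "epowr y p \<le> ?f j"
        using real * r by (simp flip: ennreal_mult ennreal_numeral add: ennreal_less_iff)
      then show ?thesis using pt order_trans by blast
    qed (use real in simp)
  next
    case top
    have "of_nat n \<le> nn_integral (count_space UNIV) ?f" for n
    proof -
      obtain j :: nat where "real n / p \<le> real j" using real_arch_simple by blast
      then have "real n \<le> p * real j" using p by (simp add: field_simps)
      moreover have "real n \<le> 2 powr (real n)"
        using of_nat_less_two_power[of n, where 'a=real] by (simp add: powr_realpow)
      moreover have "2 powr (real n) \<le> 2 powr (p * real j)" using calculation by simp
      moreover have "1 * 2 powr (p * real j) \<le> 4 powr p * 2 powr (p * real j)"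
        using p by (intro mult_right_mono) (auto intro: ge_one_powr_ge_zero)
      ultimately have "real n \<le> 4 powr p * 2 powr (p * real j)" by linarith
      moreover have "2 * ennreal (2 powr real j) < \<top>"
        by (simp add: ennreal_mult_less_top)
      ultimately have "of_nat n \<le> ?f (int j)"
        using top by (simp add: ennreal_leI ennreal_of_nat_eq_real_of_nat flip: ennreal_mult)
      then show ?thesis using pt order_trans by blast
    qed
    then have "\<forall>n. of_nat n \<le> nn_integral (count_space UNIV) ?f" by blast
    then have "nn_integral (count_space UNIV) ?f = \<top>"
    proof (rule contrapos_pp)
      assume "nn_integral (count_space UNIV) ?f \<noteq> \<top>"
      then obtain n :: nat where "nn_integral (count_space UNIV) ?f < of_nat n"
        using ennreal_Ex_less_of_nat top.not_eq_extremum by blast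
      then show "\<not> (\<forall>n. of_nat n \<le> nn_integral (count_space UNIV) ?f)"
        using not_le by blast
    qed
    then show ?thesis by simp
  qed
qed

text \<open>For finite positive \<open>y\<close> the levels below \<open>y\<close> form a half-line
  of integers, so the sum is geometric with ratio 2^(-q), and its largest term is at most
  y^q.\<close>

lemma dyadic_sum_le_epowr:
  fixes y :: ennreal assumes q: "0 < q"
  shows "(\<integral>\<^sup>+j. ennreal (2 powr (q * real_of_int j)) * indicator {j::int. ennreal (2 powr j) < y} j \<partial>count_space UNIV)
     \<le> ennreal (1 / (1 - 2 powr (- q))) * epowr y q"
proof -
  have c: "2 powr (- q) < 1" using q by (simp add: powr_less_one)
  show ?thesis
  proof (cases y)
    case (real r)
    show ?thesis
    proof (cases "r = 0")
      case True
      then show ?thesis using real by simp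
    next
      case False
      then have r: "0 < r" using real by simp
      define J where "J = \<lceil>log 2 r\<rceil> - 1"
      have iff: "2 powr (real_of_int j) < r \<longleftrightarrow> j \<le> J" for j :: int
        using r unfolding J_def by (subst less_log_iff[symmetric]) (auto, linarith+)
      have set: "{j::int. ennreal (2 powr j) < y} = {..J}"
        using iff real by (auto simp: ennreal_less_iff)
      have bij: "bij_betw (\<lambda>n::nat. J - int n) UNIV {..J}"
        by (rule bij_betwI[where g="\<lambda>j. nat (J - j)"]) auto
      have geo: "(\<lambda>n. 2 powr (q * J) * (2 powr (- q)) ^ n) sums (2 powr (q * J) * (1 / (1 - 2 powr (- q))))"
        using c by (intro sums_mult geometric_sums) auto
      have "(\<integral>\<^sup>+j. ennreal (2 powr (q * real_of_int j)) * indicator {j::int. ennreal (2 powr j) < y} j \<partial>count_space UNIV)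
          = (\<integral>\<^sup>+j. ennreal (2 powr (q * real_of_int j)) \<partial>count_space {..J})"
        unfolding set by (simp add: nn_integral_count_space_indicator)
      also have "\<dots> = (\<integral>\<^sup>+n. ennreal (2 powr (q * real_of_int (J - int n))) \<partial>count_space UNIV)"
        by (rule nn_integral_bij_count_space[OF bij, symmetric])
      also have "\<dots> = (\<Sum>n. ennreal (2 powr (q * real_of_int (J - int n))))"
        by (rule nn_integral_count_space_nat)
      also have "\<dots> = (\<Sum>n. ennreal (2 powr (q * J) * (2 powr (- q)) ^ n))"
        by (intro suminf_cong arg_cong[where f=ennreal])
           (simp add: powr_powr algebra_simps flip: powr_realpow powr_add)
      also have "\<dots> = ennreal (2 powr (q * J) * (1 / (1 - 2 powr (- q))))"
        using geo by (intro suminf_ennreal_eq) auto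
      also have "\<dots> \<le> ennreal (1 / (1 - 2 powr (- q)) * r powr q)"
      proof (intro ennreal_leI)
        have "2 powr (q * J) = (2 powr (real_of_int J)) powr q" by (simp add: powr_powr mult.commute)
        also have "\<dots> \<le> r powr q" using iff[of J] q by (intro powr_mono2) auto
        finally show "2 powr (q * J) * (1 / (1 - 2 powr (- q))) \<le> 1 / (1 - 2 powr (- q)) * r powr q"
          using c by (subst mult.commute, intro mult_left_mono) auto
      qed
      also have "\<dots> = ennreal (1 / (1 - 2 powr (- q))) * epowr y q"
        using c real by (simp flip: ennreal_mult)
      finally show ?thesis .
    qed
  next
    case top
    then show ?thesis using c q by (simp add: ennreal_mult_top)
  qed
qed

text \<open>Interpolation of Marcinkiewicz type: at level 2^j the weak-type bound is applied to the
  truncation \<open>g j\<close>. Of 2^(p j) one factor 2^j is spent there; what remains at each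
  point is the sum of 2^((p-1) j) over 2^j < \<phi> x, which converges because p > 1. Discrete
  levels make the interchange of integrals one with a counting measure, which works over any
  \<open>M\<close>.\<close>

lemma maxop_strong_type:
  assumes F: "countable F" "F \<subseteq> sets M" "laminar F" and p: "1 < p"
    and [measurable]: "\<phi> \<in> borel_measurable M"
  shows "(\<integral>\<^sup>+x. epowr (maxop M F \<phi> x) p \<partial>M)
    \<le> ennreal (4 powr p / (1 - 2 powr (1 - p))) * (\<integral>\<^sup>+x. epowr (\<phi> x) p \<partial>M)"
proof -
  note [measurable] = borel_measurable_maxop[OF F(1,2)]
  let ?N = "count_space (UNIV :: int set)"
  define g where "g j = (\<lambda>y. \<phi> y * indicator {y. ennreal (2 powr j) < \<phi> y} y)" for j :: int
  have [measurable]: "g j \<in> borel_measurable M" for j unfolding g_def by measurable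
  have weak: "ennreal (2 powr j) * emeasure M {x\<in>space M. 2 * ennreal (2 powr j) < maxop M F \<phi> x} \<le> integral\<^sup>N M (g j)"
    for j :: int
  proof -
    have "emeasure M {x\<in>space M. 2 * ennreal (2 powr j) < maxop M F \<phi> x}
        \<le> emeasure M {x\<in>space M. ennreal (2 powr j) < maxop M F (g j) x}"
    proof (intro emeasure_mono Collect_mono impI conjI; (elim conjE)?)
      fix x assume "2 * ennreal (2 powr j) < maxop M F \<phi> x"
      then have "ennreal (2 powr j) + ennreal (2 powr j) < ennreal (2 powr j) + maxop M F (g j) x"
        using maxop_truncate[OF F(2), of \<phi> x "ennreal (2 powr j)"] unfolding g_def
        by (simp add: mult_2 less_le_trans)
      then show "ennreal (2 powr j) < maxop M F (g j) x"
        by (meson add_left_mono not_le)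
    qed auto
    then show ?thesis
      using maxop_weak_type[OF F, of "g j" "ennreal (2 powr j)"]
      by (meson mult_left_mono order_trans zero_le \<open>g j \<in> _\<close>)
  qed
  have "(\<integral>\<^sup>+x. epowr (maxop M F \<phi> x) p \<partial>M)
      \<le> (\<integral>\<^sup>+x. \<integral>\<^sup>+j. ennreal (4 powr p) * (ennreal (2 powr (p * real_of_int j)) *
            indicator {j::int. 2 * ennreal (2 powr j) < maxop M F \<phi> x} j) \<partial>?N \<partial>M)"
    using p by (intro nn_integral_mono epowr_le_dyadic_sum) auto
  also have "\<dots> = (\<integral>\<^sup>+x. \<integral>\<^sup>+j. ennreal (4 powr p) * (ennreal (2 powr (p * real_of_int j)) *
            indicator {x\<in>space M. 2 * ennreal (2 powr j) < maxop M F \<phi> x} x) \<partial>?N \<partial>M)"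
    by (intro nn_integral_cong) (auto simp: indicator_def)
  also have "\<dots> = (\<integral>\<^sup>+j. \<integral>\<^sup>+x. ennreal (4 powr p) * (ennreal (2 powr (p * real_of_int j)) *
            indicator {x\<in>space M. 2 * ennreal (2 powr j) < maxop M F \<phi> x} x) \<partial>M \<partial>?N)"
    by (intro nn_integral_count_space_nn_integral) auto
  also have "\<dots> = (\<integral>\<^sup>+j. ennreal (4 powr p) * (ennreal (2 powr ((p - 1) * real_of_int j)) * (ennreal (2 powr j) *
            emeasure M {x\<in>space M. 2 * ennreal (2 powr j) < maxop M F \<phi> x})) \<partial>?N)"
  proof (intro nn_integral_cong, goal_cases)
    case (1 j)
    have "ennreal (2 powr (p * j)) = ennreal (2 powr ((p - 1) * real_of_int j)) * ennreal (2 powr j)"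
      by (simp add: algebra_simps flip: ennreal_mult powr_add)
    then show ?case by (simp add: nn_integral_cmult mult.assoc)
  qed
  also have "\<dots> \<le> (\<integral>\<^sup>+j. ennreal (4 powr p) * (ennreal (2 powr ((p - 1) * real_of_int j)) * integral\<^sup>N M (g j)) \<partial>?N)"
    by (intro nn_integral_mono mult_left_mono weak) auto
  also have "\<dots> = (\<integral>\<^sup>+j. \<integral>\<^sup>+x. ennreal (4 powr p) * (ennreal (2 powr ((p - 1) * real_of_int j)) * g j x) \<partial>M \<partial>?N)"
    by (intro nn_integral_cong) (simp add: nn_integral_cmult)
  also have "\<dots> = (\<integral>\<^sup>+x. \<integral>\<^sup>+j. ennreal (4 powr p) * (ennreal (2 powr ((p - 1) * real_of_int j)) * g j x) \<partial>?N \<partial>M)"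
    by (intro nn_integral_count_space_nn_integral[symmetric]) auto
  also have "\<dots> = (\<integral>\<^sup>+x. ennreal (4 powr p) * (\<phi> x * (\<integral>\<^sup>+j. ennreal (2 powr ((p - 1) * real_of_int j)) *
        indicator {j::int. ennreal (2 powr j) < \<phi> x} j \<partial>?N)) \<partial>M)"
    by (intro nn_integral_cong) (auto simp: g_def indicator_def ac_simps simp flip: nn_integral_cmult intro!: nn_integral_cong)
  also have "\<dots> \<le> (\<integral>\<^sup>+x. ennreal (4 powr p) * (\<phi> x * (ennreal (1 / (1 - 2 powr (- (p - 1)))) * epowr (\<phi> x) (p - 1))) \<partial>M)"
    using p by (intro nn_integral_mono mult_left_mono dyadic_sum_le_epowr) auto
  also have "\<dots> = (\<integral>\<^sup>+x. ennreal (4 powr p / (1 - 2 powr (1 - p))) * epowr (\<phi> x) p \<partial>M)"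
  proof (intro nn_integral_cong, goal_cases)
    case (1 x)
    have c: "2 powr (1 - p) < 1" using p by (simp add: powr_less_one)
    have "epowr (\<phi> x) p = \<phi> x * epowr (\<phi> x) (p - 1)"
      using epowr_add[of 1 "p - 1" "\<phi> x"] p by simp
    moreover have "ennreal (4 powr p / (1 - 2 powr (1 - p))) = ennreal (4 powr p) * ennreal (1 / (1 - 2 powr (- (p - 1))))"
      using c by (simp flip: ennreal_mult)
    ultimately show ?case by (simp add: ac_simps)
  qed
  also have "\<dots> = ennreal (4 powr p / (1 - 2 powr (1 - p))) * (\<integral>\<^sup>+x. epowr (\<phi> x) p \<partial>M)"
    by (intro nn_integral_cmult) auto
  finally show ?thesis .
qed

section \<open>Shifted dyadic grids\<close>

text \<open>The sign alternates with the level so that twice a shift differs from the next shift by an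
  integer; otherwise cells of successive levels would not be nested.\<close>

definition grid_shift :: "'a::euclidean_space set \<Rightarrow> int \<Rightarrow> 'a \<Rightarrow> real" where
  "grid_shift t j i = (if i \<in> t then (if even j then 1 / 3 else - (1 / 3)) else 0)"

text \<open>Larger \<open>j\<close> is finer: cells of level \<open>j\<close> have side 2^(-j), and
  all integers occur. The set \<open>t\<close> records the shifted coordinates. Describing cells by
  floors reduces nestedness to arithmetic of floors.\<close>

definition grid_index :: "'a::euclidean_space set \<Rightarrow> int \<Rightarrow> 'a \<Rightarrow> 'a \<Rightarrow> int" where
  "grid_index t j y i = \<lfloor>2 powr j * (y \<bullet> i) - grid_shift t j i\<rfloor>"

definition grid_cell :: "'a::euclidean_space set \<Rightarrow> int \<Rightarrow> ('a \<Rightarrow> int) \<Rightarrow> 'a set" where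
  "grid_cell t j k = {y. \<forall>i\<in>Basis. grid_index t j y i = k i}"

definition grid :: "'a::euclidean_space set \<Rightarrow> 'a set set" where
  "grid t = {grid_cell t j k | j k. True}"

definition grids :: "'a::euclidean_space set set" where
  "grids = (\<Union>t\<in>Pow Basis. grid t)"

text \<open>The scaled and shifted coordinate of level j + 1 is twice that of level \<open>j\<close>
  plus an integer (in a shifted coordinate 2/3 + 1/3 for even \<open>j\<close>, its negative for odd
  \<open>j\<close>), and the floor of 2 A determines the floor of A. So the finer index determines
  the coarser one.\<close>

lemma grid_index_refine:
  assumes "grid_index t (j + 1) y i = grid_index t (j + 1) z i"
  shows "grid_index t j y i = grid_index t j z i"
proof -
  obtain c :: int where c: "2 * grid_shift t j i - grid_shift t (j + 1) i = of_int c"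
  proof
    show "2 * grid_shift t j i - grid_shift t (j + 1) i =
        of_int (if i \<in> t then (if even j then 1 else -1) else 0)"
      by (simp add: grid_shift_def)
  qed
  have eq: "2 powr (j + 1) * (x \<bullet> i) - grid_shift t (j + 1) i
      = 2 * (2 powr j * (x \<bullet> i) - grid_shift t j i) + of_int c" for x
    using c by (simp add: powr_add algebra_simps)
  have "\<lfloor>2 * (2 powr j * (y \<bullet> i) - grid_shift t j i)\<rfloor> = \<lfloor>2 * (2 powr j * (z \<bullet> i) - grid_shift t j i)\<rfloor>"
    using assms unfolding grid_index_def eq by simp
  moreover have "\<lfloor>A\<rfloor> = \<lfloor>2 * A\<rfloor> div 2" for A :: real
    using floor_divide_real_eq_div[of 2 "2 * A"] by simp
  ultimately show ?thesis unfolding grid_index_def by metis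
qed

lemma grid_index_coarser:
  assumes "j \<le> j'" "grid_index t j' y i = grid_index t j' z i"
  shows "grid_index t j y i = grid_index t j z i"
  using assms
  by (induction j' rule: int_ge_induct) (auto dest: grid_index_refine)

text \<open>A common point fixes the index vectors of both cells; agreement on the finer level
  propagates to the coarser one, so the finer cell is contained in the other.\<close>

lemma laminar_grid: "laminar (grid t)"
proof -
  have *: "grid_cell t j' k' \<subseteq> grid_cell t j k"
    if "j \<le> j'" "z \<in> grid_cell t j k" "z \<in> grid_cell t j' k'" for j j' k k' z
  proof
    fix y assume y: "y \<in> grid_cell t j' k'"
    show "y \<in> grid_cell t j k"
      unfolding grid_cell_def
    proof (intro CollectI ballI)
      fix i :: 'a assume "i \<in> Basis"
      then show "grid_index t j y i = k i"
        using that y grid_index_coarser[of j j' t y i z] unfolding grid_cell_def by simp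
    qed
  qed
  have "R \<subseteq> R' \<or> R' \<subseteq> R \<or> R \<inter> R' = {}" if "R \<in> grid t" "R' \<in> grid t" for R R'
  proof -
    obtain j k j' k' where R: "R = grid_cell t j k" "R' = grid_cell t j' k'"
      using \<open>R \<in> grid t\<close> \<open>R' \<in> grid t\<close> unfolding grid_def by blast
    show ?thesis
    proof (cases "R \<inter> R' = {}")
      case False
      then obtain z where "z \<in> grid_cell t j k" "z \<in> grid_cell t j' k'" unfolding R by blast
      then show ?thesis
        using *[of j j' z k k'] *[of j' j z k' k] linear[of j j'] unfolding R by blast
    qed simp
  qed
  then show ?thesis unfolding laminar_def by blast
qed

lemma countable_grid: "countable (grid t)"
proof -
  have "grid t \<subseteq> (\<lambda>(j, k). grid_cell t j k) ` (UNIV \<times> (Basis \<rightarrow>\<^sub>E UNIV))"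
  proof
    fix R assume "R \<in> grid t"
    then obtain j k where "R = grid_cell t j k" unfolding grid_def by auto
    \<comment> \<open>Values of \<open>k\<close> outside \<open>Basis\<close> do not affect the
      cell; restricting \<open>k\<close> leaves countably many index vectors.\<close>
    then have "R = (\<lambda>(j, k). grid_cell t j k) (j, restrict k Basis)"
      unfolding grid_cell_def by auto
    then show "R \<in> (\<lambda>(j, k). grid_cell t j k) ` (UNIV \<times> (Basis \<rightarrow>\<^sub>E UNIV))"
      by (rule image_eqI) auto
  qed
  moreover have "countable (UNIV \<times> (Basis \<rightarrow>\<^sub>E (UNIV :: int set)) :: (int \<times> ('a \<Rightarrow> int)) set)"
    by (intro countable_SIGMA countable_PiE) auto
  ultimately show ?thesis by (rule countable_subset[OF _ countable_image])
qed

lemma grid_cell_bounds: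
  "y \<in> grid_cell t j k \<longleftrightarrow> (\<forall>i\<in>Basis. (k i + grid_shift t j i) * 2 powr (- real_of_int j) \<le> y \<bullet> i
      \<and> y \<bullet> i < (k i + 1 + grid_shift t j i) * 2 powr (- real_of_int j))"
proof -
  have "grid_index t j y i = k i \<longleftrightarrow> (k i + grid_shift t j i) * 2 powr (- real_of_int j) \<le> y \<bullet> i
      \<and> y \<bullet> i < (k i + 1 + grid_shift t j i) * 2 powr (- real_of_int j)" for i
    unfolding grid_index_def floor_eq_iff by (auto simp: powr_minus field_simps)
  then show ?thesis unfolding grid_cell_def by simp
qed

lemma measure_lebesgue_cube:
  fixes x :: "'a::euclidean_space"
  assumes "0 \<le> h" shows "measure lebesgue (cbox x (x + h *\<^sub>R One)) = h ^ DIM('a)"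
proof -
  have "measure lebesgue (cbox x (x + h *\<^sub>R One)) = measure lborel (cbox x (x + h *\<^sub>R One))"
    by (simp add: measure_completion)
  also have "\<dots> = (\<Prod>i\<in>(Basis :: 'a set). h)"
    using assms by (subst content_cbox) (auto simp: inner_add_left)
  finally show ?thesis by simp
qed

text \<open>Nested cells have to be half-open, whereas the characteristic is a supremum over closed
  cubes. The difference is part of the boundary of a box, a null set, so integrals and essential
  suprema agree.\<close>

lemma grid_cell_AE_cube:
  fixes t :: "'a::euclidean_space set"
  obtains Q where "Q \<in> cubes" "AE x in lebesgue. x \<in> grid_cell t j k \<longleftrightarrow> x \<in> Q"
    "measure lebesgue Q = (2 powr (- real_of_int j)) ^ DIM('a)"
proof -
  define a where "a = (\<Sum>i\<in>Basis. ((k i + grid_shift t j i) * 2 powr (- real_of_int j)) *\<^sub>R i)"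
  define b where "b = a + 2 powr (- real_of_int j) *\<^sub>R One"
  have ai: "a \<bullet> i = (k i + grid_shift t j i) * 2 powr (- real_of_int j)" if "i \<in> Basis" for i
    using that unfolding a_def by simp
  have bi: "b \<bullet> i = (k i + 1 + grid_shift t j i) * 2 powr (- real_of_int j)" if "i \<in> Basis" for i
    using that unfolding b_def by (simp add: inner_add_left ai algebra_simps)
  have sub: "grid_cell t j k \<subseteq> cbox a b" "box a b \<subseteq> grid_cell t j k"
    by (auto simp: grid_cell_bounds mem_box ai bi less_imp_le)
  have "cbox a b - box a b \<in> null_sets lebesgue"
    using negligible_frontier_interval negligible_iff_null_sets by blast
  then have ae: "AE x in lebesgue. x \<in> grid_cell t j k \<longleftrightarrow> x \<in> cbox a b"
    by (rule AE_I') (use sub in auto)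
  have "cbox a b \<in> cubes" unfolding cubes_def b_def by force
  moreover have "measure lebesgue (cbox a b) = (2 powr (- real_of_int j)) ^ DIM('a)"
    unfolding b_def by (rule measure_lebesgue_cube) simp
  ultimately show thesis using ae by (intro that[of "cbox a b"]) simp_all
qed

lemma grid_cell_measurable [measurable]: "grid_cell t j k \<in> sets lebesgue"
proof -
  have "grid_cell t j k = (\<Inter>i\<in>Basis. {y. (k i + grid_shift t j i) * 2 powr (- real_of_int j) \<le> y \<bullet> i}
      \<inter> {y. y \<bullet> i < (k i + 1 + grid_shift t j i) * 2 powr (- real_of_int j)})"
    by (auto simp: grid_cell_bounds)
  also have "\<dots> \<in> sets borel"
    by (intro sets.finite_INT sets.Int) (auto intro!: borel_closed borel_open closed_halfspace_component_ge open_halfspace_component_lt)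
  finally show ?thesis by (metis sets_completionI_sets sets_lborel)
qed

lemma grids_sets: "R \<in> grids \<Longrightarrow> R \<in> sets lebesgue"
  unfolding grids_def grid_def by auto

lemma cube_measure:
  assumes "Q \<in> cubes"
  shows "Q \<in> sets lebesgue" "emeasure lebesgue Q < \<infinity>" "0 < measure lebesgue Q"
proof -
  obtain x h where Q: "Q = cbox x (x + h *\<^sub>R One)" "h > 0"
    using assms unfolding cubes_def by blast
  show "Q \<in> sets lebesgue" "emeasure lebesgue Q < \<infinity>" unfolding Q by (auto simp: emeasure_lborel_cbox_eq)
  show "0 < measure lebesgue Q" unfolding Q(1) using measure_lebesgue_cube[of h x] Q(2) by simp
qed

text \<open>If (u, u + \<eta>] contains an integer then, having length at most 1/3, it contains no
  point of Z + s, because Z and Z + s are at distance 1/3.\<close>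

lemma floor_third_trick:
  fixes u :: real
  assumes "0 \<le> \<eta>" "\<eta> \<le> 1 / 3" "\<lfloor>u\<rfloor> \<noteq> \<lfloor>u + \<eta>\<rfloor>" "s = 1 / 3 \<or> s = - (1 / 3)"
  shows "\<lfloor>u + \<eta> - s\<rfloor> = \<lfloor>u - s\<rfloor>"
proof -
  define n where "n = \<lfloor>u + \<eta>\<rfloor>"
  have n: "of_int n \<le> u + \<eta>" unfolding n_def by simp
  have u: "u < of_int n"
  proof (rule ccontr)
    assume "\<not> u < of_int n"
    then have "n \<le> \<lfloor>u\<rfloor>" by (simp add: le_floor_iff)
    moreover have "\<lfloor>u\<rfloor> \<le> n" unfolding n_def using assms(1) by (intro floor_mono) simp
    ultimately show False using assms(3) n_def by simp
  qed
  show ?thesis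
    using assms(4)
  proof
    assume s: "s = 1 / 3"
    have "\<lfloor>u + \<eta> - s\<rfloor> = n - 1" "\<lfloor>u - s\<rfloor> = n - 1"
      using n u assms(1,2) unfolding s by (auto intro!: floor_unique)
    then show ?thesis by simp
  next
    assume s: "s = - (1 / 3)"
    have "\<lfloor>u + \<eta> - s\<rfloor> = n" "\<lfloor>u - s\<rfloor> = n"
      using n u assms(1,2) unfolding s by (auto intro!: floor_unique)
    then show ?thesis by simp
  qed
qed

text \<open>The one-third trick, coordinate by coordinate: a shift is switched on where the
  projection of \<open>Q\<close> crosses an unshifted grid point. These choices are independent,
  which is why \<open>grids\<close> runs over all subsets of \<open>Basis\<close>. The closed cube
  \<open>Q'\<close> is the one at which a characteristic can be evaluated.\<close>

lemma cube_subset_grids: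
  fixes Q :: "'a::euclidean_space set"
  assumes "Q \<in> cubes"
  obtains R Q' where "R \<in> grids" "Q \<subseteq> R" "Q' \<in> cubes" "AE x in lebesgue. x \<in> R \<longleftrightarrow> x \<in> Q'"
    "measure lebesgue Q' \<le> 6 ^ DIM('a) * measure lebesgue Q"
proof -
  obtain x h where Q: "Q = cbox x (x + h *\<^sub>R One)" "h > 0"
    using assms unfolding cubes_def by blast
  \<comment> \<open>The finest level whose cells have side at least 3 h. Rounding to a power of 2
    costs a factor of at most 2, so the side is at most 6 h; hence the constant
    \<open>6 ^ DIM('a)\<close>.\<close>
  define j where "j = - \<lceil>log 2 (3 * h)\<rceil>"
  have "log 2 (3 * h) \<le> - j" "- j < log 2 (3 * h) + 1"
    unfolding j_def by linarith+
  then have "3 * h \<le> 2 powr (- real_of_int j)" "2 powr (- real_of_int j) \<le> 2 powr (log 2 (3 * h) + 1)"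
    using Q(2) by (simp_all add: log_le_iff)
  then have j: "3 * h \<le> 2 powr (- real_of_int j)" "2 powr (- real_of_int j) \<le> 6 * h"
    using Q(2) by (simp_all add: powr_add)
  define \<eta> where "\<eta> = 2 powr j * h"
  have \<eta>: "0 \<le> \<eta>" "\<eta> \<le> 1 / 3"
    using j(1) Q(2) unfolding \<eta>_def by (auto simp: powr_minus field_simps)
  define t where "t = {i\<in>Basis. \<lfloor>2 powr j * (x \<bullet> i)\<rfloor> \<noteq> \<lfloor>2 powr j * (x \<bullet> i) + \<eta>\<rfloor>}"
  have "y \<in> grid_cell t j (grid_index t j x)" if "y \<in> Q" for y
    unfolding grid_cell_def
  proof (intro CollectI ballI)
    fix i :: 'a assume i: "i \<in> Basis"
    have yi: "x \<bullet> i \<le> y \<bullet> i" "y \<bullet> i \<le> x \<bullet> i + h"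
      using that i unfolding Q by (auto simp: mem_box inner_add_left)
    have m: "2 powr j * (x \<bullet> i) \<le> 2 powr j * (y \<bullet> i)" "2 powr j * (y \<bullet> i) \<le> 2 powr j * (x \<bullet> i) + \<eta>"
      using mult_left_mono[OF yi(1), of "2 powr j"] mult_left_mono[OF yi(2), of "2 powr j"]
      unfolding \<eta>_def by (auto simp: algebra_simps)
    have "\<lfloor>2 powr j * (x \<bullet> i) + \<eta> - grid_shift t j i\<rfloor> = \<lfloor>2 powr j * (x \<bullet> i) - grid_shift t j i\<rfloor>"
    proof (cases "i \<in> t")
      case True
      then show ?thesis
        using \<eta> unfolding t_def by (intro floor_third_trick) (auto simp: grid_shift_def)
    next
      case False
      then show ?thesis using i by (simp add: t_def grid_shift_def)
    qed
    then show "grid_index t j y i = grid_index t j x i"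
      using floor_mono[of "2 powr j * (x \<bullet> i) - grid_shift t j i" "2 powr j * (y \<bullet> i) - grid_shift t j i"]
        floor_mono[of "2 powr j * (y \<bullet> i) - grid_shift t j i" "2 powr j * (x \<bullet> i) + \<eta> - grid_shift t j i"] m
      unfolding grid_index_def by linarith
  qed
  then have "Q \<subseteq> grid_cell t j (grid_index t j x)" by blast
  moreover have "t \<subseteq> Basis" unfolding t_def by blast
  then have "grid_cell t j (grid_index t j x) \<in> grids"
    unfolding grids_def grid_def by blast
  moreover obtain Q' where Q': "Q' \<in> cubes" "AE y in lebesgue. y \<in> grid_cell t j (grid_index t j x) \<longleftrightarrow> y \<in> Q'"
    "measure lebesgue Q' = (2 powr (- real_of_int j)) ^ DIM('a)"
    by (rule grid_cell_AE_cube)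
  moreover have "(2 powr (- real_of_int j)) ^ DIM('a) \<le> 6 ^ DIM('a) * measure lebesgue Q"
  proof -
    have "(2 powr (- real_of_int j)) ^ DIM('a) \<le> (6 * h) ^ DIM('a)"
      using j(2) by (intro power_mono) auto
    then show ?thesis unfolding Q(1) using measure_lebesgue_cube[of h x] Q(2) by (simp add: power_mult_distrib)
  qed
  ultimately show thesis using that[OF _ _ Q'(1,2)] unfolding Q'(3) by blast
qed

section \<open>Weighted maximal operators on $L^1$\<close>

text \<open>With $d\mu = s\,dM$ this is $(\frac1{\mu(R)} \int_R (G/s)^{1/\kappa}\,d\mu)^{\kappa}$,
  so that \<open>wmax\<close> below is bounded on unweighted $L^1$ for every \<open>s\<close>, with a norm independent of \<open>s\<close>.\<close>

definition wmean :: "'a measure \<Rightarrow> ('a \<Rightarrow> real) \<Rightarrow> real \<Rightarrow> 'a set \<Rightarrow> ('a \<Rightarrow> ennreal) \<Rightarrow> ennreal" where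
  "wmean M s \<kappa> R G = epowr ((\<integral>\<^sup>+y\<in>R. epowr (G y) (1 / \<kappa>) * ennreal (s y powr (1 - 1 / \<kappa>)) \<partial>M)
      / (\<integral>\<^sup>+y\<in>R. ennreal (s y) \<partial>M)) \<kappa>"

definition wmax :: "'a measure \<Rightarrow> 'a set set \<Rightarrow> ('a \<Rightarrow> real) \<Rightarrow> real \<Rightarrow> ('a \<Rightarrow> ennreal) \<Rightarrow> 'a \<Rightarrow> ennreal" where
  "wmax M F s \<kappa> G x = ennreal (s x) * (SUP R\<in>F. indicator R x * wmean M s \<kappa> R G)"

lemma wmax_upper: "R \<in> F \<Longrightarrow> x \<in> R \<Longrightarrow> ennreal (s x) * wmean M s \<kappa> R G \<le> wmax M F s \<kappa> G x"
  unfolding wmax_def by (intro mult_left_mono SUP_upper2[of R]) auto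

lemma wmean_mono:
  assumes "0 < \<kappa>" "\<And>x. G x \<le> G' x"
  shows "wmean M s \<kappa> R G \<le> wmean M s \<kappa> R G'"
  unfolding wmean_def using assms
  by (intro epowr_mono divide_right_mono_ennreal nn_integral_mono mult_right_mono) auto

lemma wmean_cong_AE:
  assumes "AE x in M. G x = G' x"
  shows "wmean M s \<kappa> R G = wmean M s \<kappa> R G'"
proof -
  have "(\<integral>\<^sup>+y\<in>R. epowr (G y) (1 / \<kappa>) * ennreal (s y powr (1 - 1 / \<kappa>)) \<partial>M)
      = (\<integral>\<^sup>+y\<in>R. epowr (G' y) (1 / \<kappa>) * ennreal (s y powr (1 - 1 / \<kappa>)) \<partial>M)"
    using assms by (intro nn_integral_cong_AE) auto
  then show ?thesis unfolding wmean_def by simp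
qed

lemma wmean_SUP:
  assumes "0 < \<kappa>" "incseq G" "\<And>n::nat. G n \<in> borel_measurable M"
    and [measurable]: "s \<in> borel_measurable M" "R \<in> sets M"
  shows "wmean M s \<kappa> R (\<lambda>x. SUP n. G n x) = (SUP n. wmean M s \<kappa> R (G n))"
proof -
  note [measurable] = assms(3)
  define f where "f n y = epowr (G n y) (1 / \<kappa>) * ennreal (s y powr (1 - 1 / \<kappa>)) * indicator R y" for n y
  have "epowr (SUP n. G n y) (1 / \<kappa>) * ennreal (s y powr (1 - 1 / \<kappa>)) * indicator R y = (SUP n. f n y)" for y
    using \<open>0 < \<kappa>\<close> unfolding f_def by (simp add: epowr_SUP SUP_mult_right_ennreal)
  then have "(\<integral>\<^sup>+y\<in>R. epowr (SUP n. G n y) (1 / \<kappa>) * ennreal (s y powr (1 - 1 / \<kappa>)) \<partial>M)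
      = (\<integral>\<^sup>+y. (SUP n. f n y) \<partial>M)"
    by simp
  also have "\<dots> = (SUP n. integral\<^sup>N M (f n))"
  proof (rule nn_integral_monotone_convergence_SUP)
    show "incseq f"
      using assms(1,2) unfolding f_def incseq_def le_fun_def
      by (auto intro!: mult_right_mono epowr_mono)
    show "f n \<in> borel_measurable M" for n unfolding f_def by measurable
  qed
  finally show ?thesis
    unfolding wmean_def f_def using \<open>0 < \<kappa>\<close>
    by (simp add: divide_ennreal_def SUP_mult_right_ennreal epowr_SUP)
qed

text \<open>As G^(1/\<kappa>) s^(1 - 1/\<kappa>) = (G/s)^(1/\<kappa>) s, the weighted mean is the
  \<kappa>-th power of an ordinary mean with respect to s dM, that is, of a term in the supremum
  \<open>maxop\<close>.\<close>

lemma wmean_eq_maxop: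
  assumes \<kappa>: "1 < \<kappa>" and [measurable]: "s \<in> borel_measurable M" "G \<in> borel_measurable M" "R \<in> sets M"
    and s: "\<And>x. 0 < s x"
  shows "wmean M s \<kappa> R G = epowr ((\<integral>\<^sup>+y\<in>R. epowr (G y * ennreal (1 / s y)) (1 / \<kappa>) \<partial>density M (\<lambda>x. ennreal (s x)))
      / emeasure (density M (\<lambda>x. ennreal (s x))) R) \<kappa>"
proof -
  have key: "ennreal (s y) * epowr (ennreal (1 / s y)) (1 / \<kappa>) = ennreal (s y powr (1 - 1 / \<kappa>))" for y
    using s[of y] by (simp add: powr_diff powr_divide flip: ennreal_mult)
  have eq: "epowr (G y) (1 / \<kappa>) * ennreal (s y powr (1 - 1 / \<kappa>)) = ennreal (s y) * epowr (G y * ennreal (1 / s y)) (1 / \<kappa>)" for y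
    using \<kappa> by (simp add: epowr_mult mult.left_commute del: epowr_ennreal flip: key)
  show ?thesis
    unfolding wmean_def eq
    by (simp add: nn_integral_density emeasure_density mult.assoc)
qed

text \<open>The weight cancels twice: the outer factor \<open>s\<close> turns dM into s dM, where
  Doob's inequality with exponent \<kappa> applies, and the remaining integral of G/s against s dM
  is that of \<open>G\<close>.\<close>

lemma wmax_L1_bound:
  assumes F: "countable F" "F \<subseteq> sets M" "laminar F" and \<kappa>: "1 < \<kappa>"
    and [measurable]: "s \<in> borel_measurable M" "G \<in> borel_measurable M" and s: "\<And>x. 0 < s x"
  shows "(\<integral>\<^sup>+x. wmax M F s \<kappa> G x \<partial>M) \<le> ennreal (4 powr \<kappa> / (1 - 2 powr (1 - \<kappa>))) * (\<integral>\<^sup>+x. G x \<partial>M)"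
proof -
  let ?\<mu> = "density M (\<lambda>x. ennreal (s x))"
  define \<phi> where "\<phi> y = epowr (G y * ennreal (1 / s y)) (1 / \<kappa>)" for y
  have [measurable]: "\<phi> \<in> borel_measurable M" unfolding \<phi>_def by measurable
  have F': "F \<subseteq> sets ?\<mu>" using F by simp
  have [measurable]: "maxop ?\<mu> F \<phi> \<in> borel_measurable M"
    using borel_measurable_maxop[OF F(1) F'] by simp
  have eq: "wmax M F s \<kappa> G x = ennreal (s x) * epowr (maxop ?\<mu> F \<phi> x) \<kappa>" for x
  proof -
    have "(SUP R\<in>F. indicator R x * wmean M s \<kappa> R G)
        = (SUP R\<in>F. epowr (indicator R x * ((\<integral>\<^sup>+y\<in>R. \<phi> y \<partial>?\<mu>) / emeasure ?\<mu> R)) \<kappa>)"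
      using F(2) \<kappa> s unfolding \<phi>_def
      by (intro SUP_cong refl) (subst wmean_eq_maxop, auto simp: indicator_def)
    then show ?thesis
      unfolding wmax_def maxop_def using \<kappa> by (simp add: epowr_SUP)
  qed
  have "(\<integral>\<^sup>+x. wmax M F s \<kappa> G x \<partial>M) = (\<integral>\<^sup>+x. epowr (maxop ?\<mu> F \<phi> x) \<kappa> \<partial>?\<mu>)"
    unfolding eq by (subst nn_integral_density) auto
  also have "\<dots> \<le> ennreal (4 powr \<kappa> / (1 - 2 powr (1 - \<kappa>))) * (\<integral>\<^sup>+x. epowr (\<phi> x) \<kappa> \<partial>?\<mu>)"
    using F(1) F' F(3) \<kappa> by (intro maxop_strong_type) auto
  also have "(\<integral>\<^sup>+x. epowr (\<phi> x) \<kappa> \<partial>?\<mu>) = (\<integral>\<^sup>+x. G x \<partial>M)"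
  proof (subst nn_integral_density)
    have "ennreal (s x) * epowr (\<phi> x) \<kappa> = G x" for x
    proof -
      have "ennreal (s x) * epowr (\<phi> x) \<kappa> = G x * (ennreal (s x) * ennreal (1 / s x))"
        using \<kappa> unfolding \<phi>_def by (simp add: epowr_epowr mult.left_commute)
      also have "ennreal (s x) * ennreal (1 / s x) = 1"
        using s[of x] by (simp flip: ennreal_mult)
      finally show ?thesis by simp
    qed
    then show "(\<integral>\<^sup>+x. ennreal (s x) * epowr (\<phi> x) \<kappa> \<partial>M) = (\<integral>\<^sup>+x. G x \<partial>M)" by simp
  qed auto
  finally show ?thesis .
qed

section \<open>Bounded monotone operators on L^1 and their iteration\<close>

text \<open>These properties pass to finite sums and compositions and suffice for a monotone
  iteration. The pointwise clauses hold everywhere, so composing operators requires no care with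
  null sets. In the last clause the opposite inequality follows from monotonicity.\<close>

definition L1_operator :: "'a measure \<Rightarrow> real \<Rightarrow> (('a \<Rightarrow> ennreal) \<Rightarrow> 'a \<Rightarrow> ennreal) \<Rightarrow> bool" where
  "L1_operator M c T \<longleftrightarrow>
     (\<forall>G\<in>borel_measurable M. T G \<in> borel_measurable M) \<and>
     (\<forall>G\<in>borel_measurable M. (\<integral>\<^sup>+x. T G x \<partial>M) \<le> ennreal c * (\<integral>\<^sup>+x. G x \<partial>M)) \<and>
     (\<forall>G G'. (\<forall>x. G x \<le> G' x) \<longrightarrow> (\<forall>x. T G x \<le> T G' x)) \<and>
     (\<forall>G. incseq G \<longrightarrow> (\<forall>n::nat. G n \<in> borel_measurable M) \<longrightarrow>
        (\<forall>x. T (\<lambda>x. SUP n. G n x) x \<le> (SUP n. T (G n) x)))"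

lemma L1_operatorD:
  assumes "L1_operator M c T"
  shows "G \<in> borel_measurable M \<Longrightarrow> T G \<in> borel_measurable M"
    and "G \<in> borel_measurable M \<Longrightarrow> (\<integral>\<^sup>+x. T G x \<partial>M) \<le> ennreal c * (\<integral>\<^sup>+x. G x \<partial>M)"
    and "(\<And>x. G x \<le> G' x) \<Longrightarrow> T G x \<le> T G' x"
    and "incseq A \<Longrightarrow> (\<And>n::nat. A n \<in> borel_measurable M) \<Longrightarrow>
        T (\<lambda>x. SUP n. A n x) x \<le> (SUP n. T (A n) x)"
  using assms unfolding L1_operator_def by (blast, blast, blast, blast)

lemma L1_operator_incseq:
  assumes "L1_operator M c T" "incseq A"
  shows "incseq (\<lambda>n. T (A n))"
  using assms(2) L1_operatorD(3)[OF assms(1)] unfolding incseq_def le_fun_def by blast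

lemma L1_operator_comp:
  assumes T: "L1_operator M c T" and S: "L1_operator M d S" and "0 \<le> c" "0 \<le> d"
  shows "L1_operator M (c * d) (\<lambda>G. T (S G))"
  unfolding L1_operator_def
proof (intro conjI ballI allI impI)
  note D = L1_operatorD[OF T] L1_operatorD[OF S]
  fix G :: "'a \<Rightarrow> ennreal" and x assume G: "G \<in> borel_measurable M"
  then show "T (S G) \<in> borel_measurable M" by (intro D)
  have "(\<integral>\<^sup>+x. T (S G) x \<partial>M) \<le> ennreal c * (\<integral>\<^sup>+x. S G x \<partial>M)" using G by (intro D)
  also have "\<dots> \<le> ennreal c * (ennreal d * (\<integral>\<^sup>+x. G x \<partial>M))" using G by (intro mult_left_mono D) auto
  finally show "(\<integral>\<^sup>+x. T (S G) x \<partial>M) \<le> ennreal (c * d) * (\<integral>\<^sup>+x. G x \<partial>M)"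
    using assms by (simp add: ennreal_mult mult.assoc)
next
  fix G G' :: "'a \<Rightarrow> ennreal" and x assume "\<forall>x. G x \<le> G' x"
  then show "T (S G) x \<le> T (S G') x"
    by (intro L1_operatorD(3)[OF T] L1_operatorD(3)[OF S]) auto
next
  fix A :: "nat \<Rightarrow> 'a \<Rightarrow> ennreal" and x assume A: "incseq A" "\<forall>n. A n \<in> borel_measurable M"
  have "T (S (\<lambda>x. SUP n. A n x)) x \<le> T (\<lambda>x. SUP n. S (A n) x) x"
    using A by (intro L1_operatorD(3)[OF T] L1_operatorD(4)[OF S]) auto
  also have "\<dots> \<le> (SUP n. T (S (A n)) x)"
    using A L1_operatorD(1)[OF S] by (intro L1_operatorD(4)[OF T] L1_operator_incseq[OF S]) auto
  finally show "T (S (\<lambda>x. SUP n. A n x)) x \<le> (SUP n. T (S (A n)) x)" .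
qed

lemma L1_operator_sum:
  fixes T :: "'i \<Rightarrow> ('a \<Rightarrow> ennreal) \<Rightarrow> 'a \<Rightarrow> ennreal"
  assumes T: "\<And>i. i \<in> I \<Longrightarrow> L1_operator M (c i) (T i)" and "finite I" "\<And>i. i \<in> I \<Longrightarrow> 0 \<le> c i"
  shows "L1_operator M (\<Sum>i\<in>I. c i) (\<lambda>G x. \<Sum>i\<in>I. T i G x)"
  unfolding L1_operator_def
proof (intro conjI ballI allI impI)
  fix G :: "'a \<Rightarrow> ennreal" and x assume G: "G \<in> borel_measurable M"
  then show "(\<lambda>x. \<Sum>i\<in>I. T i G x) \<in> borel_measurable M"
    using L1_operatorD(1)[OF T] by (intro borel_measurable_sum) auto
  have "(\<integral>\<^sup>+x. (\<Sum>i\<in>I. T i G x) \<partial>M) = (\<Sum>i\<in>I. \<integral>\<^sup>+x. T i G x \<partial>M)"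
    using L1_operatorD(1)[OF T] G by (intro nn_integral_sum) auto
  also have "\<dots> \<le> (\<Sum>i\<in>I. ennreal (c i) * (\<integral>\<^sup>+x. G x \<partial>M))"
    using G by (intro sum_mono L1_operatorD(2)[OF T])
  finally show "(\<integral>\<^sup>+x. (\<Sum>i\<in>I. T i G x) \<partial>M) \<le> ennreal (\<Sum>i\<in>I. c i) * (\<integral>\<^sup>+x. G x \<partial>M)"
    using assms by (simp add: sum_distrib_right flip: sum_ennreal)
next
  fix G G' :: "'a \<Rightarrow> ennreal" and x assume "\<forall>x. G x \<le> G' x"
  then show "(\<Sum>i\<in>I. T i G x) \<le> (\<Sum>i\<in>I. T i G' x)"
    by (intro sum_mono L1_operatorD(3)[OF T]) auto
next
  fix A :: "nat \<Rightarrow> 'a \<Rightarrow> ennreal" and x assume A: "incseq A" "\<forall>n. A n \<in> borel_measurable M"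
  have "(\<Sum>i\<in>I. T i (\<lambda>x. SUP n. A n x) x) \<le> (\<Sum>i\<in>I. SUP n. T i (A n) x)"
    using A by (intro sum_mono L1_operatorD(4)[OF T]) auto
  also have "\<dots> = (SUP n. \<Sum>i\<in>I. T i (A n) x)"
    using L1_operator_incseq[OF T A(1)]
    by (intro ennreal_SUP_sum[symmetric]) (auto simp: incseq_def le_fun_def)
  finally show "(\<Sum>i\<in>I. T i (\<lambda>x. SUP n. A n x) x) \<le> (SUP n. \<Sum>i\<in>I. T i (A n) x)" .
qed

text \<open>The compositions to which this is applied are not sublinear, so the usual Rubio de Francia series is replaced by
  monotone iteration of \<open>G \<mapsto> h + T G / (4 c)\<close> from 0.\<close>

lemma L1_operator_supersolution:
  assumes T: "L1_operator M c T" and "0 < c" and [measurable]: "h \<in> borel_measurable M"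
  obtains G where "G \<in> borel_measurable M" "\<And>x. h x + ennreal (1 / (4 * c)) * T G x \<le> G x"
    "(\<integral>\<^sup>+x. G x \<partial>M) \<le> ennreal (4 / 3) * (\<integral>\<^sup>+x. h x \<partial>M)"
proof -
  define A where "A n = ((\<lambda>G x. h x + ennreal (1 / (4 * c)) * T G x) ^^ n) (\<lambda>x. 0)" for n
  have A_0: "A 0 = (\<lambda>x. 0)" unfolding A_def by simp
  have A_Suc: "A (Suc n) = (\<lambda>x. h x + ennreal (1 / (4 * c)) * T (A n) x)" for n
    unfolding A_def by simp
  have [measurable]: "A n \<in> borel_measurable M" for n
  proof (induction n)
    case (Suc n)
    then have [measurable]: "T (A n) \<in> borel_measurable M" by (rule L1_operatorD[OF T])
    show ?case unfolding A_Suc by measurable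
  qed (simp add: A_0)
  have "A n \<le> A (Suc n)" for n
  proof (induction n)
    case (Suc n)
    have "h x + ennreal (1 / (4 * c)) * T (A n) x \<le> h x + ennreal (1 / (4 * c)) * T (A (Suc n)) x" for x
      using Suc by (intro add_left_mono mult_left_mono L1_operatorD(3)[OF T]) (auto simp: le_fun_def)
    then show ?case
      using A_Suc[of n] A_Suc[of "Suc n"] by (metis le_funI)
  qed (simp add: A_0 le_fun_def)
  then have inc: "incseq A" by (rule incseq_SucI)
  \<comment> \<open>In units of the integral of \<open>h\<close>, one step turns a bound x into 1 +
    x/4, whose fixed point is 4/3; the bound is therefore uniform in \<open>n\<close>.\<close>
  have int: "(\<integral>\<^sup>+x. A n x \<partial>M) \<le> ennreal (4 / 3) * (\<integral>\<^sup>+x. h x \<partial>M)" for n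
  proof (induction n)
    case (Suc n)
    have [measurable]: "T (A n) \<in> borel_measurable M" by (rule L1_operatorD[OF T]) simp
    have "(\<integral>\<^sup>+x. A (Suc n) x \<partial>M) = (\<integral>\<^sup>+x. h x \<partial>M) + ennreal (1 / (4 * c)) * (\<integral>\<^sup>+x. T (A n) x \<partial>M)"
      unfolding A_Suc by (simp add: nn_integral_add nn_integral_cmult)
    also have "\<dots> \<le> (\<integral>\<^sup>+x. h x \<partial>M) + ennreal (1 / (4 * c)) * (ennreal c * (ennreal (4 / 3) * (\<integral>\<^sup>+x. h x \<partial>M)))"
      using Suc
      by (intro add_left_mono mult_left_mono order_trans[OF L1_operatorD(2)[OF T]]) auto
    also have "\<dots> = (ennreal 1 + ennreal (1 / (4 * c)) * ennreal c * ennreal (4 / 3)) * (\<integral>\<^sup>+x. h x \<partial>M)"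
      by (simp add: distrib_right mult.assoc)
    also have "ennreal 1 + ennreal (1 / (4 * c)) * ennreal c * ennreal (4 / 3) = ennreal (4 / 3)"
      using \<open>0 < c\<close> by (simp flip: ennreal_mult ennreal_plus ennreal_1)
    finally show ?case .
  qed (simp add: A_0)
  show thesis
  proof
    show "(\<lambda>x. SUP n. A n x) \<in> borel_measurable M" by measurable
    show "h x + ennreal (1 / (4 * c)) * T (\<lambda>x. SUP n. A n x) x \<le> (SUP n. A n x)" for x
    proof -
      have "h x + ennreal (1 / (4 * c)) * T (\<lambda>x. SUP n. A n x) x
          \<le> h x + ennreal (1 / (4 * c)) * (SUP n. T (A n) x)"
        using inc by (intro add_left_mono mult_left_mono L1_operatorD(4)[OF T]) auto
      also have "\<dots> = (SUP n. A (Suc n) x)"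
        unfolding A_Suc by (simp add: SUP_mult_left_ennreal ennreal_SUP_add_right)
      also have "\<dots> \<le> (SUP n. A n x)" by (intro SUP_least SUP_upper) simp
      finally show ?thesis .
    qed
    have "(\<integral>\<^sup>+x. (SUP n. A n x) \<partial>M) = (SUP n. integral\<^sup>N M (A n))"
      using inc by (intro nn_integral_monotone_convergence_SUP) auto
    then show "(\<integral>\<^sup>+x. (SUP n. A n x) \<partial>M) \<le> ennreal (4 / 3) * (\<integral>\<^sup>+x. h x \<partial>M)"
      using int by (simp add: SUP_least)
  qed
qed

text \<open>Number of shifted grids times Doob's constant. The type argument carries the dimension,
  which no other argument would determine.\<close>

definition grid_const :: "'a::euclidean_space itself \<Rightarrow> real \<Rightarrow> real" where
  "grid_const _ \<kappa> = 2 ^ DIM('a) * (4 powr \<kappa> / (1 - 2 powr (1 - \<kappa>)))"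

lemma grid_const_pos: "1 < \<kappa> \<Longrightarrow> 0 < grid_const TYPE('a::euclidean_space) \<kappa>"
  unfolding grid_const_def by (auto simp: powr_less_one)

lemma countable_grids: "countable (grids :: 'a::euclidean_space set set)"
  unfolding grids_def by (intro countable_UN countable_grid countable_finite) auto

text \<open>The union of the grids is not laminar; the supremum over it is bounded by the sum of the
  suprema over the single grids, each of which is.\<close>

lemma L1_operator_wmax:
  fixes s :: "'a::euclidean_space \<Rightarrow> real"
  assumes \<kappa>: "1 < \<kappa>" and [measurable]: "s \<in> borel_measurable lebesgue" and s: "\<And>x. 0 < s x"
  shows "L1_operator lebesgue (grid_const TYPE('a) \<kappa>) (wmax lebesgue grids s \<kappa>)"
  unfolding L1_operator_def
proof (intro conjI ballI allI impI)
  fix G :: "'a \<Rightarrow> ennreal" and x assume [measurable]: "G \<in> borel_measurable lebesgue"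
  have m: "(\<lambda>x. SUP R\<in>F. indicator R x * wmean lebesgue s \<kappa> R G) \<in> borel_measurable lebesgue"
    if "F \<subseteq> grids" for F
    using that countable_grids grids_sets by (intro borel_measurable_SUP borel_measurable_times_ennreal borel_measurable_indicator borel_measurable_const)
        (auto intro: countable_subset)
  then have [measurable]: "wmax lebesgue F s \<kappa> G \<in> borel_measurable lebesgue" if "F \<subseteq> grids" for F
    unfolding wmax_def using that by measurable
  show "wmax lebesgue grids s \<kappa> G \<in> borel_measurable lebesgue" by simp
  have sub: "grid t \<subseteq> grids" if "t \<in> Pow Basis" for t :: "'a set"
    using that unfolding grids_def by blast
  have le: "wmax lebesgue grids s \<kappa> G x \<le> (\<Sum>t\<in>Pow Basis. wmax lebesgue (grid t) s \<kappa> G x)" for x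
  proof -
    have "(SUP R\<in>grids. indicator R x * wmean lebesgue s \<kappa> R G)
        \<le> (\<Sum>t\<in>Pow Basis. SUP R\<in>grid t. indicator R x * wmean lebesgue s \<kappa> R G)"
    proof (rule SUP_least)
      fix R :: "'a set" assume "R \<in> grids"
      then obtain t where t: "t \<in> Pow Basis" "R \<in> grid t" unfolding grids_def by blast
      have "indicator R x * wmean lebesgue s \<kappa> R G \<le> (SUP R\<in>grid t. indicator R x * wmean lebesgue s \<kappa> R G)"
        using t by (intro SUP_upper)
      also have "\<dots> \<le> (\<Sum>t\<in>Pow Basis. SUP R\<in>grid t. indicator R x * wmean lebesgue s \<kappa> R G)"
        using t by (intro member_le_sum) auto
      finally show "indicator R x * wmean lebesgue s \<kappa> R G
          \<le> (\<Sum>t\<in>Pow Basis. SUP R\<in>grid t. indicator R x * wmean lebesgue s \<kappa> R G)" .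
    qed
    then show ?thesis
      unfolding wmax_def by (simp add: mult_left_mono flip: sum_distrib_left)
  qed
  have "(\<integral>\<^sup>+x. wmax lebesgue grids s \<kappa> G x \<partial>lebesgue)
      \<le> (\<integral>\<^sup>+x. (\<Sum>t\<in>Pow Basis. wmax lebesgue (grid t) s \<kappa> G x) \<partial>lebesgue)"
    by (intro nn_integral_mono le)
  also have "\<dots> = (\<Sum>t\<in>Pow Basis. \<integral>\<^sup>+x. wmax lebesgue (grid t) s \<kappa> G x \<partial>lebesgue)"
    using sub by (intro nn_integral_sum) auto
  also have "\<dots> \<le> (\<Sum>t\<in>Pow (Basis::'a set). ennreal (4 powr \<kappa> / (1 - 2 powr (1 - \<kappa>))) * (\<integral>\<^sup>+x. G x \<partial>lebesgue))"
    using \<kappa> s sub grids_sets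
    by (intro sum_mono wmax_L1_bound countable_grid laminar_grid subsetI) auto
  also have "\<dots> = ennreal (grid_const TYPE('a) \<kappa>) * (\<integral>\<^sup>+x. G x \<partial>lebesgue)"
  proof -
    define q where "q = 4 powr \<kappa> / (1 - 2 powr (1 - \<kappa>))"
    have "0 \<le> q" unfolding q_def using \<kappa> by (simp add: powr_less_one less_imp_le)
    then have "ennreal (2 ^ DIM('a) * q) = 2 ^ DIM('a) * ennreal q"
      by (simp add: ennreal_mult flip: ennreal_power)
    then show ?thesis
      unfolding grid_const_def q_def[symmetric] by (simp add: card_Pow mult.assoc)
  qed
  finally show "(\<integral>\<^sup>+x. wmax lebesgue grids s \<kappa> G x \<partial>lebesgue)
      \<le> ennreal (grid_const TYPE('a) \<kappa>) * (\<integral>\<^sup>+x. G x \<partial>lebesgue)" .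
next
  fix G G' :: "'a \<Rightarrow> ennreal" and x assume "\<forall>x. G x \<le> G' x"
  then show "wmax lebesgue grids s \<kappa> G x \<le> wmax lebesgue grids s \<kappa> G' x"
    unfolding wmax_def using \<kappa> by (intro mult_left_mono SUP_mono' wmean_mono) auto
next
  fix A :: "nat \<Rightarrow> 'a \<Rightarrow> ennreal" and x assume A: "incseq A" "\<forall>n. A n \<in> borel_measurable lebesgue"
  have "wmax lebesgue grids s \<kappa> (\<lambda>x. SUP n. A n x) x
      = ennreal (s x) * (SUP R\<in>grids. SUP n. indicator R x * wmean lebesgue s \<kappa> R (A n))"
    unfolding wmax_def using \<kappa> A grids_sets
    by (intro arg_cong2[where f="(*)"] refl SUP_cong) (subst wmean_SUP, auto simp: SUP_mult_left_ennreal)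
  also have "\<dots> = (SUP n. wmax lebesgue grids s \<kappa> (A n) x)"
    unfolding wmax_def by (subst SUP_commute) (simp add: SUP_mult_left_ennreal)
  finally show "wmax lebesgue grids s \<kappa> (\<lambda>x. SUP n. A n x) x \<le> (SUP n. wmax lebesgue grids s \<kappa> (A n) x)"
    by simp
qed

text \<open>The inequality \<open>wmax\<close> <= \<open>Y\<close>, read cell by cell and almost
  everywhere, with a null set that may depend on the cell. In this form it survives the replacement
  of extended-valued functions by real-valued ones.\<close>

definition dominates :: "('a::euclidean_space \<Rightarrow> real) \<Rightarrow> real \<Rightarrow> ('a \<Rightarrow> real) \<Rightarrow> ('a \<Rightarrow> real) \<Rightarrow> bool" where
  "dominates s \<kappa> G Y \<longleftrightarrow> (\<forall>R\<in>grids. AE x in lebesgue. x \<in> R \<longrightarrow>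
     ennreal (s x) * wmean lebesgue s \<kappa> R (\<lambda>x. ennreal (G x)) \<le> ennreal (Y x))"

text \<open>Four times the bound for the composition of the summed maximal operator with itself, the
  4 being that of the iteration. The functions \<open>s\<close> do not enter, so the constant can be
  fixed before the weights.\<close>

definition majorant_const :: "'a::euclidean_space itself \<Rightarrow> 'i set \<Rightarrow> ('i \<Rightarrow> real) \<Rightarrow> real" where
  "majorant_const T J \<kappa> = 4 * ((\<Sum>j\<in>J. grid_const T (\<kappa> j)) * (\<Sum>j\<in>J. grid_const T (\<kappa> j)))"

lemma majorant_const_pos:
  assumes "finite J" "J \<noteq> {}" "\<And>j. j \<in> J \<Longrightarrow> 1 < \<kappa> j"
  shows "0 < majorant_const TYPE('a::euclidean_space) J \<kappa>"
proof -
  have "0 < (\<Sum>j\<in>J. grid_const TYPE('a) (\<kappa> j))"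
    using assms by (intro sum_pos grid_const_pos) auto
  then show ?thesis unfolding majorant_const_def by simp
qed

text \<open>With \<open>N\<close> the sum of all the maximal operators, the iteration is run for N o
  N, and \<open>Y\<close> is a real version of N H. A single cell mean is below the sum, which gives
  both families of dominations.\<close>

lemma ex_dominating_majorant:
  fixes \<kappa> :: "'i \<Rightarrow> real" and s :: "'i \<Rightarrow> 'a::euclidean_space \<Rightarrow> real"
  assumes J: "finite J" "J \<noteq> {}" and \<kappa>: "\<And>j. j \<in> J \<Longrightarrow> 1 < \<kappa> j"
    and s: "\<And>j. j \<in> J \<Longrightarrow> s j \<in> borel_measurable lebesgue" "\<And>j x. j \<in> J \<Longrightarrow> 0 < s j x"
    and h: "h \<in> borel_measurable lebesgue" "\<And>x. 0 < h x" "(\<integral>\<^sup>+x. h x \<partial>lebesgue) < \<infinity>"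
  obtains H Y :: "'a \<Rightarrow> real" where "H \<in> borel_measurable lebesgue" "Y \<in> borel_measurable lebesgue"
    "\<forall>x. 0 < H x" "\<forall>x. 0 \<le> Y x"
    "(\<integral>\<^sup>+x. ennreal (H x) \<partial>lebesgue) \<le> ennreal (4 / 3) * (\<integral>\<^sup>+x. h x \<partial>lebesgue)"
    "AE x in lebesgue. h x \<le> ennreal (H x)"
    "\<forall>j\<in>J. dominates (s j) (\<kappa> j) H Y"
    "\<forall>j\<in>J. dominates (s j) (\<kappa> j) Y (\<lambda>x. majorant_const TYPE('a) J \<kappa> * H x)"
proof -
  define c where "c = (\<Sum>j\<in>J. grid_const TYPE('a) (\<kappa> j))"
  have c: "0 < c" unfolding c_def using J \<kappa> by (intro sum_pos grid_const_pos) auto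
  have C_eq: "majorant_const TYPE('a) J \<kappa> = 4 * (c * c)" unfolding majorant_const_def c_def ..
  note [measurable] = h(1)
  define N where "N G x = (\<Sum>j\<in>J. wmax lebesgue grids (s j) (\<kappa> j) G x)" for G :: "'a \<Rightarrow> ennreal" and x
  have N: "L1_operator lebesgue c N"
    unfolding N_def[abs_def] c_def using J \<kappa> s
    by (intro L1_operator_sum L1_operator_wmax less_imp_le[OF grid_const_pos]) auto
  have NN: "L1_operator lebesgue (c * c) (\<lambda>G. N (N G))"
    using c by (intro L1_operator_comp N) auto
  obtain G :: "'a \<Rightarrow> ennreal" where [measurable]: "G \<in> borel_measurable lebesgue"
    and G: "\<And>x. h x + ennreal (1 / (4 * (c * c))) * N (N G) x \<le> G x"
      "(\<integral>\<^sup>+x. G x \<partial>lebesgue) \<le> ennreal (4 / 3) * (\<integral>\<^sup>+x. h x \<partial>lebesgue)"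
    using L1_operator_supersolution[OF NN _ h(1)] c by auto
  have [measurable]: "N G \<in> borel_measurable lebesgue" by (rule L1_operatorD[OF N]) simp
  have Gfin: "(\<integral>\<^sup>+x. G x \<partial>lebesgue) < \<infinity>"
    using G(2) h(3) by (auto simp: ennreal_mult_less_top elim: order.strict_trans1)
  then have aeG: "AE x in lebesgue. G x < \<infinity>"
    using nn_integral_PInf_AE[of G lebesgue] by (auto simp: less_top)
  have "(\<integral>\<^sup>+x. N G x \<partial>lebesgue) \<le> ennreal c * (\<integral>\<^sup>+x. G x \<partial>lebesgue)"
    by (rule L1_operatorD(2)[OF N]) simp
  also have "\<dots> < \<infinity>" using Gfin by (simp add: ennreal_mult_less_top)
  finally have aeN: "AE x in lebesgue. N G x < \<infinity>"
    using nn_integral_PInf_AE[of "N G" lebesgue] by (auto simp: less_top)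
  \<comment> \<open>Where \<open>G\<close> is infinite, which happens on a null set only,
    \<open>enn2real\<close> would give 0; the value 1 keeps \<open>H\<close> positive everywhere, as
    the new weights require.\<close>
  define H where "H x = (if G x = \<infinity> then 1 else enn2real (G x))" for x
  define Y where "Y x = enn2real (N G x)" for x
  have [measurable]: "H \<in> borel_measurable lebesgue" "Y \<in> borel_measurable lebesgue"
    unfolding H_def Y_def by measurable
  have hG: "h x \<le> G x" for x
    using order_trans[OF _ G(1)[of x], of "h x"] by (simp add: add_increasing2)
  have H0: "0 < H x" for x
    using hG[of x] h(2)[of x] unfolding H_def by (auto simp: enn2real_positive_iff less_top)
  have H: "AE x in lebesgue. ennreal (H x) = G x"
    using aeG by eventually_elim (auto simp: H_def)
  have Y: "AE x in lebesgue. ennreal (Y x) = N G x"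
    using aeN by eventually_elim (auto simp: Y_def)
  have upper: "ennreal (s j x) * wmean lebesgue (s j) (\<kappa> j) R A \<le> N A x"
    if "j \<in> J" "R \<in> grids" "x \<in> R" for j R x A
  proof -
    have "ennreal (s j x) * wmean lebesgue (s j) (\<kappa> j) R A \<le> wmax lebesgue grids (s j) (\<kappa> j) A x"
      using that by (intro wmax_upper) auto
    also have "\<dots> \<le> N A x" unfolding N_def using that J by (intro member_le_sum) auto
    finally show ?thesis .
  qed
  have NNG: "N (N G) x \<le> ennreal (4 * (c * c)) * G x" for x
  proof -
    have "N (N G) x = ennreal (4 * (c * c)) * (ennreal (1 / (4 * (c * c))) * N (N G) x)"
      using c by (simp flip: mult.assoc ennreal_mult)
    also have "\<dots> \<le> ennreal (4 * (c * c)) * G x"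
      using order_trans[OF _ G(1)[of x], of "ennreal (1 / (4 * (c * c))) * N (N G) x"]
      by (intro mult_left_mono) (auto simp: add_increasing)
    finally show ?thesis .
  qed
  show thesis
  proof (rule that[of H Y]; (intro allI ballI)?)
    show "H x > 0" for x by (rule H0)
    show "0 \<le> Y x" for x unfolding Y_def by simp
    have "(\<integral>\<^sup>+x. ennreal (H x) \<partial>lebesgue) = (\<integral>\<^sup>+x. G x \<partial>lebesgue)"
      using H by (intro nn_integral_cong_AE)
    then show "(\<integral>\<^sup>+x. ennreal (H x) \<partial>lebesgue) \<le> ennreal (4 / 3) * (\<integral>\<^sup>+x. h x \<partial>lebesgue)"
      using G(2) by simp
    show "AE x in lebesgue. h x \<le> ennreal (H x)" using H by eventually_elim (use hG in auto)
  next
    fix j assume j: "j \<in> J"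
    show "dominates (s j) (\<kappa> j) H Y"
      unfolding dominates_def C_eq
    proof
      fix R :: "'a set" assume "R \<in> grids"
      note * = this j
      have eq: "wmean lebesgue (s j) (\<kappa> j) R (\<lambda>x. ennreal (H x)) = wmean lebesgue (s j) (\<kappa> j) R G"
        using H by (rule wmean_cong_AE)
      show "AE x in lebesgue. x \<in> R \<longrightarrow>
           ennreal (s j x) * wmean lebesgue (s j) (\<kappa> j) R (\<lambda>x. ennreal (H x)) \<le> ennreal (Y x)"
        unfolding eq using Y by eventually_elim (use upper * in auto)
    qed
  next
    fix j assume j: "j \<in> J"
    show "dominates (s j) (\<kappa> j) Y (\<lambda>x. majorant_const TYPE('a) J \<kappa> * H x)"
      unfolding dominates_def C_eq
    proof
      fix R :: "'a set" assume "R \<in> grids"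
      note * = this j
      have eq: "wmean lebesgue (s j) (\<kappa> j) R (\<lambda>x. ennreal (Y x)) = wmean lebesgue (s j) (\<kappa> j) R (N G)"
        using Y by (rule wmean_cong_AE)
      show "AE x in lebesgue. x \<in> R \<longrightarrow>
           ennreal (s j x) * wmean lebesgue (s j) (\<kappa> j) R (\<lambda>x. ennreal (Y x)) \<le> ennreal (4 * (c * c) * H x)"
        unfolding eq using H
      proof (eventually_elim, intro impI)
        fix x assume x: "ennreal (H x) = G x" "x \<in> R"
        have "ennreal (s j x) * wmean lebesgue (s j) (\<kappa> j) R (N G) \<le> ennreal (4 * (c * c)) * G x"
          using upper[OF *(2,1) x(2)] NNG order_trans by blast
        also have "\<dots> = ennreal (4 * (c * c) * H x)"
          using x(1) c H0[of x] by (simp add: ennreal_mult)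
        finally show "ennreal (s j x) * wmean lebesgue (s j) (\<kappa> j) R (N G) \<le> ennreal (4 * (c * c) * H x)" .
      qed
    qed
  qed simp_all
qed

section \<open>Hoelder's inequality for finite families\<close>

lemma weighted_arith_geom_mean:
  fixes x \<theta> :: "'i \<Rightarrow> real"
  assumes J: "finite J" and \<theta>: "\<And>j. j \<in> J \<Longrightarrow> 0 \<le> \<theta> j" "(\<Sum>j\<in>J. \<theta> j) = 1" and x: "\<And>j. j \<in> J \<Longrightarrow> 0 \<le> x j"
  shows "(\<Prod>j\<in>J. x j powr \<theta> j) \<le> (\<Sum>j\<in>J. \<theta> j * x j)"
\<comment> \<open>A zero factor is treated apart because logarithms are used below. As 0 powr 0 = 0,
  it makes the product vanish even when its exponent is 0.\<close>
proof (cases "\<exists>j\<in>J. x j = 0")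
  case True
  then have "(\<Prod>j\<in>J. x j powr \<theta> j) = 0" using J by (intro prod_zero) auto
  then show ?thesis using \<theta> x by (simp add: sum_nonneg)
next
  case False
  then have x: "\<And>j. j \<in> J \<Longrightarrow> 0 < x j" using x by force
  have "(\<Prod>j\<in>J. x j powr \<theta> j) = exp (\<Sum>j\<in>J. \<theta> j *\<^sub>R ln (x j))"
    using x J less_irrefl by (fastforce simp: powr_def exp_sum intro!: prod.cong)
  also have "\<dots> \<le> (\<Sum>j\<in>J. \<theta> j * exp (ln (x j)))"
    using J \<theta> by (intro convex_on_sum[OF _ _ exp_convex]) auto
  also have "\<dots> = (\<Sum>j\<in>J. \<theta> j * x j)" using x by (intro sum.cong) auto
  finally show ?thesis .
qed

text \<open>Hoelder's inequality with upper bounds \<open>F j\<close> in place of the integrals: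
  after division by \<open>F j\<close> the weighted AM-GM inequality holds pointwise and is
  integrated.\<close>

lemma nn_integral_prod_powr_le:
  fixes f :: "'i \<Rightarrow> 'a \<Rightarrow> real"
  assumes J: "finite J" and \<theta>: "\<And>j. j \<in> J \<Longrightarrow> 0 \<le> \<theta> j" "(\<Sum>j\<in>J. \<theta> j) = 1"
    and f: "\<And>j. j \<in> J \<Longrightarrow> f j \<in> borel_measurable M" "\<And>j x. j \<in> J \<Longrightarrow> 0 \<le> f j x"
    and F: "\<And>j. j \<in> J \<Longrightarrow> 0 < F j" "\<And>j. j \<in> J \<Longrightarrow> (\<integral>\<^sup>+x. ennreal (f j x) \<partial>M) \<le> ennreal (F j)"
  shows "(\<integral>\<^sup>+x. ennreal (\<Prod>j\<in>J. f j x powr \<theta> j) \<partial>M) \<le> ennreal (\<Prod>j\<in>J. F j powr \<theta> j)"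
proof -
  define t where "t = (\<Prod>j\<in>J. F j powr \<theta> j)"
  have t: "0 \<le> t" unfolding t_def by (intro prod_nonneg) auto
  have "(\<Prod>j\<in>J. f j x powr \<theta> j) \<le> t * (\<Sum>j\<in>J. \<theta> j * (f j x / F j))" for x
  proof -
    have "(\<Prod>j\<in>J. f j x powr \<theta> j) = t * (\<Prod>j\<in>J. (f j x / F j) powr \<theta> j)"
      unfolding t_def prod.distrib[symmetric] using f F
      by (intro prod.cong refl) (auto simp: less_imp_le less_imp_neq[THEN not_sym] simp flip: powr_mult)
    also have "\<dots> \<le> t * (\<Sum>j\<in>J. \<theta> j * (f j x / F j))"
      using t J \<theta> f F by (intro mult_left_mono weighted_arith_geom_mean) (auto simp: less_imp_le)
    finally show ?thesis .
  qed
  then have "(\<integral>\<^sup>+x. ennreal (\<Prod>j\<in>J. f j x powr \<theta> j) \<partial>M)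
      \<le> (\<integral>\<^sup>+x. ennreal (t * (\<Sum>j\<in>J. \<theta> j * (f j x / F j))) \<partial>M)"
    by (intro nn_integral_mono ennreal_leI)
  also have "\<dots> = (\<integral>\<^sup>+x. ennreal t * (\<Sum>j\<in>J. ennreal (\<theta> j / F j) * ennreal (f j x)) \<partial>M)"
  proof (intro nn_integral_cong)
    fix x
    have "(\<Sum>j\<in>J. ennreal (\<theta> j / F j) * ennreal (f j x)) = (\<Sum>j\<in>J. ennreal (\<theta> j * (f j x / F j)))"
      using \<theta> f F by (intro sum.cong) (auto simp: less_imp_le simp flip: ennreal_mult)
    also have "\<dots> = ennreal (\<Sum>j\<in>J. \<theta> j * (f j x / F j))"
      using \<theta> f F by (intro sum_ennreal) (auto simp: less_imp_le)
    finally show "ennreal (t * (\<Sum>j\<in>J. \<theta> j * (f j x / F j))) = ennreal t * (\<Sum>j\<in>J. ennreal (\<theta> j / F j) * ennreal (f j x))"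
      using t by (simp add: ennreal_mult')
  qed
  also have "\<dots> = ennreal t * (\<Sum>j\<in>J. ennreal (\<theta> j / F j) * (\<integral>\<^sup>+x. ennreal (f j x) \<partial>M))"
    using f by (simp add: nn_integral_cmult nn_integral_sum)
  also have "\<dots> \<le> ennreal t * (\<Sum>j\<in>J. ennreal (\<theta> j / F j) * ennreal (F j))"
    using F by (intro mult_left_mono sum_mono) auto
  also have "(\<Sum>j\<in>J. ennreal (\<theta> j / F j) * ennreal (F j)) = (\<Sum>j\<in>J. ennreal (\<theta> j))"
  proof (intro sum.cong refl)
    fix j assume "j \<in> J"
    then show "ennreal (\<theta> j / F j) * ennreal (F j) = ennreal (\<theta> j)"
      using \<theta> F(1)[of j] by (simp flip: ennreal_mult)
  qed
  also have "\<dots> = 1" using \<theta> by (subst sum_ennreal) auto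
  finally show ?thesis unfolding t_def by simp
qed

text \<open>Hoelder's inequality read backwards: a pointwise lower bound for a product forces one
  for the product of averages. Division by the sum \<tau> turns the exponents into Hoelder weights,
  so \<mu> enters the integral as \<mu>^(1/\<tau>).\<close>

lemma geometric_mean_averages_ge:
  fixes f :: "'i \<Rightarrow> 'a \<Rightarrow> real"
  assumes J: "finite J" and c: "\<And>j. j \<in> J \<Longrightarrow> 0 \<le> c j" "0 < (\<Sum>j\<in>J. c j)"
    and f: "\<And>j. j \<in> J \<Longrightarrow> f j \<in> borel_measurable M" "\<And>j x. j \<in> J \<Longrightarrow> 0 \<le> f j x"
    and Q: "Q \<in> sets M" "emeasure M Q = ennreal L" "0 < L"
    and F: "\<And>j. j \<in> J \<Longrightarrow> 0 < F j" "\<And>j. j \<in> J \<Longrightarrow> (\<integral>\<^sup>+x\<in>Q. ennreal (f j x) \<partial>M) \<le> ennreal (L * F j)"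
    and \<mu>: "0 \<le> \<mu>" "AE x in M. x \<in> Q \<longrightarrow> \<mu> \<le> (\<Prod>j\<in>J. f j x powr c j)"
  shows "\<mu> \<le> (\<Prod>j\<in>J. F j powr c j)"
proof -
  define \<tau> where "\<tau> = (\<Sum>j\<in>J. c j)"
  have \<tau>: "0 < \<tau>" using c unfolding \<tau>_def by simp
  define \<theta> where "\<theta> j = c j / \<tau>" for j
  have \<theta>: "\<And>j. j \<in> J \<Longrightarrow> 0 \<le> \<theta> j" "(\<Sum>j\<in>J. \<theta> j) = 1"
    using c \<tau> unfolding \<theta>_def \<tau>_def by (auto simp flip: sum_divide_distrib)
  have root: "(\<Prod>j\<in>J. z j powr c j) powr (1 / \<tau>) = (\<Prod>j\<in>J. z j powr \<theta> j)"
    if "\<And>j. j \<in> J \<Longrightarrow> 0 \<le> z j" for z :: "'i \<Rightarrow> real"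
    using that unfolding \<theta>_def by (simp add: prod_powr_distrib powr_powr)
  note [measurable] = Q(1)
  have "ennreal (\<mu> powr (1 / \<tau>) * L) = (\<integral>\<^sup>+x. ennreal (\<mu> powr (1 / \<tau>)) * indicator Q x \<partial>M)"
    using Q by (simp add: nn_integral_cmult_indicator ennreal_mult)
  also have "\<dots> \<le> (\<integral>\<^sup>+x. ennreal (\<Prod>j\<in>J. (f j x * indicator Q x) powr \<theta> j) \<partial>M)"
    using \<mu>(2)
  proof (intro nn_integral_mono_AE, eventually_elim)
    fix x assume x: "x \<in> Q \<longrightarrow> \<mu> \<le> (\<Prod>j\<in>J. f j x powr c j)"
    show "ennreal (\<mu> powr (1 / \<tau>)) * indicator Q x \<le> ennreal (\<Prod>j\<in>J. (f j x * indicator Q x) powr \<theta> j)"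
    proof (cases "x \<in> Q")
      case True
      have "\<mu> powr (1 / \<tau>) \<le> (\<Prod>j\<in>J. f j x powr c j) powr (1 / \<tau>)"
        using x True \<mu>(1) \<tau> by (intro powr_mono2) auto
      also have "\<dots> = (\<Prod>j\<in>J. f j x powr \<theta> j)" using f by (intro root) auto
      finally show ?thesis using True by (simp add: ennreal_leI)
    qed simp
  qed
  also have "\<dots> \<le> ennreal (\<Prod>j\<in>J. (L * F j) powr \<theta> j)"
  proof (rule nn_integral_prod_powr_le)
    fix j assume j: "j \<in> J"
    have "(\<integral>\<^sup>+x. ennreal (f j x * indicator Q x) \<partial>M) = (\<integral>\<^sup>+x\<in>Q. ennreal (f j x) \<partial>M)"
      by (intro nn_integral_cong) (auto simp: indicator_def)
    then show "(\<integral>\<^sup>+x. ennreal (f j x * indicator Q x) \<partial>M) \<le> ennreal (L * F j)"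
      using F(2)[OF j] by simp
  qed (use J \<theta> f F Q in auto)
  also have "(\<Prod>j\<in>J. (L * F j) powr \<theta> j) = L * (\<Prod>j\<in>J. F j powr \<theta> j)"
  proof -
    have "(\<Prod>j\<in>J. L powr \<theta> j) = L" using \<theta>(2) Q(3) by (simp flip: powr_sum)
    then show ?thesis using F Q by (simp add: powr_mult less_imp_le prod.distrib)
  qed
  finally have "\<mu> powr (1 / \<tau>) * L \<le> L * (\<Prod>j\<in>J. F j powr \<theta> j)"
    using Q(3) by (subst (asm) ennreal_le_iff) (auto intro!: mult_nonneg_nonneg prod_nonneg)
  then have "\<mu> powr (1 / \<tau>) \<le> (\<Prod>j\<in>J. F j powr c j) powr (1 / \<tau>)"
    using Q(3) F by (subst root) (auto simp: less_imp_le mult.commute)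
  then have "(\<mu> powr (1 / \<tau>)) powr \<tau> \<le> ((\<Prod>j\<in>J. F j powr c j) powr (1 / \<tau>)) powr \<tau>"
    using \<tau> by (rule_tac powr_mono2) auto
  moreover have "(z powr (1 / \<tau>)) powr \<tau> = z" if "0 \<le> z" for z :: real
    using \<tau> that by (simp add: powr_powr)
  ultimately show ?thesis
    using \<mu>(1) by (metis powr_ge_zero prod_nonneg)
qed

section \<open>Averages of the new weights\<close>

lemma AE_on_imp_ex:
  assumes "AE x in M. x \<in> Q \<longrightarrow> P x" "Q \<in> sets M" "emeasure M Q \<noteq> 0"
  shows "\<exists>x\<in>Q. P x"
proof (rule ccontr)
  assume "\<not> (\<exists>x\<in>Q. P x)"
  then have "AE x in M. x \<notin> Q" using assms(1) by auto
  then show False using assms(2,3) AE_iff_null_sets[of Q M] by auto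
qed

text \<open>Moves the argument from \<open>ennreal\<close> to positive reals, where means can be
  divided and raised to any power. The mean is positive because the integrand is, almost everywhere
  on a set of positive measure.\<close>

lemma wmean_real:
  fixes G s :: "'a \<Rightarrow> real"
  assumes "0 < \<kappa>" and [measurable]: "s \<in> borel_measurable M" "G \<in> borel_measurable M" "Q \<in> sets M"
    and pos: "\<And>x. 0 < s x" "AE x in M. x \<in> Q \<longrightarrow> 0 < G x"
    and Q: "emeasure M Q \<noteq> 0" "(\<integral>\<^sup>+x\<in>Q. ennreal (s x) \<partial>M) = ennreal T" "0 < T"
    and fin: "wmean M s \<kappa> Q (\<lambda>x. ennreal (G x)) < \<infinity>" and G: "\<And>x. 0 \<le> G x"
  shows "\<exists>n>0. wmean M s \<kappa> Q (\<lambda>x. ennreal (G x)) = ennreal n \<and>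
    (\<integral>\<^sup>+x\<in>Q. ennreal (G x powr (1 / \<kappa>) * s x powr (1 - 1 / \<kappa>)) \<partial>M) = ennreal (n powr (1 / \<kappa>) * T)"
proof -
  define X where "X = (\<integral>\<^sup>+x\<in>Q. ennreal (G x powr (1 / \<kappa>) * s x powr (1 - 1 / \<kappa>)) \<partial>M)"
  have eq: "wmean M s \<kappa> Q (\<lambda>x. ennreal (G x)) = epowr (X / ennreal T) \<kappa>"
    unfolding wmean_def Q(2) X_def using G by (simp add: ennreal_mult)
  have "X \<noteq> \<top>"
    using fin \<open>0 < T\<close> unfolding eq by (auto simp: ennreal_top_divide)
  moreover have "X \<noteq> 0"
  proof
    assume "X = 0"
    then have "AE x in M. ennreal (G x powr (1 / \<kappa>) * s x powr (1 - 1 / \<kappa>)) * indicator Q x = 0"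
      unfolding X_def by (subst (asm) nn_integral_0_iff_AE) auto
    with pos(2) have "AE x in M. x \<in> Q \<longrightarrow> False"
    proof eventually_elim
      case (elim x)
      show ?case
      proof
        assume "x \<in> Q"
        then have "0 < G x powr (1 / \<kappa>) * s x powr (1 - 1 / \<kappa>)"
          using elim pos(1)[of x] by (intro mult_pos_pos) auto
        then show False using elim \<open>x \<in> Q\<close> by (simp add: ennreal_eq_0_iff)
      qed
    qed
    from AE_on_imp_ex[OF this] Q show False by auto
  qed
  ultimately obtain X' where X': "X = ennreal X'" "0 < X'"
    by (cases X) (auto simp: less_le)
  show ?thesis
  proof (intro exI conjI)
    show "0 < (X' / T) powr \<kappa>" using X' \<open>0 < T\<close> by simp
    show "wmean M s \<kappa> Q (\<lambda>x. ennreal (G x)) = ennreal ((X' / T) powr \<kappa>)"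
      unfolding eq X' using X' \<open>0 < T\<close> by (simp add: divide_ennreal)
    show "(\<integral>\<^sup>+x\<in>Q. ennreal (G x powr (1 / \<kappa>) * s x powr (1 - 1 / \<kappa>)) \<partial>M)
        = ennreal (((X' / T) powr \<kappa>) powr (1 / \<kappa>) * T)"
      using X' \<open>0 < T\<close> \<open>0 < \<kappa>\<close> unfolding X_def[symmetric] by (simp add: powr_powr)
  qed
qed

text \<open>Comparison with s^b, whose average is S^b because \<open>S\<close> is the mean of
  \<open>s\<close>. At the endpoint b = 0 only \<open>K\<close> is left, as \<open>S\<close> > 0
  gives S powr 0 = 1.\<close>

lemma avg_le_of_AE_le:
  fixes V s :: "'a::euclidean_space \<Rightarrow> real"
  assumes "0 \<le> b" and [measurable]: "s \<in> borel_measurable lebesgue" "V \<in> borel_measurable lebesgue" "Q \<in> sets lebesgue"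
    and s: "\<And>x. 0 < s x"
    and Q: "measure lebesgue Q = L" "0 < L" "(\<integral>\<^sup>+x\<in>Q. ennreal (s x) \<partial>lebesgue) = ennreal (L * S)" "0 < S"
    and K: "0 \<le> K" "AE x in lebesgue. x \<in> Q \<longrightarrow> \<bar>V x\<bar> \<le> K * s x powr b"
  shows "avg b Q V \<le> ennreal (K * S powr b)"
proof (cases "b = 0")
  case True
  have "esssup lebesgue (\<lambda>x. ennreal (indicator Q x * \<bar>V x\<bar>)) \<le> ennreal K"
    using K(2)
  proof (intro esssup_I, measurable, eventually_elim)
    fix x assume x: "x \<in> Q \<longrightarrow> \<bar>V x\<bar> \<le> K * s x powr b"
    show "ennreal (indicator Q x * \<bar>V x\<bar>) \<le> ennreal K"
      using x s[of x] True K(1) by (auto simp: indicator_def intro!: ennreal_leI)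
  qed
  then show ?thesis using True Q unfolding avg_def by simp
next
  case False
  then have b: "0 < b" using assms(1) by simp
  have "(\<integral>\<^sup>+x\<in>Q. ennreal (\<bar>V x\<bar> powr (1 / b)) \<partial>lebesgue) \<le> (\<integral>\<^sup>+x. ennreal (K powr (1 / b)) * (ennreal (s x) * indicator Q x) \<partial>lebesgue)"
    using K(2)
  proof (intro nn_integral_mono_AE, eventually_elim)
    fix x assume x: "x \<in> Q \<longrightarrow> \<bar>V x\<bar> \<le> K * s x powr b"
    show "ennreal (\<bar>V x\<bar> powr (1 / b)) * indicator Q x \<le> ennreal (K powr (1 / b)) * (ennreal (s x) * indicator Q x)"
    proof (cases "x \<in> Q")
      case True
      have "\<bar>V x\<bar> powr (1 / b) \<le> (K * s x powr b) powr (1 / b)"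
        using x True b by (intro powr_mono2) auto
      also have "\<dots> = K powr (1 / b) * s x" using b K(1) s[of x] by (simp add: powr_mult powr_powr)
      finally show ?thesis using True s[of x] by (simp add: ennreal_leI flip: ennreal_mult)
    qed simp
  qed
  also have "\<dots> = ennreal (K powr (1 / b) * (L * S))"
    using Q by (simp add: nn_integral_cmult ennreal_mult)
  finally have "ennreal (1 / L) * (\<integral>\<^sup>+x\<in>Q. ennreal (\<bar>V x\<bar> powr (1 / b)) \<partial>lebesgue) \<le> ennreal (1 / L) * ennreal (K powr (1 / b) * (L * S))"
    by (intro mult_left_mono) auto
  also have "\<dots> = ennreal (K powr (1 / b) * S)" using Q by (simp flip: ennreal_mult)
  finally have "epowr (ennreal (1 / L) * (\<integral>\<^sup>+x\<in>Q. ennreal (\<bar>V x\<bar> powr (1 / b)) \<partial>lebesgue)) b \<le> epowr (ennreal (K powr (1 / b) * S)) b"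
    using b by (intro epowr_mono) auto
  also have "\<dots> = ennreal (K * S powr b)"
    using b Q K(1) by (simp add: powr_mult powr_powr)
  finally show ?thesis using b Q unfolding avg_def by simp
qed

text \<open>With $n_j$ and $\nu_j$ the weighted means of \<open>H\<close> and \<open>Y\<close>, an index with \<open>a j < b j\<close> contributes
  exactly $S_j^{b_j} n_j^{b_j-a_j}$, and the others at most $S_j^{b_j}(C/\nu_j)^{a_j-b_j}$.
  Hoelder's inequality applied to $\prod_j s_j^{(g-1)a_j} = 1$ bounds $\nu_j$ from below in such a way that
  all $n_j$ cancel in the product and exactly $\prod_j S_j^{g a_j}$ remains. This gives the maximum
  of the ratios \<open>b j / a j\<close> as exponent; changing the exponents pair by pair would multiply the ratios.\<close>

lemma avg_prod_le:
  fixes I :: "'i set" and s :: "'i \<Rightarrow> 'a::euclidean_space \<Rightarrow> real" and H Y :: "'a \<Rightarrow> real"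
  defines "e \<equiv> \<lambda>a b :: 'i \<Rightarrow> real. \<lambda>j. max (b j - a j) 0"
  assumes I: "finite I" and a: "\<And>j. j \<in> I \<Longrightarrow> 0 < a j" and b: "\<And>j. j \<in> I \<Longrightarrow> 0 \<le> b j"
    and e: "(\<Sum>j\<in>I. e a b j) = \<Delta>" "(\<Sum>j\<in>I. e b a j) = \<Delta>" "0 < \<Delta>"
    and g: "1 < g" "\<And>j. j \<in> I \<Longrightarrow> b j \<le> g * a j"
    and \<kappa>: "\<And>j. j \<in> I \<Longrightarrow> \<kappa> j = (if a j < b j then b j / (b j - a j) else 1 + (g - 1) * a j / \<Delta>)"
    and s: "\<And>j. j \<in> I \<Longrightarrow> s j \<in> borel_measurable lebesgue" "\<And>j x. j \<in> I \<Longrightarrow> 0 < s j x"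
      "\<And>x. (\<Prod>j\<in>I. s j x powr a j) = 1"
    and HY: "H \<in> borel_measurable lebesgue" "Y \<in> borel_measurable lebesgue" "\<And>x. 0 < H x" "\<And>x. 0 \<le> Y x"
    and Q: "Q \<in> sets lebesgue" "emeasure lebesgue Q = ennreal L" "0 < L"
    and S: "\<And>j. j \<in> I \<Longrightarrow> 0 < S j" "\<And>j. j \<in> I \<Longrightarrow> (\<integral>\<^sup>+x\<in>Q. ennreal (s j x) \<partial>lebesgue) = ennreal (L * S j)"
    and Y_ge: "\<And>j. j \<in> I \<Longrightarrow> AE x in lebesgue. x \<in> Q \<longrightarrow>
        ennreal (s j x) * wmean lebesgue (s j) (\<kappa> j) Q (\<lambda>x. ennreal (H x)) \<le> ennreal (Y x)"
    and H_ge: "\<And>j. j \<in> I \<Longrightarrow> AE x in lebesgue. x \<in> Q \<longrightarrow>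
        ennreal (s j x) * wmean lebesgue (s j) (\<kappa> j) Q (\<lambda>x. ennreal (Y x)) \<le> ennreal (C * H x)"
    and C: "0 < C"
  shows "(\<Prod>j\<in>I. avg (b j) Q (\<lambda>x. s j x powr a j * H x powr (b j - a j)))
    \<le> ennreal (C powr \<Delta> * (\<Prod>j\<in>I. S j powr a j) powr g)"
proof -
  note [measurable] = s(1) HY(1,2) Q(1)
  have Q0: "emeasure lebesgue Q \<noteq> 0" and mQ: "measure lebesgue Q = L"
    using Q by (auto simp: measure_def)
  have \<kappa>1: "1 < \<kappa> j" if "j \<in> I" for j
    using \<kappa>[OF that] a[OF that] g(1) e(3) by (auto simp: field_simps)
  \<comment> \<open>The mean does not depend on the point, so the domination at one point of
    \<open>Q\<close>, where \<open>s j\<close> is positive, already makes it finite.\<close>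
  have fin: "wmean lebesgue (s j) (\<kappa> j) Q A < \<infinity>"
    if jA: "j \<in> I" "AE x in lebesgue. x \<in> Q \<longrightarrow> ennreal (s j x) * wmean lebesgue (s j) (\<kappa> j) Q A \<le> ennreal (B x)"
    for j A and B :: "'a \<Rightarrow> real"
  proof -
    obtain x where "ennreal (s j x) * wmean lebesgue (s j) (\<kappa> j) Q A \<le> ennreal (B x)"
      using AE_on_imp_ex[OF jA(2) Q(1) Q0] by blast
    then have "ennreal (s j x) * wmean lebesgue (s j) (\<kappa> j) Q A < \<top>"
      by (rule order.strict_trans1) simp
    then show ?thesis using s(2)[OF jA(1), of x] by (auto simp: ennreal_mult_less_top)
  qed
  have "\<exists>n>0. wmean lebesgue (s j) (\<kappa> j) Q (\<lambda>x. ennreal (H x)) = ennreal n \<and>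
      (\<integral>\<^sup>+x\<in>Q. ennreal (H x powr (1 / \<kappa> j) * s j x powr (1 - 1 / \<kappa> j)) \<partial>lebesgue) = ennreal (n powr (1 / \<kappa> j) * (L * S j))"
    if j: "j \<in> I" for j
    by (rule wmean_real[OF _ s(1)[OF j] HY(1) Q(1) s(2)[OF j] _ Q0 S(2)[OF j] _ fin[OF j Y_ge[OF j]] less_imp_le[OF HY(3)]])
      (use \<kappa>1[OF j] HY(3) Q(3) S(1)[OF j] in simp_all)
  from bchoice[OF ballI[OF this]] obtain n where "\<forall>j\<in>I. 0 < n j \<and> wmean lebesgue (s j) (\<kappa> j) Q (\<lambda>x. ennreal (H x)) = ennreal (n j) \<and>
      (\<integral>\<^sup>+x\<in>Q. ennreal (H x powr (1 / \<kappa> j) * s j x powr (1 - 1 / \<kappa> j)) \<partial>lebesgue) = ennreal (n j powr (1 / \<kappa> j) * (L * S j))"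
    by (rule exE)
  then have n: "\<And>j. j \<in> I \<Longrightarrow> 0 < n j"
      "\<And>j. j \<in> I \<Longrightarrow> wmean lebesgue (s j) (\<kappa> j) Q (\<lambda>x. ennreal (H x)) = ennreal (n j)"
      "\<And>j. j \<in> I \<Longrightarrow> (\<integral>\<^sup>+x\<in>Q. ennreal (H x powr (1 / \<kappa> j) * s j x powr (1 - 1 / \<kappa> j)) \<partial>lebesgue)
          = ennreal (n j powr (1 / \<kappa> j) * (L * S j))"
    by simp_all
  have Y_ge': "AE x in lebesgue. x \<in> Q \<longrightarrow> s j x * n j \<le> Y x" if j: "j \<in> I" for j
    using Y_ge[OF j]
  proof eventually_elim
    case (elim x)
    then show ?case
      using n(1)[OF j] s(2)[OF j, of x] HY(4)[of x] unfolding n(2)[OF j]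
      by (auto simp flip: ennreal_mult)
  qed
  obtain i0 where i0: "i0 \<in> I" using e by fastforce
  have Y_pos: "AE x in lebesgue. x \<in> Q \<longrightarrow> 0 < Y x"
    using Y_ge'[OF i0]
  proof eventually_elim
    case (elim x)
    have "0 < s i0 x * n i0" using n(1)[OF i0] s(2)[OF i0, of x] by simp
    then show ?case using elim by linarith
  qed
  have "\<exists>n>0. wmean lebesgue (s j) (\<kappa> j) Q (\<lambda>x. ennreal (Y x)) = ennreal n \<and>
      (\<integral>\<^sup>+x\<in>Q. ennreal (Y x powr (1 / \<kappa> j) * s j x powr (1 - 1 / \<kappa> j)) \<partial>lebesgue) = ennreal (n powr (1 / \<kappa> j) * (L * S j))"
    if j: "j \<in> I" for j
    by (rule wmean_real[OF _ s(1)[OF j] HY(2) Q(1) s(2)[OF j] Y_pos Q0 S(2)[OF j] _ fin[OF j H_ge[OF j]] HY(4)])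
      (use \<kappa>1[OF j] Q(3) S(1)[OF j] in simp_all)
  from bchoice[OF ballI[OF this]] obtain \<nu> where "\<forall>j\<in>I. 0 < \<nu> j \<and> wmean lebesgue (s j) (\<kappa> j) Q (\<lambda>x. ennreal (Y x)) = ennreal (\<nu> j) \<and>
      (\<integral>\<^sup>+x\<in>Q. ennreal (Y x powr (1 / \<kappa> j) * s j x powr (1 - 1 / \<kappa> j)) \<partial>lebesgue) = ennreal (\<nu> j powr (1 / \<kappa> j) * (L * S j))"
    by (rule exE)
  then have \<nu>: "\<And>j. j \<in> I \<Longrightarrow> 0 < \<nu> j"
      "\<And>j. j \<in> I \<Longrightarrow> wmean lebesgue (s j) (\<kappa> j) Q (\<lambda>x. ennreal (Y x)) = ennreal (\<nu> j)"
      "\<And>j. j \<in> I \<Longrightarrow> (\<integral>\<^sup>+x\<in>Q. ennreal (Y x powr (1 / \<kappa> j) * s j x powr (1 - 1 / \<kappa> j)) \<partial>lebesgue)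
          = ennreal (\<nu> j powr (1 / \<kappa> j) * (L * S j))"
    by simp_all
  have H_ge': "AE x in lebesgue. x \<in> Q \<longrightarrow> s j x * \<nu> j \<le> C * H x" if j: "j \<in> I" for j
    using H_ge[OF j]
  proof eventually_elim
    case (elim x)
    then show ?case
      using \<nu>(1)[OF j] s(2)[OF j, of x] HY(3)[of x] C unfolding \<nu>(2)[OF j]
      by (auto simp flip: ennreal_mult)
  qed
  \<comment> \<open>Of the exponents (g - 1) a_j in prod_j s_j^((g-1) a_j) = 1, the positive part of
    b_j - a_j is spent on s_j n_j <= Y, and c_j remains. It is nonnegative because b_j <= g a_j,
    hence usable in Hoelder's inequality; this is how \<open>g\<close> becomes the maximum of the
    ratios.\<close>
  define c where "c j = (g - 1) * a j - e a b j" for j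
  have c: "0 \<le> c j" if "j \<in> I" for j
    using g a[OF that] g(2)[OF that] unfolding c_def e_def by (auto simp: max_def algebra_simps)
  define P where "P = (\<Prod>j\<in>I. S j powr c j)"
  define \<mu> where "\<mu> = (\<Prod>j\<in>I. n j powr e a b j)"
  have P: "0 < P" unfolding P_def by (intro prod_pos) (simp add: S(1)[THEN less_imp_neq, THEN not_sym])
  have \<mu>: "0 < \<mu>" unfolding \<mu>_def by (intro prod_pos) (simp add: n(1)[THEN less_imp_neq, THEN not_sym])
  \<comment> \<open>The Hoelder step: it bounds \<nu>_k from below by (\<mu> / P)^(1/\<Delta>) /
    S_k, where \<mu> contains all the means n_j that have to cancel.\<close>
  have key: "\<mu> \<le> (\<nu> k * S k) powr \<Delta> * P" if k: "k \<in> I" "b k \<le> a k" for k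
  proof -
    \<comment> \<open>The second branch of \<kappa> is designed for this identity; here the positive
      part of b_k - a_k is 0.\<close>
    have ck: "\<Delta> * \<kappa> k = \<Delta> + c k"
      using \<kappa>[OF k(1)] k(2) e(3) unfolding c_def e_def by (auto simp: field_simps)
    \<comment> \<open>At index \<open>k\<close> the integrand of the mean of \<open>Y\<close>
      replaces s_k. Its power \<Delta> \<kappa>_k is Y^\<Delta> s_k^(c_k), which supplies the power
      of \<open>Y\<close> and keeps the factor s_k^(c_k).\<close>
    define f where "f j x = (if j = k then Y x powr (1 / \<kappa> k) * s k x powr (1 - 1 / \<kappa> k) else s j x)" for j x
    define F where "F j = (if j = k then \<nu> k powr (1 / \<kappa> k) * S k else S j)" for j
    define cc where "cc j = (if j = k then \<Delta> * \<kappa> k else c j)" for j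
    have split: "(\<Prod>j\<in>I. (if j = k then A else z j) powr cc j) = A powr (\<Delta> * \<kappa> k) * (\<Prod>j\<in>I-{k}. z j powr c j)"
      for A and z :: "'i \<Rightarrow> real"
      using I k unfolding cc_def by (subst prod.remove[of I k]) (auto intro!: prod.cong)
    have joined: "(\<Prod>j\<in>I. z j powr c j) = z k powr c k * (\<Prod>j\<in>I-{k}. z j powr c j)" for z :: "'i \<Rightarrow> real"
      using I k by (subst prod.remove[of I k]) auto
    have \<kappa>k: "1 < \<kappa> k" by (rule \<kappa>1[OF k(1)])
    have "\<mu> \<le> (\<Prod>j\<in>I. F j powr cc j)"
    proof (rule geometric_mean_averages_ge[where f=f and M=lebesgue and Q=Q and L=L])
      show "0 \<le> cc j" if "j \<in> I" for j using c[OF that] e(3) \<kappa>k unfolding cc_def by simp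
      show "0 < sum cc I"
        using I k c e(3) \<kappa>k unfolding cc_def by (intro sum_pos2[of I k]) auto
      show "f j \<in> borel_measurable lebesgue" if "j \<in> I" for j
        using that k unfolding f_def[abs_def] by (cases "j = k") auto
      show "0 \<le> f j x" if "j \<in> I" for j x
        using s(2)[OF that, of x] unfolding f_def by (auto simp: less_imp_le)
      show "0 < F j" if "j \<in> I" for j using S(1)[OF that] \<nu>(1)[OF k(1)] k(1) S(1) unfolding F_def by auto
      show "(\<integral>\<^sup>+x\<in>Q. ennreal (f j x) \<partial>lebesgue) \<le> ennreal (L * F j)" if "j \<in> I" for j
        using that S(2)[OF that] \<nu>(3)[OF k(1)] unfolding f_def F_def
        by (cases "j = k") (auto simp: mult_ac)
      have "AE x in lebesgue. \<forall>j\<in>I. x \<in> Q \<longrightarrow> s j x * n j \<le> Y x"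
        using I Y_ge' by (intro AE_finite_allI)
      then show "AE x in lebesgue. x \<in> Q \<longrightarrow> \<mu> \<le> (\<Prod>j\<in>I. f j x powr cc j)"
        using Y_pos
      proof (eventually_elim, intro impI)
        fix x assume "\<forall>j\<in>I. x \<in> Q \<longrightarrow> s j x * n j \<le> Y x" "x \<in> Q \<longrightarrow> 0 < Y x" "x \<in> Q"
        then have x: "\<And>j. j \<in> I \<Longrightarrow> s j x * n j \<le> Y x" "0 < Y x" by auto
        have "(Y x powr (1 / \<kappa> k) * s k x powr (1 - 1 / \<kappa> k)) powr (\<Delta> * \<kappa> k) = Y x powr \<Delta> * s k x powr c k"
        proof -
          have "(1 - 1 / \<kappa> k) * (\<Delta> * \<kappa> k) = c k" using ck \<kappa>k by (simp add: field_simps)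
          then show ?thesis
            using x(2) s(2)[OF k(1), of x] \<kappa>k by (simp add: powr_mult powr_powr)
        qed
        then have fx: "(\<Prod>j\<in>I. f j x powr cc j) = Y x powr \<Delta> * (\<Prod>j\<in>I. s j x powr c j)"
          unfolding f_def split joined by simp
        have "\<mu> = \<mu> * (\<Prod>j\<in>I. (s j x powr a j) powr (g - 1))"
          using s(3)[of x] by (simp flip: prod_powr_distrib)
        also have "(\<Prod>j\<in>I. (s j x powr a j) powr (g - 1)) = (\<Prod>j\<in>I. s j x powr e a b j * s j x powr c j)"
          unfolding c_def by (intro prod.cong refl) (simp add: powr_powr mult.commute flip: powr_add)
        also have "\<mu> * \<dots> = (\<Prod>j\<in>I. (s j x * n j) powr e a b j) * (\<Prod>j\<in>I. s j x powr c j)"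
          unfolding \<mu>_def using n(1) s(2)
          by (simp add: prod.distrib powr_mult less_imp_le mult_ac)
        also have "\<dots> \<le> (\<Prod>j\<in>I. Y x powr e a b j) * (\<Prod>j\<in>I. s j x powr c j)"
          using x n(1) s(2) unfolding e_def
          by (intro mult_right_mono prod_mono prod_nonneg conjI powr_mono2) (auto intro!: mult_nonneg_nonneg less_imp_le)
        also have "(\<Prod>j\<in>I. Y x powr e a b j) = Y x powr \<Delta>"
          using x(2) e(1) by (simp flip: powr_sum)
        finally show "\<mu> \<le> (\<Prod>j\<in>I. f j x powr cc j)" using fx by simp
      qed
    qed (use I Q \<mu> in auto)
    also have "\<dots> = (\<nu> k * S k) powr \<Delta> * P"
    proof -
      have "(\<nu> k powr (1 / \<kappa> k) * S k) powr (\<Delta> * \<kappa> k) = \<nu> k powr \<Delta> * S k powr (\<Delta> * \<kappa> k)"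
        using \<nu>(1)[OF k(1)] S(1)[OF k(1)] \<kappa>k by (simp add: powr_mult powr_powr)
      also have "\<dots> = (\<nu> k * S k) powr \<Delta> * S k powr c k"
        unfolding ck using \<nu>(1)[OF k(1)] S(1)[OF k(1)] by (simp add: powr_mult powr_add)
      finally show ?thesis unfolding F_def split P_def joined by simp
    qed
    finally show ?thesis .
  qed
  \<comment> \<open>Chosen so that C / \<nu>_j <= S_j E whenever b_j <= a_j. It does not depend on
    \<open>j\<close>, and E^\<Delta> = C^\<Delta> P / \<mu> later removes the factor \<mu>.\<close>
  define E where "E = C * (P / \<mu>) powr (1 / \<Delta>)"
  have E: "0 < E" unfolding E_def using C P \<mu> by simp
  \<comment> \<open>A form common to both kinds of indices: at least one of the two positive parts
    is 0, and the corresponding power is 1.\<close>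
  have avg: "avg (b j) Q (\<lambda>x. s j x powr a j * H x powr (b j - a j))
      \<le> ennreal (S j powr (b j + e b a j) * n j powr e a b j * E powr e b a j)" if j: "j \<in> I" for j
  proof (cases "a j < b j")
    case True
    have bj: "0 < b j" using True a[OF j] by simp
    have \<kappa>j: "\<kappa> j = b j / (b j - a j)" using True \<kappa>[OF j] by simp
    have ex: "1 / \<kappa> j = (b j - a j) / b j" "1 - 1 / \<kappa> j = a j / b j"
      using True bj a[OF j] unfolding \<kappa>j by (auto simp: field_simps)
    have "\<bar>s j x powr a j * H x powr (b j - a j)\<bar> powr (1 / b j) = H x powr (1 / \<kappa> j) * s j x powr (1 - 1 / \<kappa> j)" for x
      unfolding ex(2) unfolding ex(1) using s(2)[OF j, of x] HY(3)[of x] by (simp add: abs_mult powr_mult powr_powr)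
    then have "avg (b j) Q (\<lambda>x. s j x powr a j * H x powr (b j - a j))
        = epowr (ennreal (1 / L) * ennreal (n j powr (1 / \<kappa> j) * (L * S j))) (b j)"
      unfolding avg_def mQ using bj n(3)[OF j] by simp
    also have "ennreal (1 / L) * ennreal (n j powr (1 / \<kappa> j) * (L * S j)) = ennreal (n j powr (1 / \<kappa> j) * S j)"
      using Q(3) S(1)[OF j] by (simp flip: ennreal_mult)
    also have "epowr \<dots> (b j) = ennreal (S j powr b j * n j powr (b j - a j))"
      using S(1)[OF j] n(1)[OF j] bj unfolding ex by (simp add: powr_mult powr_powr mult.commute)
    also have "S j powr b j * n j powr (b j - a j) = S j powr (b j + e b a j) * n j powr e a b j * E powr e b a j"
      using True E unfolding e_def by (simp add: max_def)
    finally show ?thesis by simp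
  next
    case False
    have SE: "C / \<nu> j \<le> S j * E"
    proof -
      have "\<mu> / P \<le> (\<nu> j * S j) powr \<Delta>"
        using key[OF j] False P by (simp add: field_simps)
      then have "(\<mu> / P) powr (1 / \<Delta>) \<le> ((\<nu> j * S j) powr \<Delta>) powr (1 / \<Delta>)"
        using \<mu> P e(3) by (rule_tac powr_mono2) auto
      also have "\<dots> = \<nu> j * S j" using e(3) \<nu>(1)[OF j] S(1)[OF j] by (simp add: powr_powr)
      finally have "1 \<le> (\<nu> j * S j) * (P / \<mu>) powr (1 / \<Delta>)"
        using \<mu> P by (simp add: powr_divide field_simps)
      then have "C * 1 \<le> C * ((\<nu> j * S j) * (P / \<mu>) powr (1 / \<Delta>))"
        using C by (intro mult_left_mono) auto
      then show ?thesis unfolding E_def using \<nu>(1)[OF j] by (simp add: field_simps)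
    qed
    have "avg (b j) Q (\<lambda>x. s j x powr a j * H x powr (b j - a j)) \<le> ennreal ((S j * E) powr (a j - b j) * S j powr b j)"
    proof (rule avg_le_of_AE_le[where s="s j" and L=L])
      show "AE x in lebesgue. x \<in> Q \<longrightarrow> \<bar>s j x powr a j * H x powr (b j - a j)\<bar> \<le> (S j * E) powr (a j - b j) * s j x powr b j"
        using H_ge'[OF j]
      proof (eventually_elim, intro impI)
        fix x assume "x \<in> Q \<longrightarrow> s j x * \<nu> j \<le> C * H x" "x \<in> Q"
        then have "s j x / H x \<le> C / \<nu> j"
          using \<nu>(1)[OF j] HY(3)[of x] by (simp add: field_simps)
        then have le: "s j x / H x \<le> S j * E" using SE by linarith
        \<comment> \<open>Rewriting s^a H^(b-a) as (s/H)^(a-b) s^b leaves a nonnegative power of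
          s/H, to which the pointwise lower bound of \<open>H\<close> applies.\<close>
        have "\<bar>s j x powr a j * H x powr (b j - a j)\<bar> = (s j x / H x) powr (a j - b j) * s j x powr b j"
          using s(2)[OF j, of x] HY(3)[of x]
          by (simp add: abs_mult powr_divide powr_diff field_simps)
        also have "\<dots> \<le> (S j * E) powr (a j - b j) * s j x powr b j"
          using le False s(2)[OF j, of x] HY(3)[of x] by (intro mult_right_mono powr_mono2) auto
        finally show "\<bar>s j x powr a j * H x powr (b j - a j)\<bar> \<le> (S j * E) powr (a j - b j) * s j x powr b j" .
      qed
    qed (use j b s Q mQ S in auto)
    also have "(S j * E) powr (a j - b j) * S j powr b j = S j powr (b j + e b a j) * n j powr e a b j * E powr e b a j"
      using False S(1)[OF j] E n(1)[OF j] unfolding e_def by (simp add: max_def powr_mult powr_add)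
    finally show ?thesis .
  qed
  have "(\<Prod>j\<in>I. avg (b j) Q (\<lambda>x. s j x powr a j * H x powr (b j - a j)))
      \<le> (\<Prod>j\<in>I. ennreal (S j powr (b j + e b a j) * n j powr e a b j * E powr e b a j))"
    by (intro prod_mono_ennreal avg)
  also have "\<dots> = ennreal (\<Prod>j\<in>I. S j powr (b j + e b a j) * n j powr e a b j * E powr e b a j)"
    by (intro prod_ennreal) auto
  also have "(\<Prod>j\<in>I. S j powr (b j + e b a j) * n j powr e a b j * E powr e b a j)
      = (\<Prod>j\<in>I. S j powr (b j + e b a j)) * \<mu> * E powr \<Delta>"
    using E e(2) unfolding \<mu>_def prod.distrib by (simp flip: powr_sum)
  also have "E powr \<Delta> = C powr \<Delta> * (P / \<mu>)"
    unfolding E_def using C P \<mu> e(3) by (simp add: powr_mult powr_powr)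
  also have "(\<Prod>j\<in>I. S j powr (b j + e b a j)) * \<mu> * (C powr \<Delta> * (P / \<mu>)) = C powr \<Delta> * (\<Prod>j\<in>I. S j powr (b j + e b a j) * S j powr c j)"
    using \<mu> unfolding P_def by (simp add: prod.distrib)
  also have "(\<Prod>j\<in>I. S j powr (b j + e b a j) * S j powr c j) = (\<Prod>j\<in>I. (S j powr a j) powr g)"
  proof (intro prod.cong refl)
    fix j assume "j \<in> I"
    \<comment> \<open>The positive parts of a_j - b_j and b_j - a_j differ by a_j - b_j, so b_j
      disappears from the sum.\<close>
    have "b j + e b a j + c j = a j * g" unfolding c_def e_def by (simp add: max_def algebra_simps)
    then show "S j powr (b j + e b a j) * S j powr c j = (S j powr a j) powr g"
      by (simp add: powr_powr flip: powr_add)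
  qed
  also have "\<dots> = (\<Prod>j\<in>I. S j powr a j) powr g" by (rule prod_powr_distrib[symmetric])
  finally show ?thesis .
qed

section \<open>Norms with respect to the new weights\<close>

text \<open>In L^(1/q) the function H^q has norm (int H)^q. For q = 0 the powers are 1, so the
  essential supremum is covered by the same bound.\<close>

lemma Lnorm_le_powr:
  fixes g H :: "'a::euclidean_space \<Rightarrow> real"
  assumes [measurable]: "g \<in> borel_measurable lebesgue" "H \<in> borel_measurable lebesgue"
    and "0 \<le> q" "\<And>x. 0 < H x" "0 \<le> K" "0 < B"
    and le: "AE x in lebesgue. \<bar>g x\<bar> \<le> K * H x powr q" and B: "(\<integral>\<^sup>+x. ennreal (H x) \<partial>lebesgue) \<le> ennreal B"
  shows "Lnorm q g \<le> ennreal (K * B powr q)"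
proof (cases "q = 0")
  case True
  have "esssup lebesgue (\<lambda>x. ennreal \<bar>g x\<bar>) \<le> ennreal K"
    using le
  proof (intro esssup_I, measurable, eventually_elim)
    case (elim x)
    then show ?case using True assms(4)[of x] by (simp add: ennreal_leI)
  qed
  then show ?thesis unfolding Lnorm_def using True \<open>0 < B\<close> by simp
next
  case False
  then have q: "0 < q" using assms(3) by simp
  have "(\<integral>\<^sup>+x. ennreal (\<bar>g x\<bar> powr (1 / q)) \<partial>lebesgue) \<le> (\<integral>\<^sup>+x. ennreal (K powr (1 / q)) * ennreal (H x) \<partial>lebesgue)"
    using le
  proof (intro nn_integral_mono_AE, eventually_elim)
    case (elim x)
    have "\<bar>g x\<bar> powr (1 / q) \<le> (K * H x powr q) powr (1 / q)"
      using elim q by (intro powr_mono2) auto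
    also have "\<dots> = K powr (1 / q) * H x"
      using q assms(4)[of x] \<open>0 \<le> K\<close> by (simp add: powr_mult powr_powr)
    finally show ?case using assms(4)[of x] by (simp add: ennreal_leI flip: ennreal_mult)
  qed
  also have "\<dots> \<le> ennreal (K powr (1 / q)) * ennreal B"
    using B by (simp add: nn_integral_cmult mult_left_mono)
  also have "\<dots> = ennreal (K powr (1 / q) * B)" using \<open>0 < B\<close> by (simp flip: ennreal_mult)
  finally have "epowr (\<integral>\<^sup>+x. ennreal (\<bar>g x\<bar> powr (1 / q)) \<partial>lebesgue) q \<le> epowr (ennreal (K powr (1 / q) * B)) q"
    using q by (intro epowr_mono) auto
  also have "\<dots> = ennreal (K * B powr q)" using q \<open>0 < B\<close> \<open>0 \<le> K\<close> by (simp add: powr_mult powr_powr)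
  finally show ?thesis unfolding Lnorm_def using q by simp
qed

text \<open>Finiteness carries measurability with it because \<open>Lnorm\<close> is infinite on
  nonmeasurable functions.\<close>

lemma wnorm_finiteD:
  fixes f w :: "'a::euclidean_space \<Rightarrow> real"
  assumes "wnorm p w f < \<infinity>"
  shows "(\<lambda>x. f x * w x) \<in> borel_measurable lebesgue"
    and "p \<noteq> 0 \<Longrightarrow> \<exists>I\<ge>0. (\<integral>\<^sup>+x. ennreal (\<bar>f x * w x\<bar> powr (1 / p)) \<partial>lebesgue) = ennreal I \<and> wnorm p w f = ennreal (I powr p)"
proof -
  show m: "(\<lambda>x. f x * w x) \<in> borel_measurable lebesgue"
    using assms unfolding wnorm_def Lnorm_def by (auto split: if_splits)
  assume p: "p \<noteq> 0"
  then have eq: "wnorm p w f = epowr (\<integral>\<^sup>+x. ennreal (\<bar>f x * w x\<bar> powr (1 / p)) \<partial>lebesgue) p"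
    using m unfolding wnorm_def Lnorm_def by simp
  show "\<exists>I\<ge>0. (\<integral>\<^sup>+x. ennreal (\<bar>f x * w x\<bar> powr (1 / p)) \<partial>lebesgue) = ennreal I \<and> wnorm p w f = ennreal (I powr p)"
    using assms unfolding eq by (cases "\<integral>\<^sup>+x. ennreal (\<bar>f x * w x\<bar> powr (1 / p)) \<partial>lebesgue") auto
qed

text \<open>\<open>p\<close> and \<open>q\<close> are reciprocals, so q < p raises the exponent.
  With I the integral of |f w|^(1/p), the domination gives |f w| <= I^p H^p, so the reweighted
  function is at most I^p H^q, and I^p is the old norm. This includes q = 0.\<close>

lemma wnorm_reweight_up:
  fixes f w H :: "'a::euclidean_space \<Rightarrow> real"
  assumes "0 \<le> q" "q < p" and fin: "wnorm p w f < \<infinity>"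
    and [measurable]: "H \<in> borel_measurable lebesgue" and H: "\<And>x. 0 < H x"
    and le: "AE x in lebesgue. \<bar>f x * w x\<bar> powr (1 / p)
        \<le> enn2real (\<integral>\<^sup>+x. ennreal (\<bar>f x * w x\<bar> powr (1 / p)) \<partial>lebesgue) * H x"
    and B: "0 < B" "(\<integral>\<^sup>+x. ennreal (H x) \<partial>lebesgue) \<le> ennreal B"
  shows "wnorm q (\<lambda>x. w x * H x powr (q - p)) f \<le> wnorm p w f * ennreal (B powr q)"
proof -
  note m [measurable] = wnorm_finiteD(1)[OF fin]
  have p: "0 < p" using assms(1,2) by simp
  then obtain I where I: "0 \<le> I" "(\<integral>\<^sup>+x. ennreal (\<bar>f x * w x\<bar> powr (1 / p)) \<partial>lebesgue) = ennreal I"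
      "wnorm p w f = ennreal (I powr p)"
    using wnorm_finiteD(2)[OF fin] by auto
  have "Lnorm q (\<lambda>x. f x * w x * H x powr (q - p)) \<le> ennreal (I powr p * B powr q)"
  proof (rule Lnorm_le_powr)
    show "AE x in lebesgue. \<bar>f x * w x * H x powr (q - p)\<bar> \<le> I powr p * H x powr q"
      using le
    proof eventually_elim
      case (elim x)
      then have "(\<bar>f x * w x\<bar> powr (1 / p)) powr p \<le> (I * H x) powr p"
        using p I by (rule_tac powr_mono2) auto
      then have "\<bar>f x * w x\<bar> \<le> I powr p * H x powr p"
        using p I(1) H[of x] by (simp add: powr_powr powr_mult)
      then have "\<bar>f x * w x\<bar> * H x powr (q - p) \<le> I powr p * H x powr p * H x powr (q - p)"
        by (intro mult_right_mono) auto
      also have "\<dots> = I powr p * H x powr q" by (simp add: mult.assoc flip: powr_add)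
      finally show ?case by (simp add: abs_mult)
    qed
  qed (use assms H B in auto)
  then show ?thesis
    unfolding wnorm_def[of q] I(3) by (simp add: mult.assoc ennreal_mult)
qed

text \<open>For 0 < p < q this is Hoelder's inequality between |f w|^(1/p) and \<open>H\<close> with
  weights p/q and (q-p)/q, so the integral of \<open>H\<close> is enough here.\<close>

lemma wnorm_reweight_down:
  fixes f w H :: "'a::euclidean_space \<Rightarrow> real"
  assumes "0 \<le> p" "p \<le> q" and fin: "wnorm p w f < \<infinity>"
    and [measurable]: "H \<in> borel_measurable lebesgue" and H: "\<And>x. 0 < H x"
    and B: "0 < B" "(\<integral>\<^sup>+x. ennreal (H x) \<partial>lebesgue) \<le> ennreal B"
  shows "wnorm q (\<lambda>x. w x * H x powr (q - p)) f \<le> wnorm p w f * ennreal (B powr (q - p))"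
proof -
  note m [measurable] = wnorm_finiteD(1)[OF fin]
  consider "p = q" | "p = 0" "0 < q" | "0 < p" "p < q" using assms(1,2) by linarith
  then show ?thesis
  proof cases
    case 1
    then show ?thesis using H B by (simp add: less_imp_neq[THEN not_sym])
  next
    case 2
    have eq: "wnorm p w f = esssup lebesgue (\<lambda>x. ennreal \<bar>f x * w x\<bar>)"
      unfolding wnorm_def Lnorm_def using 2 by simp
    obtain N where N: "wnorm p w f = ennreal N" "0 \<le> N" using fin by (cases "wnorm p w f") auto
    have "Lnorm q (\<lambda>x. f x * w x * H x powr q) \<le> ennreal (N * B powr q)"
    proof (rule Lnorm_le_powr)
      show "AE x in lebesgue. \<bar>f x * w x * H x powr q\<bar> \<le> N * H x powr q"
        using esssup_AE[of "\<lambda>x. ennreal \<bar>f x * w x\<bar>" lebesgue] unfolding eq[symmetric] N(1)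
      proof eventually_elim
        case (elim x)
        then have "\<bar>f x * w x\<bar> \<le> N" using N(2) by simp
        then have "\<bar>f x * w x\<bar> * H x powr q \<le> N * H x powr q" by (intro mult_right_mono) auto
        then show ?case by (simp add: abs_mult)
      qed
    qed (use 2 H B N in auto)
    then show ?thesis
      unfolding wnorm_def[of q] N(1) using 2 N by (simp add: mult.assoc ennreal_mult)
  next
    case 3
    then obtain I where I: "0 \<le> I" "(\<integral>\<^sup>+x. ennreal (\<bar>f x * w x\<bar> powr (1 / p)) \<partial>lebesgue) = ennreal I"
        "wnorm p w f = ennreal (I powr p)"
      using wnorm_finiteD(2)[OF fin] by auto
    have pw: "\<bar>f x * (w x * H x powr (q - p))\<bar> powr (1 / q)
        = (\<bar>f x * w x\<bar> powr (1 / p)) powr (p / q) * H x powr ((q - p) / q)" for x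
      using 3 by (simp add: abs_mult powr_mult powr_powr)
    have "(\<integral>\<^sup>+x. ennreal (\<bar>f x * (w x * H x powr (q - p))\<bar> powr (1 / q)) \<partial>lebesgue)
        \<le> ennreal (I powr (p / q) * B powr ((q - p) / q))"
    \<comment> \<open>The Hoelder lemma asks for positive bounds, so a vanishing norm is handled
      directly.\<close>
    proof (cases "I = 0")
      case True
      then have "AE x in lebesgue. ennreal (\<bar>f x * w x\<bar> powr (1 / p)) = 0"
        using I(2) nn_integral_0_iff_AE[of "\<lambda>x. ennreal (\<bar>f x * w x\<bar> powr (1 / p))" lebesgue] by simp
      then have "AE x in lebesgue. ennreal (\<bar>f x * (w x * H x powr (q - p))\<bar> powr (1 / q)) = 0"
        unfolding pw by eventually_elim (auto simp: ennreal_eq_0_iff)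
      then have "(\<integral>\<^sup>+x. ennreal (\<bar>f x * (w x * H x powr (q - p))\<bar> powr (1 / q)) \<partial>lebesgue) = (\<integral>\<^sup>+x. 0 \<partial>(lebesgue :: 'a measure))"
        by (rule nn_integral_cong_AE)
      then show ?thesis by simp
    next
      case False
      define u where "u b x = (if b then \<bar>f x * w x\<bar> powr (1 / p) else H x)" for b x
      define U where "U b = (if b then I else B)" for b
      define \<theta> where "\<theta> b = (if b then p / q else (q - p) / q)" for b
      have "(\<integral>\<^sup>+x. ennreal (\<Prod>b\<in>UNIV. u b x powr \<theta> b) \<partial>lebesgue) \<le> ennreal (\<Prod>b\<in>UNIV. U b powr \<theta> b)"
      proof (rule nn_integral_prod_powr_le)
        show "(\<Sum>b\<in>UNIV. \<theta> b) = 1" using 3 by (simp add: \<theta>_def UNIV_bool add_divide_distrib[symmetric])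
        show "u b \<in> borel_measurable lebesgue" for b unfolding u_def[abs_def] by (cases b) auto
        show "(\<integral>\<^sup>+x. ennreal (u b x) \<partial>lebesgue) \<le> ennreal (U b)" for b
          using I B unfolding u_def U_def by (cases b) auto
      qed (use 3 H I B False in \<open>auto simp: u_def U_def \<theta>_def less_imp_le\<close>)
      then show ?thesis unfolding pw by (simp add: UNIV_bool u_def U_def \<theta>_def mult.commute)
    qed
    then have "epowr (\<integral>\<^sup>+x. ennreal (\<bar>f x * (w x * H x powr (q - p))\<bar> powr (1 / q)) \<partial>lebesgue) q
        \<le> epowr (ennreal (I powr (p / q) * B powr ((q - p) / q))) q"
      using 3 by (intro epowr_mono) auto
    also have "\<dots> = ennreal (I powr p * B powr (q - p))"
      using 3 I(1) B(1) by (simp add: powr_mult powr_powr)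
    also have "\<dots> = wnorm p w f * ennreal (B powr (q - p))" unfolding I(3) by (simp add: ennreal_mult)
    finally show ?thesis
      unfolding wnorm_def[of q] Lnorm_def using 3 by (simp add: mult.assoc[symmetric])
  qed
qed

section \<open>Characteristic and norms of the reweighted tuple\<close>

lemma avg_subset_le:
  fixes V :: "'a::euclidean_space \<Rightarrow> real"
  assumes "0 \<le> b" and [measurable]: "V \<in> borel_measurable lebesgue" "Q \<in> sets lebesgue" "Q' \<in> sets lebesgue"
    and sub: "Q \<subseteq> R" "AE x in lebesgue. x \<in> R \<longleftrightarrow> x \<in> Q'"
    and c: "0 < measure lebesgue Q" "0 < measure lebesgue Q'" "measure lebesgue Q' \<le> c * measure lebesgue Q"
  shows "avg b Q V \<le> ennreal (c powr b) * avg b Q' V"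
proof -
  have ae: "AE x in lebesgue. x \<in> Q \<longrightarrow> x \<in> Q'" using sub(2) by eventually_elim (use sub(1) in auto)
  have "0 < c * measure lebesgue Q" using c(2,3) by linarith
  then have c0: "0 < c" using c(1) by (rule zero_less_mult_pos2)
  show ?thesis
  proof (cases "b = 0")
    case True
    have "esssup lebesgue (\<lambda>x. ennreal (indicator Q x * \<bar>V x\<bar>)) \<le> esssup lebesgue (\<lambda>x. ennreal (indicator Q' x * \<bar>V x\<bar>))"
      using ae by (intro esssup_AE_mono, measurable, eventually_elim) (auto simp: indicator_def)
    then show ?thesis unfolding avg_def using True c0 by simp
  next
    case False
    then have b: "0 < b" using assms(1) by simp
    have "(\<integral>\<^sup>+x\<in>Q. ennreal (\<bar>V x\<bar> powr (1 / b)) \<partial>lebesgue) \<le> (\<integral>\<^sup>+x\<in>Q'. ennreal (\<bar>V x\<bar> powr (1 / b)) \<partial>lebesgue)"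
      using ae by (intro nn_integral_mono_AE, eventually_elim) (auto simp: indicator_def)
    moreover have "ennreal (1 / measure lebesgue Q) \<le> ennreal (c * (1 / measure lebesgue Q'))"
      using c by (intro ennreal_leI) (simp add: field_simps)
    ultimately have "ennreal (1 / measure lebesgue Q) * (\<integral>\<^sup>+x\<in>Q. ennreal (\<bar>V x\<bar> powr (1 / b)) \<partial>lebesgue)
        \<le> ennreal (c * (1 / measure lebesgue Q')) * (\<integral>\<^sup>+x\<in>Q'. ennreal (\<bar>V x\<bar> powr (1 / b)) \<partial>lebesgue)"
      by (intro mult_mono) auto
    also have "\<dots> = ennreal c * (ennreal (1 / measure lebesgue Q') * (\<integral>\<^sup>+x\<in>Q'. ennreal (\<bar>V x\<bar> powr (1 / b)) \<partial>lebesgue))"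
      using c0 by (simp only: ennreal_mult' less_imp_le mult.assoc)
    finally have "epowr (ennreal (1 / measure lebesgue Q) * (\<integral>\<^sup>+x\<in>Q. ennreal (\<bar>V x\<bar> powr (1 / b)) \<partial>lebesgue)) b
        \<le> epowr (ennreal c * (ennreal (1 / measure lebesgue Q') * (\<integral>\<^sup>+x\<in>Q'. ennreal (\<bar>V x\<bar> powr (1 / b)) \<partial>lebesgue))) b"
      using b by (intro epowr_mono) auto
    also have "\<dots> = ennreal (c powr b) * epowr (ennreal (1 / measure lebesgue Q') * (\<integral>\<^sup>+x\<in>Q'. ennreal (\<bar>V x\<bar> powr (1 / b)) \<partial>lebesgue)) b"
      using b c0 by (subst epowr_mult) auto
    finally show ?thesis unfolding avg_def using b by simp
  qed
qed

lemma wmean_cong_set_AE: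
  assumes "AE x in M. x \<in> R \<longleftrightarrow> x \<in> Q"
  shows "wmean M s \<kappa> R G = wmean M s \<kappa> Q G"
proof -
  have "AE x in M. indicator R x = (indicator Q x :: ennreal)"
    using assms by eventually_elim (auto simp: indicator_def)
  then have "(\<integral>\<^sup>+y\<in>R. A y \<partial>M) = (\<integral>\<^sup>+y\<in>Q. A y \<partial>M)" for A
    by (intro nn_integral_cong_AE) auto
  then show ?thesis unfolding wmean_def by simp
qed

text \<open>As 0 * top = 0 in \<open>ennreal\<close>, a finite product alone does not bound its
  factors. Positivity of the weights makes every average nonzero, so each one is finite and comes
  from a positive real mean.\<close>

lemma avg_weights_real:
  fixes w :: "'i \<Rightarrow> 'a::euclidean_space \<Rightarrow> real"
  assumes "finite I" and a: "\<And>j. j \<in> I \<Longrightarrow> 0 < a j" and w: "\<And>j. j \<in> I \<Longrightarrow> weight (w j)"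
    and Q: "Q \<in> cubes" and fin: "(\<Prod>j\<in>I. avg (a j) Q (\<lambda>x. 1 / w j x)) < \<infinity>"
  obtains S where "\<And>j. j \<in> I \<Longrightarrow> 0 < S j"
    "\<And>j. j \<in> I \<Longrightarrow> (\<integral>\<^sup>+x\<in>Q. ennreal ((1 / w j x) powr (1 / a j)) \<partial>lebesgue) = ennreal (measure lebesgue Q * S j)"
    "(\<Prod>j\<in>I. avg (a j) Q (\<lambda>x. 1 / w j x)) = ennreal (\<Prod>j\<in>I. S j powr a j)"
proof -
  note Qm = cube_measure[OF Q]
  note [measurable] = Qm(1)
  define L where "L = measure lebesgue Q"
  have L: "0 < L" "emeasure lebesgue Q = ennreal L"
    using Qm unfolding L_def by (auto simp: emeasure_eq_ennreal_measure)
  define T where "T j = (\<integral>\<^sup>+x\<in>Q. ennreal ((1 / w j x) powr (1 / a j)) \<partial>lebesgue)" for j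
  have avg: "avg (a j) Q (\<lambda>x. 1 / w j x) = epowr (ennreal (1 / L) * T j) (a j)" if "j \<in> I" for j
  proof -
    have "\<bar>1 / w j x\<bar> = 1 / w j x" for x using w[OF that] unfolding weight_def by (simp add: less_imp_le)
    then show ?thesis unfolding avg_def T_def L_def using a[OF that] by simp
  qed
  have T0: "T j \<noteq> 0" if j: "j \<in> I" for j
  proof
    have [measurable]: "w j \<in> borel_measurable lebesgue" using w[OF j] unfolding weight_def by simp
    assume "T j = 0"
    then have "AE x in lebesgue. ennreal ((1 / w j x) powr (1 / a j)) * indicator Q x = 0"
      unfolding T_def by (subst (asm) nn_integral_0_iff_AE) auto
    then have "AE x in lebesgue. x \<in> Q \<longrightarrow> False"
    proof eventually_elim
      case (elim x)
      have "0 < w j x" using w[OF j] unfolding weight_def by simp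
      then show ?case using elim by (auto simp: ennreal_eq_0_iff indicator_def split: if_splits)
    qed
    from AE_on_imp_ex[OF this Qm(1)] show False using L by simp
  qed
  have avg0: "avg (a j) Q (\<lambda>x. 1 / w j x) \<noteq> 0" if j: "j \<in> I" for j
  proof (cases "T j")
    case (real r)
    then show ?thesis unfolding avg[OF j] using T0[OF j] L a[OF j] by (simp flip: ennreal_mult)
  next
    case top
    then show ?thesis unfolding avg[OF j] using L by (simp add: ennreal_mult_top)
  qed
  have Tfin: "T j \<noteq> \<top>" if j: "j \<in> I" for j
  proof
    assume "T j = \<top>"
    then have "avg (a j) Q (\<lambda>x. 1 / w j x) = \<top>" unfolding avg[OF j] using L by (simp add: ennreal_mult_top)
    then have "(\<Prod>j\<in>I. avg (a j) Q (\<lambda>x. 1 / w j x)) = \<top>"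
      using avg0 j \<open>finite I\<close> by (auto simp: ennreal_prod_eq_top)
    then show False using fin by simp
  qed
  define S where "S j = enn2real (T j) / L" for j
  have TS: "T j = ennreal (L * S j)" "0 < S j" if "j \<in> I" for j
    using Tfin[OF that] T0[OF that] L unfolding S_def by (cases "T j"; auto simp: less_le)+
  have "avg (a j) Q (\<lambda>x. 1 / w j x) = ennreal (S j powr a j)" if "j \<in> I" for j
    unfolding avg[OF that] TS(1)[OF that] using L TS(2)[OF that] by (simp flip: ennreal_mult)
  then have "(\<Prod>j\<in>I. avg (a j) Q (\<lambda>x. 1 / w j x)) = ennreal (\<Prod>j\<in>I. S j powr a j)"
    by (simp add: prod_ennreal)
  then show thesis using that[of S] TS unfolding T_def L_def by blast
qed

text \<open>The estimate is made on a closed cube that agrees almost everywhere with a cell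
  containing the given cube: domination is known on cells, and the characteristic of
  \<open>w\<close> on closed cubes. Returning to the given cube costs \<open>6 ^ DIM('a)\<close> to
  the power sum_j b_j.\<close>

lemma Achar_reweight_le:
  fixes w :: "nat \<Rightarrow> 'a::euclidean_space \<Rightarrow> real" and H Y :: "'a \<Rightarrow> real" and ip iq ir a b :: "nat \<Rightarrow> real"
  defines "a \<equiv> \<lambda>j. ir j - ip j" and "b \<equiv> \<lambda>j. ir j - iq j"
  assumes a: "\<And>j. j \<le> m \<Longrightarrow> 0 < a j" and b: "\<And>j. j \<le> m \<Longrightarrow> 0 \<le> b j"
    and e: "(\<Sum>j\<le>m. max (b j - a j) 0) = \<Delta>" "(\<Sum>j\<le>m. max (a j - b j) 0) = \<Delta>" "0 < \<Delta>"
    and g: "1 < g" "\<And>j. j \<le> m \<Longrightarrow> b j \<le> g * a j"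
    and \<kappa>: "\<And>j. \<kappa> j = (if a j < b j then b j / (b j - a j) else 1 + (g - 1) * a j / \<Delta>)"
    and w: "\<And>j. j \<le> m \<Longrightarrow> weight (w j)" "\<And>x. (\<Prod>j\<le>m. w j x) = 1" "Achar m ip ir w < \<infinity>"
    and HY: "H \<in> borel_measurable lebesgue" "Y \<in> borel_measurable lebesgue" "\<And>x. 0 < H x" "\<And>x. 0 \<le> Y x"
    and Y_ge: "\<And>j. j \<le> m \<Longrightarrow> dominates (\<lambda>x. (1 / w j x) powr (1 / a j)) (\<kappa> j) H Y"
    and H_ge: "\<And>j. j \<le> m \<Longrightarrow> dominates (\<lambda>x. (1 / w j x) powr (1 / a j)) (\<kappa> j) Y (\<lambda>x. C * H x)"
    and C: "0 < C"
  shows "Achar m iq ir (\<lambda>j x. w j x * H x powr (iq j - ip j))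
    \<le> ennreal ((6 ^ DIM('a)) powr (\<Sum>j\<le>m. b j) * C powr \<Delta>) * epowr (Achar m ip ir w) g"
proof -
  define s where "s j x = (1 / w j x) powr (1 / a j)" for j x
  define V where "V j x = s j x powr a j * H x powr (b j - a j)" for j x
  have wpos: "0 < w j x" if "j \<le> m" for j x using w(1)[OF that] unfolding weight_def by simp
  have wm [measurable]: "w j \<in> borel_measurable lebesgue" if "j \<le> m" for j using w(1)[OF that] unfolding weight_def by simp
  note [measurable] = HY(1,2)
  have sm [measurable]: "s j \<in> borel_measurable lebesgue" if "j \<le> m" for j
    unfolding s_def[abs_def] using that by measurable
  have spos: "0 < s j x" if "j \<le> m" for j x using wpos[OF that, of x] unfolding s_def by simp
  have sa: "s j x powr a j = 1 / w j x" if "j \<le> m" for j x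
    using wpos[OF that, of x] a[OF that] unfolding s_def by (simp add: powr_powr)
  have VW: "(\<lambda>x. 1 / (w j x * H x powr (iq j - ip j))) = V j" if "j \<le> m" for j
  proof
    fix x
    have "b j - a j = - (iq j - ip j)" unfolding a_def b_def by simp
    then show "1 / (w j x * H x powr (iq j - ip j)) = V j x"
      unfolding V_def sa[OF that] by (simp only: powr_minus) (simp add: field_simps)
  qed
  have prod_s: "(\<Prod>j\<le>m. s j x powr a j) = 1" for x
  proof -
    have "(\<Prod>j\<le>m. s j x powr a j) = (\<Prod>j\<le>m. 1 / w j x)" by (intro prod.cong) (auto simp: sa)
    then show ?thesis using w(2)[of x] by (simp add: prod_dividef)
  qed
  define c where "c = (6::real) ^ DIM('a)"
  have c: "0 < c" unfolding c_def by simp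
  show ?thesis
    unfolding Achar_def[of m iq]
  proof (rule SUP_least)
    fix Q0 :: "'a set" assume Q0: "Q0 \<in> cubes"
    obtain R Q where R: "R \<in> grids" "Q0 \<subseteq> R" "Q \<in> cubes" "AE x in lebesgue. x \<in> R \<longleftrightarrow> x \<in> Q"
      "measure lebesgue Q \<le> c * measure lebesgue Q0"
      by (rule cube_subset_grids[OF Q0, folded c_def])
    note Qm = cube_measure[OF R(3)]
    define L where "L = measure lebesgue Q"
    have L: "0 < L" "emeasure lebesgue Q = ennreal L"
      using Qm unfolding L_def by (auto simp: emeasure_eq_ennreal_measure)
    have le: "(\<Prod>j\<le>m. avg (a j) Q (\<lambda>x. 1 / w j x)) \<le> Achar m ip ir w"
      unfolding Achar_def a_def using R(3) by (rule SUP_upper)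
    then have fin: "(\<Prod>j\<le>m. avg (a j) Q (\<lambda>x. 1 / w j x)) < \<infinity>"
      using w(3) by (rule order.strict_trans1)
    obtain S where S: "\<And>j. j \<in> {..m} \<Longrightarrow> 0 < S j"
        "\<And>j. j \<in> {..m} \<Longrightarrow> (\<integral>\<^sup>+x\<in>Q. ennreal ((1 / w j x) powr (1 / a j)) \<partial>lebesgue) = ennreal (measure lebesgue Q * S j)"
        "(\<Prod>j\<le>m. avg (a j) Q (\<lambda>x. 1 / w j x)) = ennreal (\<Prod>j\<le>m. S j powr a j)"
      by (rule avg_weights_real[of "{..m}" a w Q]) (use a w R fin in auto)
    have est: "(\<Prod>j\<le>m. avg (b j) Q (V j)) \<le> ennreal (C powr \<Delta> * (\<Prod>j\<le>m. S j powr a j) powr g)"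
      unfolding V_def[abs_def]
    proof (rule avg_prod_le[where s=s and H=H and Y=Y and L=L and \<kappa>=\<kappa>])
      fix j assume j: "j \<in> {..m}"
      have "AE x in lebesgue. x \<in> R \<longrightarrow> ennreal (s j x) * wmean lebesgue (s j) (\<kappa> j) Q (\<lambda>x. ennreal (H x)) \<le> ennreal (Y x)"
        using Y_ge[of j] j R(1) unfolding s_def[abs_def] dominates_def wmean_cong_set_AE[OF R(4), symmetric] by simp
      then show "AE x in lebesgue. x \<in> Q \<longrightarrow> ennreal (s j x) * wmean lebesgue (s j) (\<kappa> j) Q (\<lambda>x. ennreal (H x)) \<le> ennreal (Y x)"
        using R(4) by eventually_elim auto
      have "AE x in lebesgue. x \<in> R \<longrightarrow> ennreal (s j x) * wmean lebesgue (s j) (\<kappa> j) Q (\<lambda>x. ennreal (Y x)) \<le> ennreal (C * H x)"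
        using H_ge[of j] j R(1) unfolding s_def[abs_def] dominates_def wmean_cong_set_AE[OF R(4), symmetric] by simp
      then show "AE x in lebesgue. x \<in> Q \<longrightarrow> ennreal (s j x) * wmean lebesgue (s j) (\<kappa> j) Q (\<lambda>x. ennreal (Y x)) \<le> ennreal (C * H x)"
        using R(4) by eventually_elim auto
      show "(\<integral>\<^sup>+x\<in>Q. ennreal (s j x) \<partial>lebesgue) = ennreal (L * S j)"
        using S(2)[OF j] unfolding s_def L_def by simp
    qed (use a b e g \<kappa> sm spos prod_s HY Qm L S C in simp_all)
    have "(\<Prod>j\<le>m. avg (ir j - iq j) Q0 (\<lambda>x. 1 / (w j x * H x powr (iq j - ip j))))
        = (\<Prod>j\<le>m. avg (b j) Q0 (V j))"
      by (intro prod.cong refl) (simp add: VW b_def)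
    also have "\<dots> \<le> (\<Prod>j\<le>m. ennreal (c powr b j) * avg (b j) Q (V j))"
    proof (intro prod_mono_ennreal)
      fix j assume "j \<in> {..m}"
      then have j: "j \<le> m" by simp
      have "V j \<in> borel_measurable lebesgue" unfolding V_def[abs_def] using sm[OF j] by measurable
      then show "avg (b j) Q0 (V j) \<le> ennreal (c powr b j) * avg (b j) Q (V j)"
        using b[OF j] cube_measure[OF Q0] Qm R by (intro avg_subset_le) auto
    qed
    also have "\<dots> = ennreal (c powr (\<Sum>j\<le>m. b j)) * (\<Prod>j\<le>m. avg (b j) Q (V j))"
      using c by (simp add: prod.distrib prod_ennreal powr_sum)
    also have "\<dots> \<le> ennreal (c powr (\<Sum>j\<le>m. b j)) * ennreal (C powr \<Delta> * (\<Prod>j\<le>m. S j powr a j) powr g)"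
      by (intro mult_left_mono est) simp
    also have "\<dots> = ennreal (c powr (\<Sum>j\<le>m. b j) * C powr \<Delta>) * epowr (ennreal (\<Prod>j\<le>m. S j powr a j)) g"
      by (simp add: ennreal_mult prod_nonneg mult.assoc)
    also have "\<dots> \<le> ennreal (c powr (\<Sum>j\<le>m. b j) * C powr \<Delta>) * epowr (Achar m ip ir w) g"
      using le g(1) unfolding S(3) by (intro mult_left_mono epowr_mono) auto
    finally show "(\<Prod>j\<le>m. avg (ir j - iq j) Q0 (\<lambda>x. 1 / (w j x * H x powr (iq j - ip j))))
        \<le> ennreal ((6 ^ DIM('a)) powr (\<Sum>j\<le>m. b j) * C powr \<Delta>) * epowr (Achar m ip ir w) g"
      unfolding c_def .
  qed
qed

lemma wnorm_prod_reweight_le: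
  fixes w f :: "nat \<Rightarrow> 'a::euclidean_space \<Rightarrow> real" and H :: "'a \<Rightarrow> real" and ip iq :: "nat \<Rightarrow> real"
  assumes ip: "\<And>j. j \<le> m \<Longrightarrow> 0 \<le> ip j" "(\<Sum>j\<le>m. ip j) = 1"
    and iq: "\<And>j. j \<le> m \<Longrightarrow> 0 \<le> iq j" "(\<Sum>j\<le>m. iq j) = 1"
    and fin: "\<And>j. j \<le> m \<Longrightarrow> wnorm (ip j) (w j) (f j) < \<infinity>"
    and H: "H \<in> borel_measurable lebesgue" "\<And>x. 0 < H x"
    and le: "\<And>j. j \<le> m \<Longrightarrow> iq j < ip j \<Longrightarrow> AE x in lebesgue. \<bar>f j x * w j x\<bar> powr (1 / ip j)
        \<le> enn2real (\<integral>\<^sup>+x. ennreal (\<bar>f j x * w j x\<bar> powr (1 / ip j)) \<partial>lebesgue) * H x"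
    and B: "1 \<le> B" "(\<integral>\<^sup>+x. ennreal (H x) \<partial>lebesgue) \<le> ennreal B"
  shows "(\<Prod>j\<le>m. wnorm (iq j) (\<lambda>x. w j x * H x powr (iq j - ip j)) (f j))
    \<le> ennreal B * (\<Prod>j\<le>m. wnorm (ip j) (w j) (f j))"
proof -
  \<comment> \<open>The power of \<open>B\<close> lost at index \<open>j\<close>. Both tuples have
    sum 1, so the r_j add up to the sum of \<open>ip j\<close> over \<open>iq j < ip j\<close>,
    which is at most 1; as B >= 1, the total loss is at most \<open>B\<close>.\<close>
  define r where "r j = (if iq j < ip j then iq j else iq j - ip j)" for j
  have r: "r j = (iq j - ip j) + (if iq j < ip j then ip j else 0)" for j
    unfolding r_def by simp
  have sum_r: "(\<Sum>j\<le>m. r j) \<le> 1"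
  proof -
    have "(\<Sum>j\<le>m. r j) = (\<Sum>j\<le>m. if iq j < ip j then ip j else 0)"
      unfolding r using ip iq by (simp add: sum.distrib sum_subtractf)
    also have "\<dots> \<le> (\<Sum>j\<le>m. ip j)" using ip by (intro sum_mono) auto
    finally show ?thesis using ip by simp
  qed
  have "(\<Prod>j\<le>m. wnorm (iq j) (\<lambda>x. w j x * H x powr (iq j - ip j)) (f j))
      \<le> (\<Prod>j\<le>m. wnorm (ip j) (w j) (f j) * ennreal (B powr r j))"
  proof (intro prod_mono_ennreal)
    fix j assume "j \<in> {..m}"
    then have j: "j \<le> m" by simp
    show "wnorm (iq j) (\<lambda>x. w j x * H x powr (iq j - ip j)) (f j) \<le> wnorm (ip j) (w j) (f j) * ennreal (B powr r j)"
    proof (cases "iq j < ip j")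
      case True
      then show ?thesis
        using wnorm_reweight_up[OF iq(1)[OF j] True fin[OF j] H le[OF j True] _ B(2)] B(1)
        unfolding r_def by simp
    next
      case False
      then show ?thesis
        using wnorm_reweight_down[OF ip(1)[OF j] _ fin[OF j] H _ B(2), of "iq j"] B(1)
        unfolding r_def by simp
    qed
  qed
  also have "\<dots> = (\<Prod>j\<le>m. wnorm (ip j) (w j) (f j)) * ennreal (B powr (\<Sum>j\<le>m. r j))"
    using B by (simp add: prod.distrib prod_ennreal powr_sum)
  also have "\<dots> \<le> (\<Prod>j\<le>m. wnorm (ip j) (w j) (f j)) * ennreal B"
  proof (intro mult_left_mono ennreal_leI)
    show "B powr (\<Sum>j\<le>m. r j) \<le> B" using powr_mono[OF sum_r B(1)] B(1) by simp
  qed simp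
  finally show ?thesis by (simp add: mult.commute)
qed

section \<open>Normalised majorants and the conclusion\<close>

text \<open>The f_j may vanish on large sets, while \<open>H\<close> must be positive everywhere to
  have negative powers; a small positive function is added for this purpose.\<close>

lemma ex_positive_integrable:
  fixes \<epsilon> :: real assumes "0 < \<epsilon>"
  obtains h :: "'a::euclidean_space \<Rightarrow> ennreal" where "h \<in> borel_measurable lebesgue" "\<And>x. 0 < h x"
    "(\<integral>\<^sup>+x. h x \<partial>lebesgue) \<le> ennreal \<epsilon>"
proof -
  obtain h :: "'a \<Rightarrow> ennreal" where h [measurable]: "h \<in> borel_measurable lborel"
      and h': "(\<integral>\<^sup>+x. h x \<partial>lborel) \<noteq> \<infinity>" "\<And>x. 0 < h x"
    using sigma_finite_measure.Ex_finite_integrable_function[OF sigma_finite_lborel] by auto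
  obtain K where K: "(\<integral>\<^sup>+x. h x \<partial>lborel) = ennreal K" "0 \<le> K"
    using h'(1) by (cases "\<integral>\<^sup>+x. h x \<partial>lborel") auto
  show thesis
  proof
    show "(\<lambda>x. h x * ennreal (\<epsilon> / (K + 1))) \<in> borel_measurable lebesgue"
      by (intro measurable_completion) measurable
    show "0 < h x * ennreal (\<epsilon> / (K + 1))" for x
      using h'(2)[of x] assms K(2) by (simp add: ennreal_zero_less_mult_iff)
    have "(\<integral>\<^sup>+x. h x * ennreal (\<epsilon> / (K + 1)) \<partial>lebesgue) = ennreal K * ennreal (\<epsilon> / (K + 1))"
      using K by (simp add: nn_integral_completion nn_integral_multc)
    also have "\<dots> = ennreal (K * (\<epsilon> / (K + 1)))" using K assms by (simp flip: ennreal_mult)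
    also have "\<dots> \<le> ennreal \<epsilon>"
      using K assms by (intro ennreal_leI) (simp add: field_simps)
    finally show "(\<integral>\<^sup>+x. h x * ennreal (\<epsilon> / (K + 1)) \<partial>lebesgue) \<le> ennreal \<epsilon>" .
  qed
qed

text \<open>Normalising makes the bound on the mass of \<open>h\<close> depend on the number of
  functions only. The estimate is stated for every real t above h x, so that it passes to any
  real-valued function dominating \<open>h\<close> almost everywhere.\<close>

lemma ex_normalized_majorant:
  fixes u :: "'i \<Rightarrow> 'a::euclidean_space \<Rightarrow> real"
  assumes U: "finite U" and u: "\<And>j. j \<in> U \<Longrightarrow> u j \<in> borel_measurable lebesgue" "\<And>j x. j \<in> U \<Longrightarrow> 0 \<le> u j x"
    and fin: "\<And>j. j \<in> U \<Longrightarrow> (\<integral>\<^sup>+x. ennreal (u j x) \<partial>lebesgue) < \<infinity>"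
  obtains h where "h \<in> borel_measurable lebesgue" "\<And>x. 0 < h x"
    "(\<integral>\<^sup>+x. h x \<partial>lebesgue) \<le> ennreal (card U + 1 / 2)"
    "\<And>j. j \<in> U \<Longrightarrow> AE x in lebesgue. \<forall>t. h x \<le> ennreal t \<longrightarrow>
        u j x \<le> enn2real (\<integral>\<^sup>+x. ennreal (u j x) \<partial>lebesgue) * t"
proof -
  obtain h0 :: "'a \<Rightarrow> ennreal" where h0 [measurable]: "h0 \<in> borel_measurable lebesgue"
      and h0': "\<And>x. 0 < h0 x" "(\<integral>\<^sup>+x. h0 x \<partial>lebesgue) \<le> ennreal (1 / 2)"
    using ex_positive_integrable[of "1 / 2"] by auto
  define N where "N j = enn2real (\<integral>\<^sup>+x. ennreal (u j x) \<partial>lebesgue)" for j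
  have N: "(\<integral>\<^sup>+x. ennreal (u j x) \<partial>lebesgue) = ennreal (N j)" "0 \<le> N j" if "j \<in> U" for j
    using fin[OF that] unfolding N_def by auto
  note [measurable] = u(1)
  \<comment> \<open>If \<open>N j = 0\<close> the summand is 0 (division by zero), but then \<open>u j\<close> vanishes almost everywhere.\<close>
  define h where "h x = h0 x + (\<Sum>j\<in>U. ennreal (u j x / N j))" for x
  show thesis
  proof
    show "h \<in> borel_measurable lebesgue" unfolding h_def[abs_def] by measurable
    show "0 < h x" for x unfolding h_def using h0'(1)[of x] by (simp add: add_pos_nonneg)
    have one: "(\<integral>\<^sup>+x. ennreal (u j x / N j) \<partial>lebesgue) \<le> 1" if j: "j \<in> U" for j
    proof -
      have "(\<integral>\<^sup>+x. ennreal (u j x / N j) \<partial>lebesgue) = (\<integral>\<^sup>+x. ennreal (1 / N j) * ennreal (u j x) \<partial>lebesgue)"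
        using u(2)[OF j] N(2)[OF j] by (intro nn_integral_cong) (simp flip: ennreal_mult)
      also have "\<dots> = ennreal (1 / N j) * ennreal (N j)"
        using N(1)[OF j] u(1)[OF j] by (simp add: nn_integral_cmult)
      also have "\<dots> = ennreal (1 / N j * N j)"
        using N(2)[OF j] by (intro ennreal_mult[symmetric]) auto
      also have "\<dots> \<le> 1" by (cases "N j = 0") auto
      finally show ?thesis .
    qed
    have "(\<integral>\<^sup>+x. h x \<partial>lebesgue) = (\<integral>\<^sup>+x. h0 x \<partial>lebesgue) + (\<Sum>j\<in>U. \<integral>\<^sup>+x. ennreal (u j x / N j) \<partial>lebesgue)"
      unfolding h_def by (subst nn_integral_add) (auto simp: nn_integral_sum)
    also have "\<dots> \<le> ennreal (1 / 2) + (\<Sum>j\<in>U. 1)"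
      using one h0'(2) by (intro add_mono sum_mono) auto
    also have "\<dots> = ennreal (card U + 1 / 2)"
      by (simp add: ennreal_plus add.commute flip: ennreal_of_nat_eq_real_of_nat)
    finally show "(\<integral>\<^sup>+x. h x \<partial>lebesgue) \<le> ennreal (card U + 1 / 2)" .
    fix j assume j: "j \<in> U"
    show "AE x in lebesgue. \<forall>t. h x \<le> ennreal t \<longrightarrow> u j x \<le> enn2real (\<integral>\<^sup>+x. ennreal (u j x) \<partial>lebesgue) * t"
    proof (cases "N j = 0")
      case True
      then have "AE x in lebesgue. ennreal (u j x) = 0"
        using N(1)[OF j] u(1)[OF j] by (subst nn_integral_0_iff_AE[symmetric]) auto
      then show ?thesis
        unfolding N_def[symmetric] True by eventually_elim (auto simp: ennreal_eq_0_iff)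
    next
      case False
      then have Nj: "0 < N j" using N(2)[OF j] by simp
      have "u j x \<le> N j * t" if "h x \<le> ennreal t" for x t
      proof -
        have "ennreal (u j x / N j) \<le> (\<Sum>j\<in>U. ennreal (u j x / N j))"
          using j U by (intro member_le_sum) auto
        also have "\<dots> \<le> h x" unfolding h_def by simp
        also have "\<dots> \<le> ennreal t" by (rule that)
        finally have "ennreal (u j x / N j) \<le> ennreal t" .
        moreover have "0 < t"
        proof (rule ccontr)
          assume "\<not> 0 < t"
          then have "h x \<le> 0" using that by (simp add: ennreal_neg)
          then show False unfolding h_def using h0'(1)[of x] by simp
        qed
        ultimately have "u j x / N j \<le> t" by simp
        then show ?thesis using Nj by (simp add: field_simps)
      qed
      then show ?thesis unfolding N_def[symmetric] by simp
    qed
  qed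
qed

theorem theorem3p1:
  fixes m :: nat and ip ir iq :: "nat \<Rightarrow> real"
  assumes ir: "\<forall>j\<le>m. 0 < ir j \<and> ir j \<le> 1"
    and ip: "\<forall>j\<le>m. 0 \<le> ip j \<and> ip j \<le> 1 \<and> ip j < ir j"
    and ipsum: "(\<Sum>j\<le>m. ip j) = 1"
    and iq: "\<forall>j\<le>m. 0 \<le> iq j \<and> iq j \<le> 1 \<and> iq j \<le> ir j"
    and iqsum: "(\<Sum>j\<le>m. iq j) = 1"
  shows "\<exists>C::real. C > 0 \<and>
    (\<forall>(w :: nat \<Rightarrow> 'a::euclidean_space \<Rightarrow> real) (f :: nat \<Rightarrow> 'a \<Rightarrow> real).
       (\<forall>j\<le>m. weight (w j)) \<longrightarrow> (\<forall>x. (\<Prod>j\<le>m. w j x) = 1) \<longrightarrow>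
       Achar m ip ir w < \<infinity> \<longrightarrow>
       (\<forall>j\<le>m. wnorm (ip j) (w j) (f j) < \<infinity>) \<longrightarrow>
       (\<exists>W :: nat \<Rightarrow> 'a \<Rightarrow> real.
          (\<forall>j\<le>m. weight (W j)) \<and> (\<forall>x. (\<Prod>j\<le>m. W j x) = 1) \<and>
          Achar m iq ir W < \<infinity> \<and>
          (\<Prod>j\<le>m. wnorm (iq j) (W j) (f j))
            \<le> ennreal (2 ^ (m ^ 2)) * (\<Prod>j\<le>m. wnorm (ip j) (w j) (f j)) \<and>
          Achar m iq ir W
            \<le> ennreal C * epowr (Achar m ip ir w)
                 (Max ((\<lambda>j. (ir j - iq j) / (ir j - ip j)) ` {..m}))))"
proof (cases "\<exists>j\<le>m. iq j < ip j")
  case False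
  \<comment> \<open>With equal sums the two tuples coincide on {..m}. Then W = w works with constant
    1, and every ratio, hence the exponent, is 1.\<close>
  then have le: "ip j \<le> iq j" if "j \<le> m" for j using that by force
  have "(\<Sum>j\<le>m. iq j - ip j) = 0" using ipsum iqsum by (simp add: sum_subtractf)
  then have eq: "iq j = ip j" if "j \<le> m" for j
    using le that by (subst (asm) sum_nonneg_eq_0_iff) auto
  have img: "(\<lambda>j. (ir j - iq j) / (ir j - ip j)) ` {..m} = {1}"
  proof -
    have "(ir j - iq j) / (ir j - ip j) = 1" if "j \<le> m" for j
      using eq[OF that] ip[rule_format, OF that] by simp
    then have "(\<lambda>j. (ir j - iq j) / (ir j - ip j)) ` {..m} = (\<lambda>j. 1) ` {..m}"
      by (intro image_cong refl) (simp only: atMost_iff)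
    then show ?thesis using image_constant[of 0 "{..m}" "1::real"] by simp
  qed
  have Aeq: "Achar m iq ir w = Achar m ip ir w" for w :: "nat \<Rightarrow> 'a \<Rightarrow> real"
    unfolding Achar_def using eq by (intro SUP_cong prod.cong) auto
  have Neq: "(\<Prod>j\<le>m. wnorm (iq j) (w j) (f j)) = (\<Prod>j\<le>m. wnorm (ip j) (w j) (f j))" for w f :: "nat \<Rightarrow> 'a \<Rightarrow> real"
    using eq by (intro prod.cong) auto
  have "1 * X \<le> ennreal (2 ^ (m ^ 2)) * X" for X
    by (intro mult_right_mono) (auto simp: one_le_power simp flip: ennreal_1)
  then show ?thesis
    unfolding img Max_singleton Aeq Neq by (intro exI[of _ 1] conjI allI impI) auto
next
  case True
  define a where "a = (\<lambda>j. ir j - ip j)"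
  define b where "b = (\<lambda>j. ir j - iq j)"
  define g where "g = Max ((\<lambda>j. b j / a j) ` {..m})"
  define U where "U = {j. j \<le> m \<and> iq j < ip j}"
  obtain i where i: "i \<le> m" "iq i < ip i" using True by blast
  have a: "0 < a j" if "j \<le> m" for j using ip that unfolding a_def by auto
  have b: "0 \<le> b j" if "j \<le> m" for j using iq that unfolding b_def by auto
  have bg: "b j \<le> g * a j" if "j \<le> m" for j
  proof -
    have "b j / a j \<le> g" unfolding g_def using that by (intro Max_ge) auto
    then show ?thesis using a[OF that] by (simp add: field_simps)
  qed
  \<comment> \<open>An index with 1/q_i < 1/p_i has ratio above 1. Strictness makes \<kappa>_j > 1
    at the indices with b_j <= a_j.\<close>
  have g: "1 < g"
  proof -
    have "1 * a i < g * a i" using bg[OF i(1)] i(2) unfolding a_def b_def by simp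
    then show ?thesis using a[OF i(1)] by simp
  qed
  \<comment> \<open>Both tuples have the same sum, so the positive and the negative part of b - a
    have the same total and one \<Delta> serves for both.\<close>
  define \<Delta> where "\<Delta> = (\<Sum>j\<le>m. max (b j - a j) 0)"
  have \<Delta>': "(\<Sum>j\<le>m. max (a j - b j) 0) = \<Delta>"
  proof -
    have "\<Delta> - (\<Sum>j\<le>m. max (a j - b j) 0) = (\<Sum>j\<le>m. ip j - iq j)"
      unfolding \<Delta>_def sum_subtractf[symmetric] a_def b_def by (intro sum.cong) auto
    then show ?thesis using ipsum iqsum by (simp add: sum_subtractf)
  qed
  have \<Delta>: "0 < \<Delta>"
    unfolding \<Delta>_def using i by (intro sum_pos2[of _ i]) (auto simp: a_def b_def)
  \<comment> \<open>The first branch makes |s^a H^(b-a)|^(1/b) equal to H^(1/\<kappa>) s^(1 -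
    1/\<kappa>), the integrand of a weighted mean. As \<kappa> is built from the exponents alone,
    \<open>C\<close> and \<open>K\<close> can be fixed before weights and functions.\<close>
  define \<kappa> where "\<kappa> j = (if a j < b j then b j / (b j - a j) else 1 + (g - 1) * a j / \<Delta>)" for j
  have \<kappa>1: "1 < \<kappa> j" if "j \<in> {..m}" for j
    using a[of j] g \<Delta> that unfolding \<kappa>_def by (auto simp: field_simps)
  define C where "C = majorant_const TYPE('a) {..m} \<kappa>"
  have C: "0 < C" unfolding C_def using \<kappa>1 by (intro majorant_const_pos) auto
  define K where "K = (6 ^ DIM('a)) powr (\<Sum>j\<le>m. b j) * C powr \<Delta>"
  \<comment> \<open>The equal sums prevent all m + 1 indices from satisfying 1/q_j < 1/p_j, so at
    most \<open>m\<close> functions have to be dominated.\<close>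
  have U: "finite U" "card U \<le> m" "1 \<le> m"
  proof -
    have sub: "U \<subseteq> {..m}" unfolding U_def by auto
    then show "finite U" by (rule finite_subset) simp
    have "U \<noteq> {..m}"
    proof
      assume "U = {..m}"
      then have "(\<Sum>j\<le>m. iq j) < (\<Sum>j\<le>m. ip j)" unfolding U_def by (intro sum_strict_mono) auto
      then show False using ipsum iqsum by simp
    qed
    then have "U \<subset> {..m}" using sub by blast
    then have "card U < card {..m}" by (intro psubset_card_mono) auto
    then show "card U \<le> m" by simp
    moreover have "card U \<noteq> 0" using i \<open>finite U\<close> unfolding U_def by auto
    ultimately show "1 \<le> m" by simp
  qed
  show ?thesis
  proof (intro exI[of _ K] conjI allI impI)
    show "0 < K" unfolding K_def using C by simp
    fix w f :: "nat \<Rightarrow> 'a \<Rightarrow> real"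
    assume w: "\<forall>j\<le>m. weight (w j)" "\<forall>x. (\<Prod>j\<le>m. w j x) = 1" "Achar m ip ir w < \<infinity>"
      and f: "\<forall>j\<le>m. wnorm (ip j) (w j) (f j) < \<infinity>"
    have wpos: "0 < w j x" if "j \<le> m" for j x using w(1) that unfolding weight_def by simp
    have wm: "w j \<in> borel_measurable lebesgue" if "j \<le> m" for j using w(1) that unfolding weight_def by simp
    have U_iff: "j \<in> U \<longleftrightarrow> j \<le> m \<and> iq j < ip j" for j unfolding U_def by simp
    obtain h where h: "h \<in> borel_measurable lebesgue" "\<And>x. 0 < h x"
        "(\<integral>\<^sup>+x. h x \<partial>lebesgue) \<le> ennreal (card U + 1 / 2)"
        "\<And>j. j \<in> U \<Longrightarrow> AE x in lebesgue. \<forall>t. h x \<le> ennreal t \<longrightarrow> \<bar>f j x * w j x\<bar> powr (1 / ip j)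
          \<le> enn2real (\<integral>\<^sup>+x. ennreal (\<bar>f j x * w j x\<bar> powr (1 / ip j)) \<partial>lebesgue) * t"
    proof (rule ex_normalized_majorant[OF U(1), of "\<lambda>j x. \<bar>f j x * w j x\<bar> powr (1 / ip j)"])
      fix j assume j: "j \<in> U"
      then have fin: "wnorm (ip j) (w j) (f j) < \<infinity>" using f unfolding U_iff by simp
      have [measurable]: "(\<lambda>x. f j x * w j x) \<in> borel_measurable lebesgue" by (rule wnorm_finiteD[OF fin])
      show "(\<lambda>x. \<bar>f j x * w j x\<bar> powr (1 / ip j)) \<in> borel_measurable lebesgue" by measurable
      have "ip j \<noteq> 0" using j iq unfolding U_iff by force
      then show "(\<integral>\<^sup>+x. ennreal (\<bar>f j x * w j x\<bar> powr (1 / ip j)) \<partial>lebesgue) < \<infinity>"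
        using wnorm_finiteD(2)[OF fin] by auto
    qed auto
    have hfin: "(\<integral>\<^sup>+x. h x \<partial>lebesgue) < \<infinity>"
      using h(3) by (rule order.strict_trans1) (simp only: infinity_ennreal_def ennreal_less_top)
    define s where "s j x = (1 / w j x) powr (1 / a j)" for j x
    have sm: "s j \<in> borel_measurable lebesgue" if "j \<in> {..m}" for j
    proof -
      have [measurable]: "w j \<in> borel_measurable lebesgue" using wm[of j] that by simp
      show ?thesis unfolding s_def[abs_def] by measurable
    qed
    have spos: "0 < s j x" if "j \<in> {..m}" for j x
      using wpos[of j x] that unfolding s_def by simp
    have ne: "{..m} \<noteq> {}" by simp
    obtain H Y where HY: "H \<in> borel_measurable lebesgue" "Y \<in> borel_measurable lebesgue"
        "\<forall>x. 0 < H x" "\<forall>x. 0 \<le> Y x"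
        "(\<integral>\<^sup>+x. ennreal (H x) \<partial>lebesgue) \<le> ennreal (4 / 3) * (\<integral>\<^sup>+x. h x \<partial>lebesgue)"
        "AE x in lebesgue. h x \<le> ennreal (H x)"
        "\<forall>j\<in>{..m}. dominates (s j) (\<kappa> j) H Y"
        "\<forall>j\<in>{..m}. dominates (s j) (\<kappa> j) Y (\<lambda>x. C * H x)"
      unfolding C_def by (rule ex_dominating_majorant[OF finite_atMost ne \<kappa>1 sm spos h(1,2) hfin])
    note H0 = HY(3)[rule_format]
    \<comment> \<open>With k = card U <= m and 1 <= m, the available bound 4/3 * (k + 1/2) is at
      most 2 m.\<close>
    define B where "B = 2 * real m"
    have B: "1 \<le> B" using U(3) unfolding B_def by simp
    have HB: "(\<integral>\<^sup>+x. ennreal (H x) \<partial>lebesgue) \<le> ennreal B"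
    proof -
      have "(\<integral>\<^sup>+x. ennreal (H x) \<partial>lebesgue) \<le> ennreal (4 / 3) * ennreal (card U + 1 / 2)"
        using HY(5) h(3) by (meson mult_left_mono order_trans zero_le)
      also have "\<dots> = ennreal (4 / 3 * (card U + 1 / 2))" by (rule ennreal_mult[symmetric]) auto
      also have "\<dots> \<le> ennreal B"
        using U(2,3) unfolding B_def by (intro ennreal_leI) simp
      finally show ?thesis .
    qed
    define W where "W = (\<lambda>j x. w j x * H x powr (iq j - ip j))"
    have A: "Achar m iq ir W \<le> ennreal K * epowr (Achar m ip ir w) g"
      unfolding W_def K_def b_def
    proof (rule Achar_reweight_le[where \<kappa>=\<kappa> and Y=Y])
      show "0 < ir j - ip j" if "j \<le> m" for j using a[OF that] unfolding a_def .
      show "0 \<le> ir j - iq j" if "j \<le> m" for j using b[OF that] unfolding b_def .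
      show "(\<Sum>j\<le>m. max ((ir j - iq j) - (ir j - ip j)) 0) = \<Delta>" unfolding \<Delta>_def a_def b_def ..
      show "(\<Sum>j\<le>m. max ((ir j - ip j) - (ir j - iq j)) 0) = \<Delta>" using \<Delta>' unfolding a_def b_def .
      show "ir j - iq j \<le> g * (ir j - ip j)" if "j \<le> m" for j using bg[OF that] unfolding a_def b_def .
      show "\<kappa> j = (if ir j - ip j < ir j - iq j then (ir j - iq j) / ((ir j - iq j) - (ir j - ip j))
          else 1 + (g - 1) * (ir j - ip j) / \<Delta>)" for j
        unfolding \<kappa>_def a_def b_def ..
      show "dominates (\<lambda>x. (1 / w j x) powr (1 / (ir j - ip j))) (\<kappa> j) H Y" if "j \<le> m" for j
        using HY(7) that unfolding s_def[abs_def] a_def by simp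
      show "dominates (\<lambda>x. (1 / w j x) powr (1 / (ir j - ip j))) (\<kappa> j) Y (\<lambda>x. C * H x)" if "j \<le> m" for j
        using HY(8) that unfolding s_def[abs_def] a_def by simp
    qed (use \<Delta> g w HY C in auto)
    have norms: "(\<Prod>j\<le>m. wnorm (iq j) (W j) (f j)) \<le> ennreal B * (\<Prod>j\<le>m. wnorm (ip j) (w j) (f j))"
      unfolding W_def
    proof (rule wnorm_prod_reweight_le)
      fix j assume j: "j \<le> m" "iq j < ip j"
      then have "j \<in> U" unfolding U_iff by simp
      from h(4)[OF this] HY(6)
      show "AE x in lebesgue. \<bar>f j x * w j x\<bar> powr (1 / ip j)
        \<le> enn2real (\<integral>\<^sup>+x. ennreal (\<bar>f j x * w j x\<bar> powr (1 / ip j)) \<partial>lebesgue) * H x"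
        by eventually_elim blast
    qed (use ip iq ipsum iqsum f HY(1) H0 B HB in auto)
    show "\<exists>W :: nat \<Rightarrow> 'a \<Rightarrow> real.
          (\<forall>j\<le>m. weight (W j)) \<and> (\<forall>x. (\<Prod>j\<le>m. W j x) = 1) \<and>
          Achar m iq ir W < \<infinity> \<and>
          (\<Prod>j\<le>m. wnorm (iq j) (W j) (f j))
            \<le> ennreal (2 ^ (m ^ 2)) * (\<Prod>j\<le>m. wnorm (ip j) (w j) (f j)) \<and>
          Achar m iq ir W
            \<le> ennreal K * epowr (Achar m ip ir w)
                 (Max ((\<lambda>j. (ir j - iq j) / (ir j - ip j)) ` {..m}))"
    proof (intro exI[of _ W] conjI allI impI)
      note [measurable] = HY(1)
      show "weight (W j)" if "j \<le> m" for j
        using wm[OF that] wpos[OF that] HY(1) H0 unfolding weight_def W_def by (auto simp: less_imp_neq[THEN not_sym])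
      show "(\<Prod>j\<le>m. W j x) = 1" for x
      proof -
        have "(\<Prod>j\<le>m. W j x) = (\<Prod>j\<le>m. w j x) * H x powr (\<Sum>j\<le>m. iq j - ip j)"
          using H0[of x] unfolding W_def by (simp add: prod.distrib powr_sum)
        then show ?thesis using w(2) H0[of x] ipsum iqsum by (simp add: sum_subtractf)
      qed
      have g_eq: "g = Max ((\<lambda>j. (ir j - iq j) / (ir j - ip j)) ` {..m})" unfolding g_def a_def b_def ..
      show "Achar m iq ir W \<le> ennreal K * epowr (Achar m ip ir w) (Max ((\<lambda>j. (ir j - iq j) / (ir j - ip j)) ` {..m}))"
        using A unfolding g_eq .
      have "epowr (Achar m ip ir w) g < \<infinity>" using w(3) unfolding epowr_def by simp
      then have "ennreal K * epowr (Achar m ip ir w) g < \<infinity>" by (simp add: ennreal_mult_less_top)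
      with A show "Achar m iq ir W < \<infinity>" by (rule order.strict_trans1)
      \<comment> \<open>The passage to the constant of the statement: 2 m <= 2^m <= 2^(m^2).\<close>
      have "2 * real m \<le> 2 ^ (m ^ 2)"
      proof -
        have "m \<le> 2 ^ (m - 1)" using less_exp[of "m - 1"] by linarith
        then have "2 * m \<le> 2 ^ Suc (m - 1)" by simp
        also have "Suc (m - 1) = m" using U(3) by simp
        also have "(2::nat) ^ m \<le> 2 ^ (m ^ 2)"
          using U(3) by (intro power_increasing) (auto simp: power2_eq_square)
        finally have "real (2 * m) \<le> real (2 ^ (m ^ 2))" by (simp only: of_nat_le_iff)
        then show ?thesis by simp
      qed
      then have "ennreal B \<le> ennreal (2 ^ (m ^ 2))" unfolding B_def by (rule ennreal_leI)
      then show "(\<Prod>j\<le>m. wnorm (iq j) (W j) (f j)) \<le> ennreal (2 ^ (m ^ 2)) * (\<Prod>j\<le>m. wnorm (ip j) (w j) (f j))"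
        using norms by (meson mult_right_mono order_trans zero_le)
    qed
  qed
qed

end
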